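(* For every $n\ge1$, $[\mathrm{UVAL}_n]=[\mathrm{USAT}_n]\cap[\overline{\mathrm{USAT}}_n]$.
   Context: $\Sigma=\{0,1\}$, $\Sigma^*$ the finite nonempty binary strings; for $x\in\Sigma^m$, $\pi_1(x)=x_1$. $\mathbb{P}_+\Sigma=\{\{0\},\{1\},\Sigma\}$. A promise problem is $\phi:\Sigma^*\to\mathbb{P}_+\Sigma$. $\phi_1\propto\phi_2$ means there is a polynomial-time computable $\mu:\Sigma^*\to\Sigma^*$ with $\phi_1(x)\supseteq\phi_2(\mu(x))$ for all $x$; $[\phi]=\{\phi_1:\phi_1\propto\phi\}$. Level-$n$ problems: the input encodes (e.g. dimensions in binary plus a Boolean formula) $f:\Sigma^{m_1}\times\dots\times\Sigma^{m_n}\to\Sigma$, written $f(x,y^{(1)},\dots,y^{(n-1)})$ with $x\in\Sigma^{m_1}$; $f_x$ is $f$ with $x$ fixed. For a constant $c$, $\mathrm{SAT}_0(c)=\overline{\mathrm{SAT}}_0(c)=c$; for $n\ge1$, $\mathrm{SAT}_n(f)=1\iff\exists x:\overline{\mathrm{SAT}}_{n-1}(f_x)=1$, $\overline{\mathrm{SAT}}_n(f)=1\iff\forall x,\ \mathrm{SAT}_{n-1}(f_x)=1$; $\mathrm{USAT}_n(f)=\{\mathrm{SAT}_n(f)\}$ if $|\{x:\overline{\mathrm{SAT}}_{n-1}(f_x)=1\}|\le1$, else $\Sigma$; $\overline{\mathrm{USAT}}_n(f)=\{\overline{\mathrm{SAT}}_n(f)\}$ if $|\{x:\mathrm{SAT}_{n-1}(f_x)=0\}|\le1$,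 else $\Sigma$; $\mathrm{UVAL}_n(f)=\{\pi_1x:\overline{\mathrm{SAT}}_{n-1}(f_x)=1\}$ if there is exactly one $x$ with $\overline{\mathrm{SAT}}_{n-1}(f_x)=1$, else $\Sigma$. *)

theory Defs
  imports Main
begin

text \<open>Sigma = bool; Sigma^* = nonempty bool lists; P_+ Sigma = nonempty subsets of bool.
  A promise problem is a function bool list => bool set, nonempty-valued on nonempty strings
  (its value on the empty list is irrelevant).\<close>

type_synonym promise = "bool list \<Rightarrow> bool set"

definition promise_problem :: "promise \<Rightarrow> bool" where
  "promise_problem \<phi> \<longleftrightarrow> (\<forall>x. x \<noteq> [] \<longrightarrow> \<phi> x \<noteq> {})"

text \<open>Tape symbols are naturals: 0 = blank, 1 = bit False, 2 = bit True; further symbols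
  are allowed as work symbols. State 0 is the start state, state 1 the halting state.
  A transition function maps (state, read symbol) to (new state, written symbol, move),
  with move in {-1,0,1}.\<close>

type_synonym tm = "nat \<Rightarrow> nat \<Rightarrow> nat \<times> nat \<times> int"
type_synonym conf = "nat \<times> (int \<Rightarrow> nat) \<times> int"

definition valid_tm :: "nat \<Rightarrow> nat \<Rightarrow> tm \<Rightarrow> bool" where
  "valid_tm Q K \<delta> \<longleftrightarrow> Q \<ge> 2 \<and> K \<ge> 3 \<and>
     (\<forall>q<Q. \<forall>s<K. case \<delta> q s of (q', s', d) \<Rightarrow> q' < Q \<and> s' < K \<and> d \<in> {-1, 0, 1})"

definition bit_sym :: "bool \<Rightarrow> nat" where
  "bit_sym b = (if b then 2 else 1)"

definition tm_step :: "tm \<Rightarrow> conf \<Rightarrow> conf" where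
  "tm_step \<delta> c = (case c of (q, tp, h) \<Rightarrow>
     if q = 1 then (q, tp, h)
     else (case \<delta> q (tp h) of (q', s, d) \<Rightarrow> (q', tp(h := s), h + d)))"

definition tm_init :: "bool list \<Rightarrow> conf" where
  "tm_init x = (0, \<lambda>i. if 0 \<le> i \<and> i < int (length x) then bit_sym (x ! nat i) else 0, 0)"

definition tm_output :: "conf \<Rightarrow> bool list \<Rightarrow> bool" where
  "tm_output c y \<longleftrightarrow> (case c of (q, tp, h) \<Rightarrow>
     (\<forall>i<length y. tp (h + int i) = bit_sym (y ! i)) \<and> tp (h + int (length y)) \<notin> {1, 2})"

definition poly_time_computable :: "(bool list \<Rightarrow> bool list) \<Rightarrow> bool" where
  "poly_time_computable \<mu> \<longleftrightarrow>
     (\<exists>Q K \<delta> (c::nat) (k::nat). valid_tm Q K \<delta> \<and>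
        (\<forall>x. x \<noteq> [] \<longrightarrow>
           (\<exists>t \<le> c * length x ^ k + c.
              fst ((tm_step \<delta> ^^ t) (tm_init x)) = 1 \<and>
              tm_output ((tm_step \<delta> ^^ t) (tm_init x)) (\<mu> x))))"

definition preduces :: "promise \<Rightarrow> promise \<Rightarrow> bool" (infix "\<propto>" 50) where
  "\<phi>1 \<propto> \<phi>2 \<longleftrightarrow> (\<exists>\<mu>. poly_time_computable \<mu> \<and>
      (\<forall>x. x \<noteq> [] \<longrightarrow> \<mu> x \<noteq> [] \<and> \<phi>2 (\<mu> x) \<subseteq> \<phi>1 x))"

definition pclass :: "promise \<Rightarrow> promise set" where
  "pclass \<phi> = {\<phi>1. promise_problem \<phi>1 \<and> \<phi>1 \<propto> \<phi>}"

datatype bform = Var nat nat | Neg bform | And bform bform | Or bform bform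

fun eval :: "bform \<Rightarrow> bool list list \<Rightarrow> bool" where
  "eval (Var i j) ys = ys ! i ! j"
| "eval (Neg p) ys = (\<not> eval p ys)"
| "eval (And p q) ys = (eval p ys \<and> eval q ys)"
| "eval (Or p q) ys = (eval p ys \<or> eval q ys)"

fun vars_ok :: "nat list \<Rightarrow> bform \<Rightarrow> bool" where
  "vars_ok ms (Var i j) = (i < length ms \<and> j < ms ! i)"
| "vars_ok ms (Neg p) = vars_ok ms p"
| "vars_ok ms (And p q) = (vars_ok ms p \<and> vars_ok ms q)"
| "vars_ok ms (Or p q) = (vars_ok ms p \<and> vars_ok ms q)"

type_synonym inst = "nat list \<times> bform"

definition wf_inst :: "nat \<Rightarrow> inst \<Rightarrow> bool" where
  "wf_inst n I \<longleftrightarrow> (case I of (ms, p) \<Rightarrow>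
     length ms = n \<and> (\<forall>m\<in>set ms. m \<ge> 1) \<and> vars_ok ms p)"

text \<open>Binary encoding (dimensions and variable indices in binary, self-delimiting).\<close>
fun bin :: "nat \<Rightarrow> bool list" where
  "bin n = (if n = 0 then [] else odd n # bin (n div 2))"

definition enc_nat :: "nat \<Rightarrow> bool list" where
  "enc_nat n = concat (map (\<lambda>b. [True, b]) (bin n)) @ [False]"

fun enc_form :: "bform \<Rightarrow> bool list" where
  "enc_form (Var i j) = [False, False] @ enc_nat i @ enc_nat j"
| "enc_form (Neg p) = [False, True] @ enc_form p"
| "enc_form (And p q) = [True, False] @ enc_form p @ enc_form q"
| "enc_form (Or p q) = [True, True] @ enc_form p @ enc_form q"

definition enc_inst :: "inst \<Rightarrow> bool list" where
  "enc_inst I = (case I of (ms, p) \<Rightarrow>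
     concat (map (\<lambda>m. True # enc_nat m) ms) @ [False] @ enc_form p)"

definition decode :: "nat \<Rightarrow> bool list \<Rightarrow> inst option" where
  "decode n s = (if \<exists>I. wf_inst n I \<and> enc_inst I = s
                 then Some (THE I. wf_inst n I \<and> enc_inst I = s) else None)"

text \<open>For dimensions ms = [m1,...,mn] and f : bool list list => bool (argument blocks),
  sat ms f = SAT_n(f), nsat ms f = co-SAT_n(f); SAT_0(c) = co-SAT_0(c) = c.\<close>
fun sat :: "nat list \<Rightarrow> (bool list list \<Rightarrow> bool) \<Rightarrow> bool"
and nsat :: "nat list \<Rightarrow> (bool list list \<Rightarrow> bool) \<Rightarrow> bool" where
  "sat [] f = f []"
| "sat (m # ms) f = (\<exists>x. length x = m \<and> nsat ms (\<lambda>ys. f (x # ys)))"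
| "nsat [] f = f []"
| "nsat (m # ms) f = (\<forall>x. length x = m \<longrightarrow> sat ms (\<lambda>ys. f (x # ys)))"

definition wit_set :: "nat list \<Rightarrow> (bool list list \<Rightarrow> bool) \<Rightarrow> bool list set" where
  "wit_set ms f = {x. length x = hd ms \<and> nsat (tl ms) (\<lambda>ys. f (x # ys))}"

definition cowit_set :: "nat list \<Rightarrow> (bool list list \<Rightarrow> bool) \<Rightarrow> bool list set" where
  "cowit_set ms f = {x. length x = hd ms \<and> \<not> sat (tl ms) (\<lambda>ys. f (x # ys))}"

text \<open>Strings not encoding a level-n instance carry no promise (value Sigma).\<close>
definition USAT :: "nat \<Rightarrow> promise" where
  "USAT n s = (case decode n s of None \<Rightarrow> UNIV
     | Some (ms, p) \<Rightarrow> if card (wit_set ms (eval p)) \<le> 1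
                       then {sat ms (eval p)} else UNIV)"

definition coUSAT :: "nat \<Rightarrow> promise" where
  "coUSAT n s = (case decode n s of None \<Rightarrow> UNIV
     | Some (ms, p) \<Rightarrow> if card (cowit_set ms (eval p)) \<le> 1
                       then {nsat ms (eval p)} else UNIV)"

definition UVAL :: "nat \<Rightarrow> promise" where
  "UVAL n s = (case decode n s of None \<Rightarrow> UNIV
     | Some (ms, p) \<Rightarrow> if card (wit_set ms (eval p)) = 1
                       then hd ` wit_set ms (eval p) else UNIV)"

end

theory Submission
  imports Defs "HOL-Library.Countable"
begin

text \<open>
  If \<open>f\<close> has a unique witness, then \<open>f \<and> x\<^sub>1\<close> has at most one, and \<open>\<not> (f \<and> \<not> x\<^sub>1)\<close> has at most
  one co-witness; both evaluate to the first bit of the witness.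
  Conversely, let \<open>f\<close> and \<open>g\<close> be the USAT and coUSAT instances obtained for an input whose
  value is \<open>b\<close>. If \<open>b = 1\<close>, then \<open>f\<close> has exactly one witness and \<open>\<not> g\<close> none; if \<open>b = 0\<close>, it is
  the other way round. Hence \<open>(z\<^sub>0 \<and> f(x)) \<or> (\<not> z\<^sub>0 \<and> \<not> g(x))\<close>, with all unused bits forced to 0, has
  exactly one witness, and its first bit is \<open>b\<close>. The dimensions are given in binary and can be
  exponential, so the unused bits cannot always be listed; but then not all bits occur in
  the formula, which therefore has no unique witness and can be replaced by a contradiction.

  Polynomial time is handled through programs on finitely many stacks. They run on one tape whose
  tracks hold the stacks, they can simulate any Turing machine with two stacks, and the functions
  they compute are closed under composition and under iteration over a list with polynomially
  bounded intermediate results.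
\<close>

section \<open>Polynomial bounds\<close>

text \<open>Only the first block is subject to a promise; the later blocks matter through the truth
  of quantified statements alone. They may therefore be padded to a common length by bits that no
  formula reads, and \<open>2 ^ X - 1\<close>, with \<open>X\<close> the total length of both codes,
  is large enough and is written as \<open>X\<close> ones. The first block allows no such freedom,
  since every free bit would double the number of witnesses. There \<open>X\<close> bounds the
  number of distinct variables of either formula and thereby the dimension of an instance with a
  unique witness.

  The constructions on codes avoid arithmetic: numbers are written with the lowest bit first, so
  that doubling a positive \<open>j\<close>, or forming \<open>2 * j + 1\<close>, prefixes one bit.
  This is why witness bits go to odd positions instead of being shifted by one.

  The given reductions are arbitrary Turing machines, and two of them have to run on the same input.
  This asks for a model with several stores that can be entered from the single-tape definition and
  left towards it again; a calculus of closure properties then replaces explicit machines.\<close>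

inductive ispoly :: "(nat \<Rightarrow> nat) \<Rightarrow> bool" where
  const: "ispoly (\<lambda>_. c)"
| id: "ispoly (\<lambda>n. n)"
| add: "ispoly p \<Longrightarrow> ispoly q \<Longrightarrow> ispoly (\<lambda>n. p n + q n)"
| mult: "ispoly p \<Longrightarrow> ispoly q \<Longrightarrow> ispoly (\<lambda>n. p n * q n)"

lemma ispoly_comp: "ispoly p \<Longrightarrow> ispoly q \<Longrightarrow> ispoly (\<lambda>n. p (q n))"
  by (induction rule: ispoly.induct) (auto intro: ispoly.intros)

lemma ispoly_mono: "ispoly p \<Longrightarrow> a \<le> b \<Longrightarrow> p a \<le> p b"
  by (induction rule: ispoly.induct) (auto intro: add_mono mult_mono)

lemma ispoly_Suc: "ispoly p \<Longrightarrow> ispoly (\<lambda>n. Suc (p n))"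
  using ispoly.add[OF _ ispoly.const[of 1]] by simp

lemma ispoly_bound: "ispoly p \<Longrightarrow> \<exists>c k. \<forall>n. p n \<le> c * n ^ k + c"
proof (induction rule: ispoly.induct)
  case (const c)
  show ?case by (rule exI[of _ c], rule exI[of _ 0]) simp
next
  case id
  show ?case by (rule exI[of _ 1], rule exI[of _ 1]) simp
next
  case (add p q)
  then obtain c k d l where *: "\<And>n. p n \<le> c * n ^ k + c" "\<And>n. q n \<le> d * n ^ l + d" by blast
  have "p n + q n \<le> (2*c+2*d) * n ^ (k + l) + (2*c+2*d)" for n
  proof -
    have "n ^ k \<le> n ^ (k+l) + 1" "n ^ l \<le> n ^ (k+l) + 1"
      by (cases "n = 0"; auto simp: power_0_left intro!: le_SucI power_increasing)+
    then have "c * n ^ k \<le> c * n ^ (k+l) + c" "d * n ^ l \<le> d * n ^ (k+l) + d"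
      by (metis add_mult_distrib2 mult_le_mono2 nat_mult_1_right)+
    then show ?thesis using *[of n] by (simp add: algebra_simps)
  qed
  then show ?case by blast
next
  case (mult p q)
  then obtain c k d l where *: "\<And>n. p n \<le> c * n ^ k + c" "\<And>n. q n \<le> d * n ^ l + d" by blast
  have "p n * q n \<le> (4*c*d) * n ^ (k + l) + (4*c*d)" for n
  proof -
    have le: "n ^ k \<le> n ^ (k+l) + 1" "n ^ l \<le> n ^ (k+l) + 1"
      by (cases "n = 0"; auto simp: power_0_left intro!: le_SucI power_increasing)+
    have "p n * q n \<le> (c * n ^ k + c) * (d * n ^ l + d)" by (intro mult_mono) (auto simp: *)
    also have "\<dots> = c * d * (n ^ (k+l) + n ^ k + n ^ l + 1)" by (simp add: algebra_simps power_add)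
    also have "\<dots> \<le> c * d * (4 * n ^ (k+l) + 4)" using le by (intro mult_le_mono2) simp
    finally show ?thesis by (simp add: algebra_simps)
  qed
  then show ?case by blast
qed

lemma funpow_trans: "(f ^^ a) x = y \<Longrightarrow> (f ^^ b) y = z \<Longrightarrow> (f ^^ (a + b)) x = z"
  by (metis add.commute comp_apply funpow_add)

section \<open>Stack programs on a single tape\<close>

definition astep :: "('q \<Rightarrow> 's \<Rightarrow> 'q \<times> 's \<times> int) \<Rightarrow> 'q \<Rightarrow> 'q \<times> (int \<Rightarrow> 's) \<times> int \<Rightarrow> 'q \<times> (int \<Rightarrow> 's) \<times> int" where
  "astep \<delta> qh = (\<lambda>(q, tp, h). if q = qh then (q, tp, h)
     else case \<delta> q (tp h) of (q', s, d) \<Rightarrow> (q', tp(h := s), h + d))"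

text \<open>States and cells are renumbered injectively so that start, halt, blank and the two bits
  get their prescribed numbers, and the other \<open>to_nat\<close> codes are shifted beyond these.
  The maxima over the finite closed sets \<open>Qs\<close> and \<open>Cs\<close> then yield the
  bounds that \<open>valid_tm\<close> asks for.\<close>

lemma abstract_machine_poly_time:
  fixes \<delta> :: "'q::countable \<Rightarrow> 's::countable \<Rightarrow> 'q \<times> 's \<times> int"
  assumes fin: "finite Qs" "finite Cs" and q: "q0 \<in> Qs" "qh \<in> Qs" "q0 \<noteq> qh"
    and b: "b0 \<in> Cs" "b1 \<in> Cs" "b2 \<in> Cs" "b0 \<noteq> b1" "b0 \<noteq> b2" "b1 \<noteq> b2"
    and closed: "\<And>q s q' s' d. q \<in> Qs \<Longrightarrow> s \<in> Cs \<Longrightarrow> q \<noteq> qh \<Longrightarrow> \<delta> q s = (q', s', d) \<Longrightarrow>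
        q' \<in> Qs \<and> s' \<in> Cs \<and> d \<in> {-1, 0, 1}"
    and p: "ispoly p"
    and run: "\<And>x. x \<noteq> [] \<Longrightarrow> \<exists>t\<le>p (length x). \<exists>tp h.
        (astep \<delta> qh ^^ t) (q0, \<lambda>i. if 0 \<le> i \<and> i < int (length x)
            then if x ! nat i then b2 else b1 else b0, 0) = (qh, tp, h) \<and>
        (\<forall>i<length (\<mu> x). tp (h + int i) = (if \<mu> x ! i then b2 else b1)) \<and>
        tp (h + int (length (\<mu> x))) \<notin> {b1, b2}"
  shows "poly_time_computable \<mu>"
proof -
  define eS :: "'s \<Rightarrow> nat" where "eS s =
    (if s = b0 then 0 else if s = b1 then 1 else if s = b2 then 2 else to_nat s + 3)" for s
  define eQ :: "'q \<Rightarrow> nat" where "eQ s = (if s = q0 then 0 else if s = qh then 1 else to_nat s + 2)" for s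
  have injS: "inj eS" and injQ: "inj eQ"
    using b q by (auto simp: inj_def eS_def eQ_def)
  define K Q where "K = Max (eS ` Cs) + 3" and "Q = Max (eQ ` Qs) + 2"
  have K: "eS s < K" if "s \<in> Cs" for s
    using that fin(2) Max_ge[of "eS ` Cs" "eS s"] by (simp add: K_def le_imp_less_Suc less_SucI eval_nat_numeral)
  have Q: "eQ s < Q" if "s \<in> Qs" for s
    using that fin(1) Max_ge[of "eQ ` Qs" "eQ s"] by (simp add: Q_def le_imp_less_Suc less_SucI eval_nat_numeral)
  \<comment> \<open>Numbers that code nothing in \<open>Qs\<close> or \<open>Cs\<close>, and the
    halting state, get a harmless halting transition, because \<open>valid_tm\<close> constrains all
    numbers below the bounds.\<close>
  define \<delta>' where "\<delta>' q s = (if q \<in> eQ ` Qs \<and> s \<in> eS ` Cs \<and> q \<noteq> 1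
    then case \<delta> (inv eQ q) (inv eS s) of (q', s', d) \<Rightarrow> (eQ q', eS s', d) else (1, 0, 0))" for q s
  have valid: "valid_tm Q K \<delta>'"
    unfolding valid_tm_def
  proof (intro conjI allI impI)
    show "2 \<le> Q" "3 \<le> K" by (auto simp: Q_def K_def)
    fix q s
    show "case \<delta>' q s of (q', s', d) \<Rightarrow> q' < Q \<and> s' < K \<and> d \<in> {-1, 0, 1}"
    proof (cases "q \<in> eQ ` Qs \<and> s \<in> eS ` Cs \<and> q \<noteq> 1")
      case True
      then obtain q1 s1 where q1: "q1 \<in> Qs" "q = eQ q1" "s1 \<in> Cs" "s = eS s1" by blast
      have "q1 \<noteq> qh" using True q1 q(3) by (auto simp: eQ_def)
      obtain q' s' d where \<delta>: "\<delta> q1 s1 = (q', s', d)" by (metis prod_cases3)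
      from closed[OF q1(1,3) \<open>q1 \<noteq> qh\<close> this]
      show ?thesis using True q1 \<delta> K Q injS injQ by (simp add: \<delta>'_def)
    qed (auto simp: \<delta>'_def Q_def K_def)
  qed
  define enc where "enc = (\<lambda>(q, tp :: int \<Rightarrow> _, h :: int). (eQ q, eS \<circ> tp, h))"
  have step: "tm_step \<delta>' (enc (q, tp, h)) = enc (astep \<delta> qh (q, tp, h)) \<and>
      fst (astep \<delta> qh (q, tp, h)) \<in> Qs \<and> range (fst (snd (astep \<delta> qh (q, tp, h)))) \<subseteq> Cs"
    if "q \<in> Qs" "range tp \<subseteq> Cs" for q tp h
  proof (cases "q = qh")
    case True
    then show ?thesis using that q by (auto simp: tm_step_def enc_def astep_def eQ_def)
  next
    case False
    then have "eQ q \<noteq> 1" using q by (auto simp: eQ_def)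
    obtain q' s' d where \<delta>: "\<delta> q (tp h) = (q', s', d)" by (metis prod_cases3)
    have c: "tp h \<in> Cs" using that by blast
    have "\<delta>' (eQ q) (eS (tp h)) = (eQ q', eS s', d)"
      using that(1) c \<open>eQ q \<noteq> 1\<close> injS injQ \<delta> by (simp add: \<delta>'_def)
    then show ?thesis using False \<open>eQ q \<noteq> 1\<close> \<delta> closed[OF that(1) c False \<delta>] that(2)
      by (auto simp: tm_step_def enc_def astep_def fun_eq_iff)
  qed
  have steps: "(tm_step \<delta>' ^^ t) (enc (q, tp, h)) = enc ((astep \<delta> qh ^^ t) (q, tp, h)) \<and>
      fst ((astep \<delta> qh ^^ t) (q, tp, h)) \<in> Qs \<and> range (fst (snd ((astep \<delta> qh ^^ t) (q, tp, h)))) \<subseteq> Cs"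
    if "q \<in> Qs" "range tp \<subseteq> Cs" for t q tp h
  proof (induction t)
    case (Suc t)
    then show ?case using step
      by (cases "(astep \<delta> qh ^^ t) (q, tp, h)") auto
  qed (use that in auto)
  obtain c k where ck: "\<And>n. p n \<le> c * n ^ k + c" using ispoly_bound[OF p] by blast
  show ?thesis unfolding poly_time_computable_def
  proof (rule exI[of _ Q], rule exI[of _ K], rule exI[of _ \<delta>'], rule exI[of _ c], rule exI[of _ k],
      intro conjI allI impI valid)
    fix x :: "bool list" assume "x \<noteq> []"
    define T0 where "T0 = (\<lambda>i. if 0 \<le> i \<and> i < int (length x) then if x ! nat i then b2 else b1 else b0)"
    from run[OF \<open>x \<noteq> []\<close>] obtain t tp h where t: "t \<le> p (length x)"
      and r: "(astep \<delta> qh ^^ t) (q0, T0, 0) = (qh, tp, h)"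
      and o: "\<And>i. i < length (\<mu> x) \<Longrightarrow> tp (h + int i) = (if \<mu> x ! i then b2 else b1)"
        "tp (h + int (length (\<mu> x))) \<notin> {b1, b2}"
      by (auto simp: T0_def)
    have init: "tm_init x = enc (q0, T0, 0)"
      using b q by (auto simp: tm_init_def enc_def T0_def bit_sym_def eS_def eQ_def)
    have "range T0 \<subseteq> Cs" using b by (auto simp: T0_def)
    from steps[OF q(1) this, of t 0] have fin: "(tm_step \<delta>' ^^ t) (tm_init x) = enc (qh, tp, h)"
      by (simp add: init r)
    have out: "tm_output (enc (qh, tp, h)) (\<mu> x)"
      using o b by (auto simp: tm_output_def enc_def bit_sym_def eS_def)
    show "\<exists>t\<le>c * length x ^ k + c. fst ((tm_step \<delta>' ^^ t) (tm_init x)) = 1 \<and>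
        tm_output ((tm_step \<delta>' ^^ t) (tm_init x)) (\<mu> x)"
      using t ck[of "length x"] out q by (intro exI[of _ t]) (auto simp: fin, auto simp: enc_def eQ_def)
  qed
qed

section \<open>Syntax and small-step semantics of stack programs\<close>

datatype com = Push nat nat | Pop nat | Seq com com | Branch nat nat com com | Loop nat nat com

instance com :: countable by countable_datatype

text \<open>Reading the top of an empty stack yields 0, a value that is never pushed.\<close>

definition peek :: "nat list \<Rightarrow> nat" where
  "peek l = (case l of [] \<Rightarrow> 0 | a # _ \<Rightarrow> a)"

lemma peek_simps [simp]: "peek [] = 0" "peek (a # l) = a"
  by (simp_all add: peek_def)

type_synonym store = "nat \<Rightarrow> nat list"

fun cstep :: "com list \<times> store \<Rightarrow> com list \<times> store" where
  "cstep ([], \<sigma>) = ([], \<sigma>)"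
| "cstep (Push i a # ks, \<sigma>) = (ks, \<sigma>(i := a # \<sigma> i))"
| "cstep (Pop i # ks, \<sigma>) = (ks, \<sigma>(i := tl (\<sigma> i)))"
| "cstep (Seq c d # ks, \<sigma>) = (c # d # ks, \<sigma>)"
| "cstep (Branch i a c d # ks, \<sigma>) = ((if peek (\<sigma> i) = a then c else d) # ks, \<sigma>)"
| "cstep (Loop i a c # ks, \<sigma>) = (if peek (\<sigma> i) = a then ks else c # Loop i a c # ks, \<sigma>)"

text \<open>The continuation part of \<open>cstep\<close>, with the store reduced to the one value
  that is read. This is all that a finite control can base its next state on.\<close>

fun after :: "com list \<Rightarrow> nat \<Rightarrow> com list" where
  "after [] v = []"
| "after (Push i a # ks) v = ks"
| "after (Pop i # ks) v = ks"
| "after (Seq c d # ks) v = c # d # ks"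
| "after (Branch i a c d # ks) v = (if v = a then c else d) # ks"
| "after (Loop i a c # ks) v = (if v = a then ks else c # Loop i a c # ks)"

fun reg :: "com \<Rightarrow> nat" where
  "reg (Push i a) = i"
| "reg (Pop i) = i"
| "reg (Seq c d) = 0"
| "reg (Branch i a c d) = i"
| "reg (Loop i a c) = i"

fun okc :: "nat \<Rightarrow> nat \<Rightarrow> com \<Rightarrow> bool" where
  "okc m B (Push i a) = (i < m \<and> 0 < a \<and> a < B)"
| "okc m B (Pop i) = (i < m)"
| "okc m B (Seq c d) = (okc m B c \<and> okc m B d)"
| "okc m B (Branch i a c d) = (i < m \<and> okc m B c \<and> okc m B d)"
| "okc m B (Loop i a c) = (i < m \<and> okc m B c)"

fun wfc :: "com \<Rightarrow> bool" where
  "wfc (Push i a) = (0 < a)"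
| "wfc (Pop i) = True"
| "wfc (Seq c d) = (wfc c \<and> wfc d)"
| "wfc (Branch i a c d) = (wfc c \<and> wfc d)"
| "wfc (Loop i a c) = wfc c"

lemma okc_mono: "okc m B c \<Longrightarrow> m \<le> m' \<Longrightarrow> B \<le> B' \<Longrightarrow> okc m' B' c"
  by (induction c) auto

lemma wfc_okc: "wfc c \<Longrightarrow> \<exists>m. okc m m c"
proof (induction c)
  case (Push i a)
  then show ?case by (intro exI[of _ "Suc (i + a)"]) auto
next
  case (Pop i)
  then show ?case by (intro exI[of _ "Suc i"]) auto
next
  case (Seq c d)
  then obtain m m' where "okc m m c" "okc m' m' d" by auto
  then show ?case by (intro exI[of _ "m + m'"]) (auto intro: okc_mono)
next
  case (Branch i a c d)
  then obtain m m' where "okc m m c" "okc m' m' d" by auto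
  then show ?case by (intro exI[of _ "Suc (i + m + m')"]) (auto intro: okc_mono)
next
  case (Loop i a c)
  then obtain m where "okc m m c" by auto
  then show ?case by (intro exI[of _ "Suc (i + m)"]) (auto intro: okc_mono)
qed

text \<open>Continuations double as states of the simulating machine. Although they are lists of
  unbounded length in general, those that arise while \<open>c\<close> runs in front of
  \<open>ks\<close> lie in this finite set, since a loop only puts itself back.\<close>

fun conts :: "com \<Rightarrow> com list \<Rightarrow> com list set" where
  "conts (Push i a) ks = {Push i a # ks}"
| "conts (Pop i) ks = {Pop i # ks}"
| "conts (Seq c d) ks = {Seq c d # ks} \<union> conts c (d # ks) \<union> conts d ks"
| "conts (Branch i a c d) ks = {Branch i a c d # ks} \<union> conts c ks \<union> conts d ks"
| "conts (Loop i a c) ks = {Loop i a c # ks} \<union> conts c (Loop i a c # ks)"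

lemma finite_conts: "finite (conts c ks)"
  by (induction c arbitrary: ks) auto

lemma conts_self: "c # ks \<in> conts c ks"
  by (cases c) auto

lemma conts_after: "cs \<in> conts c ks \<Longrightarrow> after cs v \<in> insert ks (conts c ks)"
proof (induction c arbitrary: ks)
  case (Seq c d)
  then show ?case using conts_self[of c "d # ks"] conts_self[of d ks] by fastforce
next
  case (Branch i a c d)
  then show ?case using conts_self[of c ks] conts_self[of d ks] by (auto split: if_splits)
next
  case (Loop i a c)
  then show ?case using Loop.IH[of "Loop i a c # ks"] conts_self[of c "Loop i a c # ks"]
    by (auto split: if_splits)
qed auto

lemma conts_okc:
  "cs \<in> conts c ks \<Longrightarrow> okc m B c \<Longrightarrow> list_all (okc m B) ks \<Longrightarrow> list_all (okc m B) cs"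
  by (induction c arbitrary: ks) fastforce+

text \<open>The store is kept on parallel tracks: track \<open>i\<close> spells stack \<open>i\<close> from bottom to top, starting at
  the marked cell 0, so that the top of a stack is found by a search to the right for a blank.\<close>

type_synonym cell = "bool \<times> nat list"

fun track :: "nat list \<Rightarrow> int \<Rightarrow> nat" where
  "track [] j = 0"
| "track (a # l) j = (if j = int (length l) then a else track l j)"

definition layout :: "nat \<Rightarrow> store \<Rightarrow> int \<Rightarrow> cell" where
  "layout m \<sigma> j = (j = 0, map (\<lambda>i. track (\<sigma> i) j) [0..<m])"

definition blank :: "nat \<Rightarrow> cell" where
  "blank m = (False, replicate m 0)"

definition plain :: "nat \<Rightarrow> nat \<Rightarrow> cell" where
  "plain m a = (False, (replicate m 0)[0 := a])"

section \<open>The simulating machine\<close>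

datatype ctl = Init | Halt | FinSeek | FinBack | Home "com list" | Seek "com list"
  | AtTop "com list" | Back "com list"

instance ctl :: countable by countable_datatype

text \<open>A round starts and ends in \<open>Home\<close> on the marked cell: \<open>Seek\<close>
  runs right to the first blank of the addressed track, \<open>AtTop\<close> acts one cell to the
  left of it, \<open>Back\<close> returns to the mark. At the end \<open>FinSeek\<close> and
  \<open>FinBack\<close> delete the mark and all tracks but the first along the output, so that its
  cells become literally the two input symbols.\<close>

fun mach :: "nat \<Rightarrow> com \<Rightarrow> ctl \<Rightarrow> cell \<Rightarrow> ctl \<times> cell \<times> int" where
  "mach m c Init (b, l) = (Home [c], (True, l), 0)"
| "mach m c Halt (b, l) = (Halt, (b, l), 0)"
| "mach m c FinSeek (b, l) = (if l ! 0 \<noteq> 0 then (FinSeek, (b, l), 1)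
     else if b then (Halt, blank m, 0) else (FinBack, blank m, -1))"
| "mach m c FinBack (b, l) =
     (if b then Halt else FinBack, plain m (l ! 0), if b then 0 else -1)"
| "mach m c (Home cs) (b, l) =
     (case cs of [] \<Rightarrow> FinSeek | Seq d e # ks \<Rightarrow> Home (d # e # ks) | _ \<Rightarrow> Seek cs, (b, l), 0)"
| "mach m c (Seek cs) (b, l) = (if l ! reg (hd cs) \<noteq> 0 then (Seek cs, (b, l), 1)
     else case hd cs of Push i a \<Rightarrow> (Back (tl cs), (b, l[i := a]), 0)
     | _ \<Rightarrow> if b then (Back (after cs 0), (b, l), 0) else (AtTop cs, (b, l), -1))"
| "mach m c (AtTop cs) (b, l) = (Back (after cs (l ! reg (hd cs))),
     (b, case hd cs of Pop i \<Rightarrow> l[i := 0] | _ \<Rightarrow> l), 0)"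
| "mach m c (Back cs) (b, l) = (if b then (Home cs, (b, l), 0) else (Back cs, (b, l), -1))"

lemma track_ge: "int (length l) \<le> j \<Longrightarrow> track l j = 0"
  by (induction l) auto

lemma track_neg: "j < 0 \<Longrightarrow> track l j = 0"
  by (induction l) auto

lemma track_pos: "0 \<notin> set l \<Longrightarrow> 0 \<le> j \<Longrightarrow> j < int (length l) \<Longrightarrow> track l j \<noteq> 0"
  by (induction l) auto

lemma track_rev: "i < length l \<Longrightarrow> track (rev l) (int i) = l ! i"
proof (induction l rule: rev_induct)
  case (snoc a l)
  then show ?case by (auto simp: nth_append)
qed simp

lemma layout_nth: "i < m \<Longrightarrow> snd (layout m \<sigma> j) ! i = track (\<sigma> i) j"
  by (simp add: layout_def)

lemma layout_idem: "(layout m \<sigma>)(j := (j = 0, snd (layout m \<sigma> j))) = layout m \<sigma>"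
  by (simp add: layout_def fun_eq_iff)

lemma layout_push:
  assumes "i < m"
  shows "(layout m \<sigma>)(int (length (\<sigma> i)) := (\<sigma> i = [], (snd (layout m \<sigma> (int (length (\<sigma> i)))))[i := a]))
    = layout m (\<sigma>(i := a # \<sigma> i))"
  using assms by (auto simp: layout_def fun_eq_iff nth_list_update intro!: nth_equalityI)

lemma layout_pop:
  assumes "i < m" "\<sigma> i = a # l"
  shows "(layout m \<sigma>)(int (length l) := (l = [], (snd (layout m \<sigma> (int (length l))))[i := 0]))
    = layout m (\<sigma>(i := l))"
  using assms by (auto simp: layout_def fun_eq_iff nth_list_update track_ge intro!: nth_equalityI)

text \<open>The value 0 is excluded because it delimits a track.\<close>

definition good :: "nat \<Rightarrow> nat \<Rightarrow> store \<Rightarrow> bool" where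
  "good m B \<sigma> \<longleftrightarrow> (\<forall>i<m. set (\<sigma> i) \<subseteq> {0<..<B})"

lemma good_cstep:
  assumes "good m B \<sigma>" "list_all (okc m B) cs"
  shows "good m B (snd (cstep (cs, \<sigma>)))"
proof -
  have "x \<in> set (tl l) \<Longrightarrow> x \<in> set l" for x and l :: "nat list" by (cases l) auto
  then show ?thesis using assms
    by (cases "(cs, \<sigma>)" rule: cstep.cases) (auto simp: good_def subset_iff split: if_splits)
qed

section \<open>Correctness of the simulation\<close>

context
  fixes m B :: nat and c :: com
begin

abbreviation "mstep \<equiv> astep (mach m c) Halt"

lemma seek:
  assumes "0 \<notin> set (\<sigma> i)" "i < m" "i = reg (hd cs)" "p \<le> length (\<sigma> i)"
  shows "(mstep ^^ (length (\<sigma> i) - p)) (Seek cs, layout m \<sigma>, int p)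
    = (Seek cs, layout m \<sigma>, int (length (\<sigma> i)))"
  using assms(4)
proof (induction "length (\<sigma> i) - p" arbitrary: p)
  case (Suc x)
  have "track (\<sigma> i) (int p) \<noteq> 0" using Suc assms by (intro track_pos) auto
  then have "mstep (Seek cs, layout m \<sigma>, int p) = (Seek cs, layout m \<sigma>, int (Suc p))"
    using assms by (auto simp: astep_def layout_def split: prod.splits)
  moreover have "(mstep ^^ x) (Seek cs, layout m \<sigma>, int (Suc p))
      = (Seek cs, layout m \<sigma>, int (length (\<sigma> i)))"
  proof -
    have "x = length (\<sigma> i) - Suc p" "Suc p \<le> length (\<sigma> i)" using Suc by auto
    then show ?thesis using Suc.hyps(1)[of "Suc p"] by simp
  qed
  ultimately show ?case using Suc.hyps(2) by (metis comp_apply funpow_Suc_right)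
qed simp

lemma finseek:
  assumes "0 \<notin> set (\<sigma> 0)" "0 < m" "p \<le> length (\<sigma> 0)"
  shows "(mstep ^^ (length (\<sigma> 0) - p)) (FinSeek, layout m \<sigma>, int p)
    = (FinSeek, layout m \<sigma>, int (length (\<sigma> 0)))"
  using assms(3)
proof (induction "length (\<sigma> 0) - p" arbitrary: p)
  case (Suc x)
  have "track (\<sigma> 0) (int p) \<noteq> 0" using Suc assms by (intro track_pos) auto
  then have "mstep (FinSeek, layout m \<sigma>, int p) = (FinSeek, layout m \<sigma>, int (Suc p))"
    using assms by (auto simp: astep_def layout_def split: prod.splits)
  moreover have "(mstep ^^ x) (FinSeek, layout m \<sigma>, int (Suc p))
      = (FinSeek, layout m \<sigma>, int (length (\<sigma> 0)))"
  proof -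
    have "x = length (\<sigma> 0) - Suc p" "Suc p \<le> length (\<sigma> 0)" using Suc by auto
    then show ?thesis using Suc.hyps(1)[of "Suc p"] by simp
  qed
  ultimately show ?case using Suc.hyps(2) by (metis comp_apply funpow_Suc_right)
qed simp

lemma rewind:
  "(mstep ^^ Suc p) (Back cs, layout m \<sigma>, int p) = (Home cs, layout m \<sigma>, 0)"
proof (induction p)
  case 0
  show ?case by (auto simp: astep_def layout_def)
next
  case (Suc p)
  have "mstep (Back cs, layout m \<sigma>, int (Suc p)) = (Back cs, layout m \<sigma>, int p)"
    by (auto simp: astep_def layout_def)
  then show ?case using Suc by (metis comp_apply funpow_Suc_right)
qed

text \<open>Stated for a tape that agrees with the layout only up to the head, since the cells to
  the right have already been rewritten.\<close>

lemma finback: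
  assumes "\<And>j. j \<le> int p \<Longrightarrow> T j = layout m \<sigma> j" "0 < m"
  shows "(mstep ^^ Suc p) (FinBack, T, int p) = (Halt, \<lambda>j. if 0 \<le> j \<and> j \<le> int p
     then plain m (track (\<sigma> 0) j) else T j, 0)"
  using assms(1)
proof (induction p arbitrary: T)
  case 0
  have "T 0 = (True, snd (layout m \<sigma> 0))" using 0[of 0] by (simp add: layout_def)
  moreover have "T(0 := plain m (track (\<sigma> 0) 0)) =
      (\<lambda>j. if 0 \<le> j \<and> j \<le> int 0 then plain m (track (\<sigma> 0) j) else T j)"
    by (rule ext) auto
  ultimately show ?case using assms(2) by (simp add: astep_def layout_nth)
next
  case (Suc p)
  let ?T = "T(int (Suc p) := plain m (track (\<sigma> 0) (int (Suc p))))"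
  have "mstep (FinBack, T, int (Suc p)) = (FinBack, ?T, int p)"
    using assms(2) Suc.prems[of "int (Suc p)"] by (auto simp: astep_def layout_def)
  moreover have "(mstep ^^ Suc p) (FinBack, ?T, int p) = (Halt, \<lambda>j. if 0 \<le> j \<and> j \<le> int p
     then plain m (track (\<sigma> 0) j) else ?T j, 0)"
    using Suc.prems by (intro Suc.IH) auto
  moreover have "(\<lambda>j. if 0 \<le> j \<and> j \<le> int p then plain m (track (\<sigma> 0) j) else ?T j)
      = (\<lambda>j. if 0 \<le> j \<and> j \<le> int (Suc p) then plain m (track (\<sigma> 0) j) else T j)"
    by (rule ext) auto
  ultimately show ?case by (simp only: funpow_Suc_right[of "Suc p"] comp_apply)
qed

text \<open>One program step costs one round trip between the mark and the top of a stack, plus a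
  constant.\<close>

lemma mach_cstep:
  assumes "good m B \<sigma>" "list_all (okc m B) cs" "cs \<noteq> []" "\<And>i. length (\<sigma> i) \<le> N"
  shows "\<exists>t\<le>2 * N + 4. (mstep ^^ t) (Home cs, layout m \<sigma>, 0) =
    (case cstep (cs, \<sigma>) of (cs', \<sigma>') \<Rightarrow> (Home cs', layout m \<sigma>', 0))"
\<comment> \<open>\<open>Seq\<close> touches no stack and is unfolded in \<open>Home\<close> without
  any seek; its \<open>reg\<close> value is a dummy.\<close>
proof (cases "\<exists>d e. hd cs = Seq d e")
  case True
  then obtain d e ks where "cs = Seq d e # ks" using assms(3) by (cases cs) auto
  then show ?thesis by (intro exI[of _ 1]) (auto simp: astep_def layout_def)
next
  case False
  define i where "i = reg (hd cs)"
  define L where "L = length (\<sigma> i)"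
  have i: "i < m" using assms(2,3) False unfolding i_def
    by (cases cs; cases "hd cs") auto
  have nz: "0 \<notin> set (\<sigma> i)" using assms(1) i unfolding good_def by fastforce
  have 1: "(mstep ^^ 1) (Home cs, layout m \<sigma>, 0) = (Seek cs, layout m \<sigma>, int 0)"
    using False assms(3) by (cases cs) (auto simp: astep_def layout_def split: com.splits)
  have 2: "(mstep ^^ (1 + L)) (Home cs, layout m \<sigma>, 0) = (Seek cs, layout m \<sigma>, int L)"
    using funpow_trans[OF 1 seek[of \<sigma> i cs 0]] nz i by (simp add: i_def L_def)
  have z: "track (\<sigma> i) (int L) = 0" by (simp add: L_def track_ge)
  have LN: "L \<le> N" using assms(4) by (simp add: L_def)
  show ?thesis
  proof (cases "\<exists>a. hd cs = Push i a")
    case True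
    then obtain a ks where cs: "cs = Push i a # ks" using assms(3) by (cases cs) auto
    have 3: "(mstep ^^ 1) (Seek cs, layout m \<sigma>, int L) = (Back ks, layout m (\<sigma>(i := a # \<sigma> i)), int L)"
      using z i layout_push[OF i, of \<sigma> a] by (simp add: cs astep_def L_def layout_def)
    from funpow_trans[OF funpow_trans[OF 2 3] rewind]
    show ?thesis using LN by (intro exI[of _ "1 + L + 1 + Suc L"]) (simp add: cs)
  next
    case nopush: False
    show ?thesis
    proof (cases "\<sigma> i")
      case Nil
      have "after cs 0 = fst (cstep (cs, \<sigma>))" "snd (cstep (cs, \<sigma>)) = \<sigma>"
        using Nil nopush False assms(3) unfolding i_def
        by (cases "(cs, \<sigma>)" rule: cstep.cases; simp add: fun_upd_idem)+
      moreover have 3: "(mstep ^^ 1) (Seek cs, layout m \<sigma>, int L) = (Back (after cs 0), layout m \<sigma>, int 0)"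
        using Nil z i nopush False
        by (cases "hd cs") (auto simp: astep_def L_def layout_def i_def[symmetric] fun_eq_iff i_def)
      note funpow_trans[OF funpow_trans[OF 2 3] rewind]
      ultimately show ?thesis using LN
        by (intro exI[of _ "1 + L + 1 + Suc 0"]) (auto split: prod.splits)
    next
      case (Cons a l)
      have 3: "(mstep ^^ 1) (Seek cs, layout m \<sigma>, int L) = (AtTop cs, layout m \<sigma>, int (length l))"
        using Cons z i nopush False
        by (cases "hd cs") (auto simp: astep_def L_def layout_def i_def fun_eq_iff)
      have 4: "(mstep ^^ 1) (AtTop cs, layout m \<sigma>, int (length l))
        = (Back (fst (cstep (cs, \<sigma>))), layout m (snd (cstep (cs, \<sigma>))), int (length l))"
      proof -
        define V where "V = snd (layout m \<sigma> (int (length l)))"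
        have lay: "layout m \<sigma> (int (length l)) = (l = [], V)" by (simp add: layout_def V_def)
        show ?thesis
        proof (cases "\<exists>j. hd cs = Pop j")
          case True
          then obtain ks where cs: "cs = Pop i # ks" using assms(3) by (cases cs) (auto simp: i_def)
          then show ?thesis
            using Cons layout_pop[of i m \<sigma> a l] i
            by (simp add: astep_def lay)
        next
          case nopop: False
          have "after cs a = fst (cstep (cs, \<sigma>))" "snd (cstep (cs, \<sigma>)) = \<sigma>"
            using Cons nopush nopop False assms(3) unfolding i_def
            by (cases "(cs, \<sigma>)" rule: cstep.cases; simp)+
          moreover have "snd (layout m \<sigma> (int (length l))) ! i = a"
            using i Cons by (simp add: layout_nth)
          ultimately show ?thesis
            using nopop i_def layout_idem[of m \<sigma> "int (length l)"]
            by (cases "hd cs") (simp_all add: astep_def lay)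
        qed
      qed
      from funpow_trans[OF funpow_trans[OF funpow_trans[OF 2 3] 4] rewind]
      show ?thesis using LN Cons
        by (intro exI[of _ "1 + L + 1 + 1 + Suc (length l)"]) (auto simp: L_def split: prod.splits)
    qed
  qed
qed

lemma length_cstep: "length (snd (cstep (cs, \<sigma>)) i) \<le> Suc (length (\<sigma> i))"
  by (cases "(cs, \<sigma>)" rule: cstep.cases) auto

text \<open>A step lengthens a stack by at most one symbol, so \<open>N + n\<close> bounds all
  stacks during \<open>n\<close> steps and every round trip is linear in it.\<close>

lemma mach_csteps:
  assumes "good m B \<sigma>" "cs \<in> insert [] (conts c [])" "okc m B c" "\<And>i. length (\<sigma> i) \<le> N"
  shows "(cstep ^^ n) (cs, \<sigma>) = ([], \<sigma>') \<Longrightarrow> \<exists>t\<le>n * (2 * (N + n) + 4).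
     (mstep ^^ t) (Home cs, layout m \<sigma>, 0) = (Home [], layout m \<sigma>', 0) \<and> good m B \<sigma>'"
  using assms(1,2,4)
proof (induction n arbitrary: cs \<sigma> N)
  case (Suc n)
  show ?case
  proof (cases "cs = []")
    case True
    have "(cstep ^^ k) ([], \<sigma>) = ([], \<sigma>)" for k by (induction k) auto
    then show ?thesis using Suc.prems True by (intro exI[of _ 0]) simp
  next
    case False
    then have ok: "list_all (okc m B) cs" using Suc.prems(3) conts_okc[of cs c "[]" m B] assms(3) by auto
    obtain cs1 \<sigma>1 where s: "cstep (cs, \<sigma>) = (cs1, \<sigma>1)" by fastforce
    have cs1: "cs1 = after cs (peek (\<sigma> (reg (hd cs))))"
      using s by (cases "(cs, \<sigma>)" rule: cstep.cases) auto
    then have "cs1 \<in> insert [] (conts c [])"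
      using False Suc.prems(3) conts_after[of cs c "[]"] by auto
    moreover have "(cstep ^^ n) (cs1, \<sigma>1) = ([], \<sigma>')"
      using Suc.prems(1) s by (metis comp_apply funpow_Suc_right)
    moreover have "good m B \<sigma>1" using good_cstep[OF Suc.prems(2) ok] s by simp
    moreover have "length (\<sigma>1 i) \<le> N + 1" for i
      using length_cstep[of cs \<sigma> i] s Suc.prems(4)[of i] by simp
    ultimately obtain t1 where t1: "t1 \<le> n * (2 * (N + 1 + n) + 4)"
       "(mstep ^^ t1) (Home cs1, layout m \<sigma>1, 0) = (Home [], layout m \<sigma>', 0)" "good m B \<sigma>'"
      using Suc.IH[of cs1 \<sigma>1 "N + 1"] by blast
    obtain t0 where t0: "t0 \<le> 2 * N + 4" "(mstep ^^ t0) (Home cs, layout m \<sigma>, 0) = (Home cs1, layout m \<sigma>1, 0)"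
      using mach_cstep[OF Suc.prems(2) ok False Suc.prems(4)] s by auto
    have "t0 + t1 \<le> Suc n * (2 * (N + Suc n) + 4)" using t0 t1 by simp
    then show ?thesis using funpow_trans[OF t0(2) t1(2)] t1(3) by blast
  qed
qed auto

end

text \<open>The quantifier over the continuation makes executions composable: the same run is
  available in every context.\<close>

definition exec :: "com \<Rightarrow> store \<Rightarrow> nat \<Rightarrow> store \<Rightarrow> bool" where
  "exec c \<sigma> n \<sigma>' \<longleftrightarrow> (\<forall>ks. (cstep ^^ n) (c # ks, \<sigma>) = (ks, \<sigma>'))"

text \<open>A track spells its stack from the bottom, so the tape content \<open>x\<close> is a
  stack with the last bit on top; hence the reversals.\<close>

theorem com_poly_time:
  assumes wf: "wfc c" and p: "ispoly p"
    and run: "\<And>x. x \<noteq> [] \<Longrightarrow> \<exists>n\<le>p (length x). \<exists>\<sigma>'.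
      exec c ((\<lambda>_. [])(0 := rev (map bit_sym x))) n \<sigma>' \<and> \<sigma>' 0 = rev (map bit_sym (\<mu> x))"
  shows "poly_time_computable \<mu>"
proof -
  obtain m0 where "okc m0 m0 c" using wfc_okc[OF wf] by blast
  \<comment> \<open>One number bounds both the tracks and the stack symbols; the value 3 leaves room
    for the two bit symbols.\<close>
  then obtain m where okc: "okc m m c" and m: "3 \<le> m"
    using okc_mono[of m0 m0 c "m0 + 3" "m0 + 3"] by (metis le_add1 le_add2)
  define Cs :: "cell set" where "Cs = UNIV \<times> {l. set l \<subseteq> {..<m} \<and> length l = m}"
  define S where "S = insert [] (conts c [])"
  define Qs where "Qs = {Init, Halt, FinSeek, FinBack} \<union> Home ` S \<union> Seek ` (S - {[]}) \<union> AtTop ` (S - {[]}) \<union> Back ` S"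
  have S: "after cs v \<in> S" "list_all (okc m m) cs" if "cs \<in> S" for cs v
    using that conts_after[of cs c "[]" v] conts_okc[of cs c "[]" m m] okc by (auto simp: S_def)
  have cellI: "(b, l[i := a]) \<in> Cs" if "(b, l) \<in> Cs" "a < m" for b l i a
    using that set_update_subset_insert[of l i a] by (auto simp: Cs_def)
  have [simp]: "blank m \<in> Cs" using m by (auto simp: Cs_def blank_def)
  have plain: "plain m a \<in> Cs" if "a < m" for a
    using cellI[of False "replicate m 0" a 0] that m \<open>blank m \<in> Cs\<close> by (simp add: plain_def blank_def)
  define bt where "bt b = plain m (bit_sym b)" for b
  show ?thesis
  \<comment> \<open>The summands of the bound: setting the mark, the simulated steps, entering
    \<open>FinSeek\<close>, and one trip along the output and back. Its length is at most
    \<open>n + p n\<close>, as each program step adds at most one symbol.\<close>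
  proof (rule abstract_machine_poly_time[where \<delta> = "mach m c" and Qs = Qs and Cs = Cs and
        ?q0.0 = Init and qh = Halt and ?b0.0 = "blank m" and ?b1.0 = "bt False" and ?b2.0 = "bt True"
        and p = "\<lambda>n. 1 + p n * (2 * (n + p n) + 4) + 1 + 2 * (n + p n) + 2"])
    show "finite Qs" by (auto simp: Qs_def S_def finite_conts)
    have "finite {l. set l \<subseteq> {..<m} \<and> length l = m}" by (rule finite_lists_length_eq) simp
    then show "finite Cs" by (auto simp: Cs_def)
    show "Init \<in> Qs" "Halt \<in> Qs" "Init \<noteq> Halt" by (auto simp: Qs_def)
    show "bt False \<in> Cs" "bt True \<in> Cs" "blank m \<in> Cs" using m by (auto simp: bt_def bit_sym_def plain)
    show "blank m \<noteq> bt False" "blank m \<noteq> bt True" "bt False \<noteq> bt True"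
      using m by (cases m; simp add: bt_def blank_def plain_def bit_sym_def)+
    show "ispoly (\<lambda>n. 1 + p n * (2 * (n + p n) + 4) + 1 + 2 * (n + p n) + 2)"
      by (intro ispoly.intros p)
  next
    fix q s q' s' d
    assume q: "q \<in> Qs" and s: "s \<in> Cs" and "q \<noteq> Halt" and eq: "mach m c q s = (q', s', d)"
    obtain b l where bl: "s = (b, l)" by fastforce
    have l: "length l = m" "\<And>i. i < m \<Longrightarrow> l ! i < m" "\<And>i. i < m \<Longrightarrow> (False, l[i := 0]) \<in> Cs"
      using s m by (auto simp: bl Cs_def subset_iff set_conv_nth nth_list_update)
    have b': "(b', l) \<in> Cs" for b' using s by (auto simp: bl Cs_def)
    have Q: "Home cs \<in> Qs" "Back cs \<in> Qs" "cs \<noteq> [] \<Longrightarrow> Seek cs \<in> Qs" "cs \<noteq> [] \<Longrightarrow> AtTop cs \<in> Qs"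
      "FinSeek \<in> Qs" "FinBack \<in> Qs" "Halt \<in> Qs" if "cs \<in> S" for cs
      using that by (auto simp: Qs_def)
    show "q' \<in> Qs \<and> s' \<in> Cs \<and> d \<in> {-1, 0, 1}"
    proof (cases q)
      case Init
      then show ?thesis using eq conts_self[of c "[]"] b' by (auto simp: bl Qs_def S_def)
    next
      case FinSeek
      then show ?thesis using eq b' by (auto simp: bl Qs_def split: if_splits)
    next
      case FinBack
      then show ?thesis using eq l(2)[of 0] m by (auto simp: bl Qs_def plain split: if_splits)
    next
      case (Home cs)
      then have "cs \<in> S" using q by (auto simp: Qs_def)
      then show ?thesis using eq Home s Q[OF S(1)[of cs 0]] Q[of cs]
        by (cases cs; cases "hd cs") (auto simp: bl)
    next
      case (Seek cs)
      then have cs: "cs \<in> S" "cs \<noteq> []" using q by (auto simp: Qs_def)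
      then show ?thesis using eq Seek s Q(2)[OF S(1)[of cs 0]] Q(3,4)[of cs] S(2)[of cs]
        by (cases cs; cases "hd cs") (auto simp: bl cellI split: if_splits)
    next
      case (AtTop cs)
      then have cs: "cs \<in> S" "cs \<noteq> []" using q by (auto simp: Qs_def)
      have "q' = Back (after cs (l ! reg (hd cs)))" "d = 0"
        using eq AtTop by (auto simp: bl)
      moreover have "s' \<in> Cs" using eq AtTop s m
        by (cases "hd cs") (auto simp: bl cellI)
      ultimately show ?thesis using Q(2)[OF S(1)[OF cs(1)]] by simp
    next
      case (Back cs)
      then show ?thesis using eq q b' by (auto simp: bl Qs_def split: if_splits)
    qed (use \<open>q \<noteq> Halt\<close> in auto)
  next
    fix x :: "bool list"
    assume "x \<noteq> []"
    define \<sigma> where "\<sigma> = ((\<lambda>_. [])(0 := rev (map bit_sym x)) :: store)"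
    from run[OF \<open>x \<noteq> []\<close>] obtain n \<sigma>' where n: "n \<le> p (length x)" and ex: "exec c \<sigma> n \<sigma>'"
      and out: "\<sigma>' 0 = rev (map bit_sym (\<mu> x))" by (auto simp: \<sigma>_def)
    let ?N = "length x" and ?ms = "astep (mach m c) Halt" and ?M = "length (\<mu> x)"
    have len: "length (\<sigma> i) \<le> ?N" for i by (simp add: \<sigma>_def)
    have "good m m \<sigma>" using m by (auto simp: good_def \<sigma>_def bit_sym_def)
    moreover have ex': "(cstep ^^ n) ([c], \<sigma>) = ([], \<sigma>')" using ex by (simp add: exec_def)
    moreover have "[c] \<in> insert [] (conts c [])" using conts_self by simp
    ultimately obtain t where t: "t \<le> n * (2 * (?N + n) + 4)" and good': "good m m \<sigma>'"
      and run1: "(?ms ^^ t) (Home [c], layout m \<sigma>, 0) = (Home [], layout m \<sigma>', 0)"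
      using mach_csteps[where \<sigma> = \<sigma> and N = ?N, OF _ _ okc len] by blast
    have "length (snd ((cstep ^^ n) (cs, \<sigma>)) i) \<le> length (\<sigma> i) + n" for i cs
    proof (induction n)
      case (Suc n)
      obtain cs' s' where "(cstep ^^ n) (cs, \<sigma>) = (cs', s')" by fastforce
      then show ?case using Suc length_cstep[of cs' s' i] by simp
    qed simp
    from this[of "[c]" 0] have M: "?M \<le> ?N + n" using len[of 0] ex' out by simp
    let ?T0 = "\<lambda>i. if 0 \<le> i \<and> i < int ?N then if x ! nat i then bt True else bt False else blank m"
    have "(?ms ^^ 1) (Init, T, 0) = (Home [c], T(0 := (True, snd (T 0))), 0)" for T
      by (cases "T 0") (simp add: astep_def)
    from this[of ?T0]
    have "(?ms ^^ 1) (Init, ?T0, 0) = (Home [c], ?T0(0 := (True, snd (?T0 0))), 0)" .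
    also have "?T0(0 := (True, snd (?T0 0))) = layout m \<sigma>"
    proof
      fix j :: int
      have tr: "track (rev (map bit_sym x)) j = (if 0 \<le> j \<and> j < int ?N then bit_sym (x ! nat j) else 0)"
        using track_rev[of "nat j" "map bit_sym x"] track_ge[of "rev (map bit_sym x)" j] track_neg[of j] by auto
      show "(?T0(0 := (True, snd (?T0 0)))) j = layout m \<sigma> j"
      proof -
        have A: "map (\<lambda>i. track (\<sigma> i) j) [0..<m]
            = (replicate m 0)[0 := if 0 \<le> j \<and> j < int ?N then bit_sym (x ! nat j) else 0]"
          by (rule nth_equalityI) (auto simp: \<sigma>_def nth_list_update tr)
        have "(replicate m 0)[0 := 0] = replicate m (0::nat)" using m by (cases m) auto
        then show ?thesis
          by (auto simp: layout_def A bt_def plain_def blank_def)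
      qed
    qed
    finally have run0: "(?ms ^^ 1) (Init, ?T0, 0) = (Home [c], layout m \<sigma>, 0)" .
    have run2: "(?ms ^^ 1) (Home [], layout m \<sigma>', 0) = (FinSeek, layout m \<sigma>', int 0)"
      by (auto simp: astep_def layout_def)
    have "0 \<notin> set (\<sigma>' 0)" by (auto simp: out bit_sym_def)
    then have run3: "(?ms ^^ ?M) (FinSeek, layout m \<sigma>', int 0) = (FinSeek, layout m \<sigma>', int ?M)"
      using finseek[of \<sigma>' m 0 c] m by (simp add: out)
    note R = funpow_trans[OF funpow_trans[OF funpow_trans[OF run0 run1] run2] run3]
    let ?goal = "\<lambda>t. \<exists>tp h. (?ms ^^ t) (Init, ?T0, 0) = (Halt, tp, h) \<and>
        (\<forall>i<?M. tp (h + int i) = (if \<mu> x ! i then bt True else bt False)) \<and>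
        tp (h + int ?M) \<notin> {bt False, bt True}"
    have bb: "blank m \<notin> {bt False, bt True}"
      using m by (cases m) (auto simp: bt_def blank_def plain_def bit_sym_def)
    have tr: "track (\<sigma>' 0) (int j) = bit_sym (\<mu> x ! j)" if "j < ?M" for j
      using track_rev[of j "map bit_sym (\<mu> x)"] that by (simp add: out)
    have "\<exists>t4\<le>?M + 2. ?goal (1 + t + 1 + ?M + t4)"
    proof (cases ?M)
      case 0
      then have "track (\<sigma>' 0) 0 = 0" by (simp add: out)
      then have "(?ms ^^ 1) (FinSeek, layout m \<sigma>', int ?M) = (Halt, (layout m \<sigma>')(0 := blank m), 0)"
        using 0 m by (auto simp: astep_def layout_def)
      from funpow_trans[OF R this] show ?thesis using 0 bb
        by (intro exI[of _ 1]) auto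
    next
      case (Suc k)
      have "track (\<sigma>' 0) (int ?M) = 0" by (rule track_ge) (simp add: out)
      then have f: "(?ms ^^ 1) (FinSeek, layout m \<sigma>', int ?M) = (FinBack, (layout m \<sigma>')(int ?M := blank m), int k)"
        using Suc m by (auto simp: astep_def layout_def)
      have "(?ms ^^ Suc k) (FinBack, (layout m \<sigma>')(int ?M := blank m), int k)
        = (Halt, \<lambda>j. if 0 \<le> j \<and> j \<le> int k then plain m (track (\<sigma>' 0) j)
             else ((layout m \<sigma>')(int ?M := blank m)) j, 0)"
        using Suc m by (intro finback) auto
      from funpow_trans[OF funpow_trans[OF R f] this] show ?thesis using Suc bb tr
        by (intro exI[of _ "1 + Suc k"]) (auto simp: bt_def add.assoc)
    qed
    then obtain t4 where t4: "t4 \<le> ?M + 2" "?goal (1 + t + 1 + ?M + t4)" by blast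
    let ?p = "p (length x)"
    define P where "P = ?p * (2 * (?N + ?p) + 4)"
    have "n * (2 * (?N + n) + 4) \<le> P"
      unfolding P_def using n by (intro mult_mono) auto
    then have "t \<le> P" using t by (rule le_trans[rotated])
    then have "1 + t + 1 + ?M + t4 \<le> 1 + P + 1 + 2 * (?N + ?p) + 2"
      using M n t4(1) by (simp add: algebra_simps)
    then have "1 + t + 1 + ?M + t4 \<le> 1 + ?p * (2 * (?N + ?p) + 4) + 1 + 2 * (?N + ?p) + 2"
      by (simp only: P_def)
    with t4(2) show "\<exists>t\<le>1 + ?p * (2 * (?N + ?p) + 4) + 1 + 2 * (?N + ?p) + 2. ?goal t" by blast
  qed
qed

section \<open>Running times of stack programs\<close>

definition run :: "com \<Rightarrow> store \<Rightarrow> nat \<Rightarrow> store \<Rightarrow> bool" where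
  "run c \<sigma> b \<sigma>' \<longleftrightarrow> (\<exists>n\<le>b. exec c \<sigma> n \<sigma>')"

lemma run_mono: "run c \<sigma> b \<sigma>' \<Longrightarrow> b \<le> b' \<Longrightarrow> run c \<sigma> b' \<sigma>'"
  unfolding run_def using le_trans by blast

lemma run_push: "run (Push i a) \<sigma> 1 (\<sigma>(i := a # \<sigma> i))"
  unfolding run_def exec_def by (intro exI[of _ 1]) simp

lemma run_pop: "run (Pop i) \<sigma> 1 (\<sigma>(i := tl (\<sigma> i)))"
  unfolding run_def exec_def by (intro exI[of _ 1]) simp

lemma run_seq:
  assumes "run c \<sigma> a \<sigma>'" "run d \<sigma>' b \<sigma>''"
  shows "run (Seq c d) \<sigma> (Suc (a + b)) \<sigma>''"
proof -
  obtain n n' where n: "n \<le> a" "exec c \<sigma> n \<sigma>'" and n': "n' \<le> b" "exec d \<sigma>' n' \<sigma>''"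
    using assms by (auto simp: run_def)
  have "(cstep ^^ (1 + (n + n'))) (Seq c d # ks, \<sigma>) = (ks, \<sigma>'')" for ks
    using n(2) n'(2) by (intro funpow_trans[of 1]) (auto simp: exec_def intro!: funpow_trans)
  then show ?thesis using n n' unfolding run_def exec_def
    by (intro exI[of _ "1 + (n + n')"]) auto
qed

lemma run_branch:
  assumes "run (if peek (\<sigma> i) = a then c else d) \<sigma> b \<sigma>'"
  shows "run (Branch i a c d) \<sigma> (Suc b) \<sigma>'"
proof -
  obtain n where n: "n \<le> b" "exec (if peek (\<sigma> i) = a then c else d) \<sigma> n \<sigma>'"
    using assms by (auto simp: run_def)
  have "(cstep ^^ (1 + n)) (Branch i a c d # ks, \<sigma>) = (ks, \<sigma>')" for ks
    using n(2) by (intro funpow_trans[of 1]) (auto simp: exec_def)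
  then show ?thesis using n unfolding run_def exec_def by (intro exI[of _ "1 + n"]) auto
qed

lemma run_loop_end: "peek (\<sigma> i) = a \<Longrightarrow> run (Loop i a c) \<sigma> 1 \<sigma>"
  unfolding run_def exec_def by (intro exI[of _ 1]) simp

lemma run_loop_step:
  assumes "peek (\<sigma> i) \<noteq> a" "run c \<sigma> b \<sigma>'" "run (Loop i a c) \<sigma>' b' \<sigma>''"
  shows "run (Loop i a c) \<sigma> (Suc (b + b')) \<sigma>''"
proof -
  obtain n n' where n: "n \<le> b" "exec c \<sigma> n \<sigma>'" and n': "n' \<le> b'" "exec (Loop i a c) \<sigma>' n' \<sigma>''"
    using assms by (auto simp: run_def)
  have "(cstep ^^ (1 + (n + n'))) (Loop i a c # ks, \<sigma>) = (ks, \<sigma>'')" for ks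
    using n(2) n'(2) assms(1)
    by (intro funpow_trans[of 1]) (auto simp: exec_def intro!: funpow_trans)
  then show ?thesis using n n' unfolding run_def exec_def
    by (intro exI[of _ "1 + (n + n')"]) auto
qed

lemma run_length: "run c \<sigma> b \<sigma>' \<Longrightarrow> length (\<sigma>' i) \<le> length (\<sigma> i) + b"
proof -
  have *: "length (snd ((cstep ^^ n) (cs, \<sigma>)) i) \<le> length (\<sigma> i) + n" for n cs
  proof (induction n)
    case (Suc n)
    obtain cs' s' where "(cstep ^^ n) (cs, \<sigma>) = (cs', s')" by fastforce
    then show ?case using Suc length_cstep[of cs' s' i] by simp
  qed simp
  assume "run c \<sigma> b \<sigma>'"
  then obtain n where "n \<le> b" "(cstep ^^ n) ([c], \<sigma>) = ([], \<sigma>')" by (auto simp: run_def exec_def)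
  then show ?thesis using *[of n "[c]"] by simp
qed

section \<open>Elementary programs on stacks\<close>

definition skip :: com where
  "skip = Seq (Push 0 1) (Pop 0)"

lemma run_skip: "run skip \<sigma> 3 \<sigma>"
proof -
  have "run skip \<sigma> (Suc (1 + 1)) (\<sigma>(0 := 1 # \<sigma> 0, 0 := tl ((\<sigma>(0 := 1 # \<sigma> 0)) 0)))"
    unfolding skip_def by (rule run_seq[OF run_push run_pop])
  then show ?thesis by (simp add: eval_nat_numeral)
qed

text \<open>Case \<open>q\<close> is represented by the symbol \<open>Suc q\<close>, because 0 is
  what an empty stack shows; the empty stack falls through to \<open>d\<close>.\<close>

fun switch :: "nat \<Rightarrow> nat \<Rightarrow> com \<Rightarrow> (nat \<Rightarrow> com) \<Rightarrow> com" where
  "switch i 0 d f = d"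
| "switch i (Suc n) d f = Branch i (Suc n) (f n) (switch i n d f)"

lemma run_switch:
  "peek (\<sigma> i) = Suc q \<Longrightarrow> q < n \<Longrightarrow> run (f q) \<sigma> b \<sigma>' \<Longrightarrow> run (switch i n d f) \<sigma> (b + n) \<sigma>'"
proof (induction n)
  case (Suc n)
  show ?case
  proof (cases "q = n")
    case True
    then show ?thesis using Suc.prems run_mono[of "f q" \<sigma> b \<sigma>' "b + n"]
      by (auto intro!: run_branch)
  qed (use Suc in \<open>auto intro!: run_branch\<close>)
qed simp

lemma run_switch_default:
  "peek (\<sigma> i) = 0 \<Longrightarrow> run d \<sigma> b \<sigma>' \<Longrightarrow> run (switch i n d f) \<sigma> (b + n) \<sigma>'"
  by (induction n) (auto intro!: run_branch)

lemma wfc_switch: "wfc d \<Longrightarrow> (\<And>q. q < n \<Longrightarrow> wfc (f q)) \<Longrightarrow> wfc (switch i n d f)"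
  by (induction n) auto

fun emit :: "nat \<Rightarrow> bool list \<Rightarrow> com" where
  "emit j [] = skip"
| "emit j (b # w) = Seq (Push j (bit_sym b)) (emit j w)"

lemma run_emit:
  "run (emit j w) \<sigma> (2 * length w + 3) (\<sigma>(j := map bit_sym (rev w) @ \<sigma> j))"
proof (induction w arbitrary: \<sigma>)
  case Nil
  show ?case using run_skip by simp
next
  case (Cons b w)
  have "\<sigma>(j := bit_sym b # \<sigma> j, j := map bit_sym (rev w) @ (\<sigma>(j := bit_sym b # \<sigma> j)) j)
      = \<sigma>(j := map bit_sym (rev (b # w)) @ \<sigma> j)" by simp
  then show ?case using run_seq[OF run_push[of j "bit_sym b" \<sigma>] Cons] by (simp del: fun_upd_apply)
qed

lemma bit_sym_simps [simp]: "0 < bit_sym b" "bit_sym b \<noteq> 0" "bit_sym True = 2" "bit_sym False = 1"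
  by (auto simp: bit_sym_def)

lemma wfc_skip [simp]: "wfc skip"
  by (simp add: skip_def)

lemma wfc_emit [simp]: "wfc (emit j w)"
  by (induction w) auto

definition clear :: "nat \<Rightarrow> com" where
  "clear i = Loop i 0 (Pop i)"

lemma run_clear: "0 \<notin> set (\<sigma> i) \<Longrightarrow> run (clear i) \<sigma> (2 * length (\<sigma> i) + 1) (\<sigma>(i := []))"
proof (induction "\<sigma> i" arbitrary: \<sigma>)
  case Nil
  then show ?case using run_loop_end[of \<sigma> i 0 "Pop i"] by (simp add: clear_def fun_upd_idem)
next
  case (Cons a l)
  have "run (clear i) (\<sigma>(i := tl (\<sigma> i))) (2 * length l + 1) (\<sigma>(i := []))"
    using Cons(1)[of "\<sigma>(i := tl (\<sigma> i))"] Cons.prems by (simp flip: Cons(2))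
  moreover have "peek (\<sigma> i) \<noteq> 0" using Cons.prems by (auto simp flip: Cons(2))
  ultimately have "run (clear i) \<sigma> (Suc (1 + (2 * length l + 1))) (\<sigma>(i := []))"
    unfolding clear_def by (intro run_loop_step[OF _ run_pop])
  then show ?case by (simp flip: Cons(2))
qed

definition move :: "nat \<Rightarrow> nat \<Rightarrow> com" where
  "move i j = Loop i 0 (Branch i 1 (Seq (Pop i) (Push j 1)) (Seq (Pop i) (Push j 2)))"

lemma run_move:
  assumes "i \<noteq> j"
  shows "\<sigma> i = map bit_sym xs \<Longrightarrow>
    run (move i j) \<sigma> (5 * length xs + 1) (\<sigma>(i := [], j := map bit_sym (rev xs) @ \<sigma> j))"
proof (induction xs arbitrary: \<sigma>)
  case Nil
  then show ?case using run_loop_end[of \<sigma> i 0] by (simp add: move_def fun_upd_idem)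
next
  case (Cons b xs)
  let ?\<sigma> = "\<sigma>(i := map bit_sym xs, j := bit_sym b # \<sigma> j)"
  have "run (Branch i 1 (Seq (Pop i) (Push j 1)) (Seq (Pop i) (Push j 2))) \<sigma> (Suc (Suc (1 + 1))) ?\<sigma>"
    using run_seq[OF run_pop[of i \<sigma>] run_push[of j "bit_sym b"]] Cons.prems assms
    by (intro run_branch) (cases b; simp)
  moreover have "run (move i j) ?\<sigma> (5 * length xs + 1) (?\<sigma>(i := [], j := map bit_sym (rev xs) @ ?\<sigma> j))"
    using assms by (intro Cons.IH) simp
  ultimately have "run (move i j) \<sigma> (Suc (Suc (Suc (1 + 1)) + (5 * length xs + 1)))
      (?\<sigma>(i := [], j := map bit_sym (rev xs) @ ?\<sigma> j))"
    unfolding move_def using Cons.prems by (intro run_loop_step) auto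
  moreover have "?\<sigma>(i := [], j := map bit_sym (rev xs) @ ?\<sigma> j) = \<sigma>(i := [], j := map bit_sym (rev (b # xs)) @ \<sigma> j)"
    using assms by (auto simp: fun_eq_iff)
  ultimately show ?case by (auto simp del: fun_upd_apply intro: run_mono)
qed

definition dup :: "nat \<Rightarrow> nat \<Rightarrow> nat \<Rightarrow> com" where
  "dup i j l = Loop i 0 (Branch i 1 (Seq (Pop i) (Seq (Push j 1) (Push l 1)))
     (Seq (Pop i) (Seq (Push j 2) (Push l 2))))"

lemma run_dup:
  assumes "i \<noteq> j" "i \<noteq> l" "j \<noteq> l"
  shows "\<sigma> i = map bit_sym xs \<Longrightarrow> run (dup i j l) \<sigma> (7 * length xs + 1)
    (\<sigma>(i := [], j := map bit_sym (rev xs) @ \<sigma> j, l := map bit_sym (rev xs) @ \<sigma> l))"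
proof (induction xs arbitrary: \<sigma>)
  case Nil
  then show ?case using run_loop_end[of \<sigma> i 0] by (simp add: dup_def fun_upd_idem)
next
  case (Cons b xs)
  let ?\<sigma> = "\<sigma>(i := map bit_sym xs, j := bit_sym b # \<sigma> j, l := bit_sym b # \<sigma> l)"
  let ?P = "\<lambda>\<sigma>. \<sigma>(i := [], j := map bit_sym (rev xs) @ \<sigma> j, l := map bit_sym (rev xs) @ \<sigma> l)"
  have "run (Branch i 1 (Seq (Pop i) (Seq (Push j 1) (Push l 1)))
     (Seq (Pop i) (Seq (Push j 2) (Push l 2)))) \<sigma> (Suc (Suc (1 + Suc (1 + 1)))) ?\<sigma>"
    using run_seq[OF run_pop[of i \<sigma>] run_seq[OF run_push[of j "bit_sym b"] run_push[of l "bit_sym b"]]]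
      Cons.prems assms
    by (intro run_branch) (cases b; simp)
  moreover have "run (dup i j l) ?\<sigma> (7 * length xs + 1) (?P ?\<sigma>)"
    using assms by (intro Cons.IH) simp
  ultimately have "run (dup i j l) \<sigma> (Suc (Suc (Suc (1 + Suc (1 + 1))) + (7 * length xs + 1))) (?P ?\<sigma>)"
    unfolding dup_def using Cons.prems by (intro run_loop_step) auto
  moreover have "?P ?\<sigma> = \<sigma>(i := [], j := map bit_sym (rev (b # xs)) @ \<sigma> j, l := map bit_sym (rev (b # xs)) @ \<sigma> l)"
    using assms by (auto simp: fun_eq_iff)
  ultimately show ?case by (auto simp del: fun_upd_apply intro: run_mono)
qed

definition transfer :: "nat \<Rightarrow> nat \<Rightarrow> nat \<Rightarrow> com" where
  "transfer i t j = Seq (move i t) (move t j)"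

lemma run_transfer:
  assumes "\<sigma> i = map bit_sym xs" "\<sigma> t = []" "\<sigma> j = []" "distinct [i, t, j]"
  shows "run (transfer i t j) \<sigma> (10 * length xs + 3) (\<sigma>(i := [], j := map bit_sym xs))"
proof -
  let ?\<sigma> = "\<sigma>(i := [], t := map bit_sym (rev xs) @ \<sigma> t)"
  have "run (transfer i t j) \<sigma> (Suc ((5 * length xs + 1) + (5 * length (rev xs) + 1)))
     (?\<sigma>(t := [], j := map bit_sym (rev (rev xs)) @ ?\<sigma> j))"
    unfolding transfer_def using assms run_move[of i t \<sigma> xs] run_move[of t j ?\<sigma> "rev xs"]
    by (intro run_seq[of _ _ _ ?\<sigma>]) simp_all
  moreover have "?\<sigma>(t := [], j := map bit_sym (rev (rev xs)) @ ?\<sigma> j) = \<sigma>(i := [], j := map bit_sym xs)"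
    using assms by (auto simp: fun_eq_iff)
  ultimately show ?thesis by (auto simp del: fun_upd_apply intro: run_mono)
qed

definition copy :: "nat \<Rightarrow> nat \<Rightarrow> nat \<Rightarrow> com" where
  "copy i t j = Seq (move i t) (dup t i j)"

lemma run_copy:
  assumes "\<sigma> i = map bit_sym xs" "\<sigma> t = []" "\<sigma> j = []" "distinct [i, t, j]"
  shows "run (copy i t j) \<sigma> (12 * length xs + 3) (\<sigma>(j := map bit_sym xs))"
proof -
  let ?\<sigma> = "\<sigma>(i := [], t := map bit_sym (rev xs) @ \<sigma> t)"
  let ?\<tau> = "?\<sigma>(t := [], i := map bit_sym (rev (rev xs)) @ ?\<sigma> i, j := map bit_sym (rev (rev xs)) @ ?\<sigma> j)"
  have "run (copy i t j) \<sigma> (Suc ((5 * length xs + 1) + (7 * length (rev xs) + 1))) ?\<tau>"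
    unfolding copy_def using assms run_move[of i t \<sigma> xs] run_dup[of t i j ?\<sigma> "rev xs"]
    by (intro run_seq[of _ _ _ ?\<sigma>]) simp_all
  moreover have "?\<tau> = \<sigma>(j := map bit_sym xs)"
    using assms by (auto simp: fun_eq_iff)
  ultimately show ?thesis by (auto simp del: fun_upd_apply intro: run_mono)
qed

lemma wfc_simps [simp]: "wfc (clear i)" "wfc (move i j)" "wfc (dup i j l)" "wfc (transfer i t j)" "wfc (copy i t j)"
  by (simp_all add: clear_def move_def dup_def transfer_def copy_def)

section \<open>Polynomial time functions of bit strings\<close>

definition st :: "(nat \<Rightarrow> bool list) \<Rightarrow> store" where
  "st \<rho> = (\<lambda>i. map bit_sym (\<rho> i))"

lemma st_upd: "st (\<rho>(i := xs)) = (st \<rho>)(i := map bit_sym xs)"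
  by (auto simp: st_def)

definition tsize :: "nat \<Rightarrow> (nat \<Rightarrow> bool list) \<Rightarrow> nat" where
  "tsize k \<rho> = (\<Sum>i<k. length (\<rho> i))"

lemma tsize_upd: "tsize (Suc k) (\<rho>(k := xs)) = tsize k \<rho> + length xs"
  by (simp add: tsize_def)

lemma tsize_ge: "i < k \<Longrightarrow> length (\<rho> i) \<le> tsize k \<rho>"
  unfolding tsize_def by (rule member_le_sum) auto

text \<open>Registers from \<open>k\<close> on are scratch space. \<open>evaluates\<close> leaves
  all of them except the result register empty again, which lets evaluations be chained.\<close>

definition fresh :: "nat \<Rightarrow> (nat \<Rightarrow> bool list) \<Rightarrow> bool" where
  "fresh k \<rho> \<longleftrightarrow> (\<forall>j\<ge>k. \<rho> j = [])"

lemma freshD: "fresh k \<rho> \<Longrightarrow> k \<le> j \<Longrightarrow> \<rho> j = []"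
  by (simp add: fresh_def)

text \<open>Registers \<open>0, \<dots>, k - 1\<close> are the variables in scope; the value of \<open>f\<close> is put into register \<open>k\<close>.\<close>

definition evaluates :: "com \<Rightarrow> (nat \<Rightarrow> nat) \<Rightarrow> nat \<Rightarrow> ((nat \<Rightarrow> bool list) \<Rightarrow> bool list) \<Rightarrow> bool" where
  "evaluates c p k f \<longleftrightarrow> wfc c \<and> ispoly p \<and>
     (\<forall>\<rho>. fresh k \<rho> \<longrightarrow> run c (st \<rho>) (p (tsize k \<rho>)) (st (\<rho>(k := f \<rho>))))"

definition cmp :: "nat \<Rightarrow> ((nat \<Rightarrow> bool list) \<Rightarrow> bool list) \<Rightarrow> bool" where
  "cmp k f \<longleftrightarrow> (\<exists>c p. evaluates c p k f)"

lemma cmpI: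
  assumes "wfc c" "ispoly p"
    "\<And>\<rho>. fresh k \<rho> \<Longrightarrow> run c (st \<rho>) (p (tsize k \<rho>)) (st (\<rho>(k := f \<rho>)))"
  shows "cmp k f"
  using assms unfolding cmp_def evaluates_def by blast

text \<open>The last claim holds because a program pushes at most one symbol per step, so its
  running time bounds the length of the value.\<close>

lemma evaluatesD:
  assumes "evaluates c p k f"
  shows "wfc c" "ispoly p"
    "fresh k \<rho> \<Longrightarrow> run c (st \<rho>) (p (tsize k \<rho>)) (st (\<rho>(k := f \<rho>)))"
    "fresh k \<rho> \<Longrightarrow> length (f \<rho>) \<le> p (tsize k \<rho>)"
proof -
  show *: "wfc c" "ispoly p" and r: "fresh k \<rho> \<Longrightarrow> run c (st \<rho>) (p (tsize k \<rho>)) (st (\<rho>(k := f \<rho>)))"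
    using assms by (auto simp: evaluates_def)
  show "length (f \<rho>) \<le> p (tsize k \<rho>)" if e: "fresh k \<rho>"
    using run_length[OF r[OF e], where i = k] freshD[OF e] by (simp add: st_def)
qed

lemma cmp_var: "i < k \<Longrightarrow> cmp k (\<lambda>\<rho>. \<rho> i)"
proof (rule cmpI)
  show "ispoly (\<lambda>n. 12 * n + 3)" by (intro ispoly.intros)
  fix \<rho> :: "nat \<Rightarrow> bool list" assume "i < k" and e: "fresh k \<rho>"
  have "run (copy i (Suc k) k) (st \<rho>) (12 * length (\<rho> i) + 3) (st (\<rho>(k := \<rho> i)))"
    unfolding st_upd using \<open>i < k\<close> e by (intro run_copy) (auto simp: st_def fresh_def)
  then show "run (copy i (Suc k) k) (st \<rho>) (12 * tsize k \<rho> + 3) (st (\<rho>(k := \<rho> i)))"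
    by (rule run_mono) (use tsize_ge[OF \<open>i < k\<close>, of \<rho>] in auto)
qed simp

lemma cmp_const: "cmp k (\<lambda>\<rho>. w)"
proof (rule cmpI)
  show "ispoly (\<lambda>n. 2 * length w + 3)" by (intro ispoly.intros)
  fix \<rho> :: "nat \<Rightarrow> bool list" assume e: "fresh k \<rho>"
  show "run (emit k (rev w)) (st \<rho>) (2 * length w + 3) (st (\<rho>(k := w)))"
    using run_emit[of k "rev w" "st \<rho>"] freshD[OF e] by (simp add: st_upd) (simp add: st_def)
qed simp

text \<open>Composition in the form of a local variable: the value of \<open>f\<close> occupies
  register \<open>k\<close> while \<open>g\<close> is evaluated into the next one; then it is erased
  and the result moved down. The scope seen by \<open>g\<close> has size at most
  \<open>n + p n\<close>, whence the composed polynomial.\<close>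

lemma cmp_let:
  assumes "cmp k f" "cmp (Suc k) g"
  shows "cmp k (\<lambda>\<rho>. g (\<rho>(k := f \<rho>)))"
proof -
  obtain c p where ev: "evaluates c p k f" using assms(1) by (auto simp: cmp_def)
  note c = evaluatesD(1,2)[OF ev] and rc = evaluatesD(3)[OF ev] and lc = evaluatesD(4)[OF ev]
  obtain d q where ev': "evaluates d q (Suc k) g" using assms(2) by (auto simp: cmp_def)
  note d = evaluatesD(1,2)[OF ev'] and rd = evaluatesD(3)[OF ev'] and ld = evaluatesD(4)[OF ev']
  show ?thesis
  proof (rule cmpI)
    show "wfc (Seq c (Seq d (Seq (clear k) (transfer (Suc k) (Suc (Suc k)) k))))"
      using c d by simp
    have "ispoly (\<lambda>n. q (n + p n))" using ispoly_comp[OF d(2) ispoly.add[OF ispoly.id c(2)]] .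
    then show "ispoly (\<lambda>n. p n + q (n + p n) + (2 * p n + 1) + (10 * q (n + p n) + 3) + 3)"
      by (intro ispoly.intros c)
    fix \<rho> :: "nat \<Rightarrow> bool list" assume e: "fresh k \<rho>"
    define \<rho>' where "\<rho>' = \<rho>(k := f \<rho>)"
    let ?n = "tsize k \<rho>"
    have e': "fresh (Suc k) \<rho>'" using e by (auto simp: \<rho>'_def fresh_def)
    have t: "tsize (Suc k) \<rho>' \<le> ?n + p ?n" using lc[OF e] by (simp add: \<rho>'_def tsize_upd)
    then have q: "q (tsize (Suc k) \<rho>') \<le> q (?n + p ?n)" by (rule ispoly_mono[OF d(2)])
    have 1: "run c (st \<rho>) (p ?n) (st \<rho>')" unfolding \<rho>'_def by (rule rc[OF e])
    have 2: "run d (st \<rho>') (q (tsize (Suc k) \<rho>')) (st (\<rho>'(Suc k := g \<rho>')))" by (rule rd[OF e'])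
    have 3: "run (clear k) (st (\<rho>'(Suc k := g \<rho>'))) (2 * length (st (\<rho>'(Suc k := g \<rho>')) k) + 1)
        ((st (\<rho>'(Suc k := g \<rho>')))(k := []))"
      by (rule run_clear) (auto simp: st_def)
    have 4: "run (transfer (Suc k) (Suc (Suc k)) k) ((st (\<rho>'(Suc k := g \<rho>')))(k := []))
      (10 * length (g \<rho>') + 3)
      ((st (\<rho>'(Suc k := g \<rho>')))(k := [], Suc k := [], k := map bit_sym (g \<rho>')))"
      using e' by (intro run_transfer) (auto simp: st_def fresh_def)
    have 5: "(st (\<rho>'(Suc k := g \<rho>')))(k := [], Suc k := [], k := map bit_sym (g \<rho>'))
        = st (\<rho>(k := g \<rho>'))"
      using e by (auto simp: st_def \<rho>'_def fun_eq_iff fresh_def)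
    have "length (g \<rho>') \<le> q (?n + p ?n)" using ld[OF e'] q by linarith
    moreover have "length (st (\<rho>'(Suc k := g \<rho>')) k) \<le> p ?n"
      using lc[OF e] by (simp add: st_def \<rho>'_def)
    ultimately show "run (Seq c (Seq d (Seq (clear k) (transfer (Suc k) (Suc (Suc k)) k)))) (st \<rho>)
      (p ?n + q (?n + p ?n) + (2 * p ?n + 1) + (10 * q (?n + p ?n) + 3) + 3)
      (st (\<rho>(k := g (\<rho>(k := f \<rho>)))))"
      using run_seq[OF 1 run_seq[OF 2 run_seq[OF 3 4]]] q unfolding 5 \<rho>'_def[symmetric]
      by (elim run_mono) linarith
  qed
qed

text \<open>An expression over the variables below \<open>m\<close> must remain computable in every
  larger scope, because it may be evaluated after further local variables have been bound; the first
  conjunct ensures that these do not affect its value.\<close>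

definition expr :: "nat \<Rightarrow> ((nat \<Rightarrow> bool list) \<Rightarrow> bool list) \<Rightarrow> bool" where
  "expr m f \<longleftrightarrow> (\<forall>\<rho> \<rho>'. (\<forall>j<m. \<rho> j = \<rho>' j) \<longrightarrow> f \<rho> = f \<rho>') \<and> (\<forall>k\<ge>m. cmp k f)"

lemma expr_cmp: "expr m f \<Longrightarrow> m \<le> k \<Longrightarrow> cmp k f"
  by (simp add: expr_def)

lemma expr_var: "i < m \<Longrightarrow> expr m (\<lambda>\<rho>. \<rho> i)"
  by (simp add: expr_def cmp_var)

lemma expr_const: "expr m (\<lambda>\<rho>. w)"
  by (simp add: expr_def cmp_const)

lemma expr_indep: "expr m f \<Longrightarrow> m \<le> k \<Longrightarrow> f (\<rho>(k := w)) = f \<rho>"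
  unfolding expr_def by (metis fun_upd_apply not_le)

text \<open>Polynomial time phrased as a closure property of \<open>expr\<close>. Composites are
  then handled by introduction rules; \<open>fp1_tm\<close> and \<open>fp1_poly_time\<close> connect
  this notion with Turing machines.\<close>

definition fp1 :: "(bool list \<Rightarrow> bool list) \<Rightarrow> bool" where
  "fp1 F \<longleftrightarrow> (\<forall>m f. expr m f \<longrightarrow> expr m (\<lambda>\<rho>. F (f \<rho>)))"

definition fp2 :: "(bool list \<Rightarrow> bool list \<Rightarrow> bool list) \<Rightarrow> bool" where
  "fp2 F \<longleftrightarrow> (\<forall>m f g. expr m f \<longrightarrow> expr m g \<longrightarrow> expr m (\<lambda>\<rho>. F (f \<rho>) (g \<rho>)))"

definition fp3 :: "(bool list \<Rightarrow> bool list \<Rightarrow> bool list \<Rightarrow> bool list) \<Rightarrow> bool" where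
  "fp3 F \<longleftrightarrow> (\<forall>m f g h. expr m f \<longrightarrow> expr m g \<longrightarrow> expr m h \<longrightarrow> expr m (\<lambda>\<rho>. F (f \<rho>) (g \<rho>) (h \<rho>)))"

lemma fp1D: "fp1 F \<Longrightarrow> expr m f \<Longrightarrow> expr m (\<lambda>\<rho>. F (f \<rho>))"
  by (simp add: fp1_def)

lemma fp2D: "fp2 F \<Longrightarrow> expr m f \<Longrightarrow> expr m g \<Longrightarrow> expr m (\<lambda>\<rho>. F (f \<rho>) (g \<rho>))"
  by (simp add: fp2_def)

lemma fp3D: "fp3 F \<Longrightarrow> expr m f \<Longrightarrow> expr m g \<Longrightarrow> expr m h \<Longrightarrow> expr m (\<lambda>\<rho>. F (f \<rho>) (g \<rho>) (h \<rho>))"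
  by (simp add: fp3_def)

lemma fp1I:
  assumes "\<And>k i. i < k \<Longrightarrow> cmp k (\<lambda>\<rho>. F (\<rho> i))"
  shows "fp1 F"
  unfolding fp1_def expr_def
proof (intro allI impI conjI)
  fix m f k assume "(\<forall>\<rho> \<rho>'. (\<forall>j<m. \<rho> j = \<rho>' j) \<longrightarrow> f \<rho> = f \<rho>') \<and> (\<forall>k\<ge>m. cmp k f)" "m \<le> k"
  then have "cmp k f" by blast
  from cmp_let[OF this assms[of k "Suc k"]] show "cmp k (\<lambda>\<rho>. F (f \<rho>))" by simp
qed metis

text \<open>The arguments are bound to three fresh registers by nested applications of
  \<open>cmp_let\<close>, the last argument being substituted first. An argument evaluated later
  does not see the registers bound before it, by \<open>expr_indep\<close>.\<close>

lemma fp3I: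
  assumes "\<And>k i j l. i < k \<Longrightarrow> j < k \<Longrightarrow> l < k \<Longrightarrow> cmp k (\<lambda>\<rho>. F (\<rho> i) (\<rho> j) (\<rho> l))"
  shows "fp3 F"
  unfolding fp3_def
proof (intro allI impI)
  fix m f g h assume f: "expr m f" and g: "expr m g" and h: "expr m h"
  have "cmp k (\<lambda>\<rho>. F (f \<rho>) (g \<rho>) (h \<rho>))" if "m \<le> k" for k
  proof -
    have "cmp (Suc (Suc (Suc k))) (\<lambda>\<rho>. F (\<rho> k) (\<rho> (Suc k)) (\<rho> (Suc (Suc k))))" by (rule assms) auto
    from cmp_let[OF expr_cmp[OF h] this] have "cmp (Suc (Suc k)) (\<lambda>\<rho>. F (\<rho> k) (\<rho> (Suc k)) (h \<rho>))"
      using that by simp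
    from cmp_let[OF expr_cmp[OF g] this] have "cmp (Suc k) (\<lambda>\<rho>. F (\<rho> k) (g \<rho>) (h \<rho>))"
      using that expr_indep[OF h, of "Suc k"] by simp
    from cmp_let[OF expr_cmp[OF f that] this] show ?thesis
      using expr_indep[OF g that] expr_indep[OF h that] by simp
  qed
  moreover have "\<forall>\<rho> \<rho>'. (\<forall>j<m. \<rho> j = \<rho>' j) \<longrightarrow> F (f \<rho>) (g \<rho>) (h \<rho>) = F (f \<rho>') (g \<rho>') (h \<rho>')"
    using f g h unfolding expr_def by metis
  ultimately show "expr m (\<lambda>\<rho>. F (f \<rho>) (g \<rho>) (h \<rho>))" unfolding expr_def by blast
qed

lemma fp3_if: "fp3 (\<lambda>x y z. if x = [] then y else z)"
proof (rule fp3I)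
  fix k i j l :: nat assume *: "i < k" "j < k" "l < k"
  obtain c p where ev: "evaluates c p k (\<lambda>\<rho>. \<rho> j)" using cmp_var[OF *(2)] by (auto simp: cmp_def)
  note c = evaluatesD(1,2)[OF ev] and rc = evaluatesD(3)[OF ev]
  obtain d q where ev': "evaluates d q k (\<lambda>\<rho>. \<rho> l)" using cmp_var[OF *(3)] by (auto simp: cmp_def)
  note d = evaluatesD(1,2)[OF ev'] and rd = evaluatesD(3)[OF ev']
  show "cmp k (\<lambda>\<rho>. if \<rho> i = [] then \<rho> j else \<rho> l)"
  proof (rule cmpI)
    show "wfc (Branch i 0 c d)" using c d by simp
    show "ispoly (\<lambda>n. Suc (p n + q n))" using c d by (intro ispoly_Suc ispoly.intros)
    fix \<rho> :: "nat \<Rightarrow> bool list" assume e: "fresh k \<rho>"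
    show "run (Branch i 0 c d) (st \<rho>) (Suc (p (tsize k \<rho>) + q (tsize k \<rho>)))
        (st (\<rho>(k := if \<rho> i = [] then \<rho> j else \<rho> l)))"
    proof (rule run_branch, cases "\<rho> i")
      case Nil
      then have "run c (st \<rho>) (p (tsize k \<rho>) + q (tsize k \<rho>)) (st (\<rho>(k := if \<rho> i = [] then \<rho> j else \<rho> l)))"
        using run_mono[OF rc[OF e], of "p (tsize k \<rho>) + q (tsize k \<rho>)"] by simp
      then show "run (if peek (st \<rho> i) = 0 then c else d) (st \<rho>) (p (tsize k \<rho>) + q (tsize k \<rho>))
          (st (\<rho>(k := if \<rho> i = [] then \<rho> j else \<rho> l)))"
        using Nil by (simp add: st_def)
    next
      case (Cons b xs)
      then have "run d (st \<rho>) (p (tsize k \<rho>) + q (tsize k \<rho>)) (st (\<rho>(k := if \<rho> i = [] then \<rho> j else \<rho> l)))"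
        using run_mono[OF rd[OF e], of "p (tsize k \<rho>) + q (tsize k \<rho>)"] by simp
      then show "run (if peek (st \<rho> i) = 0 then c else d) (st \<rho>) (p (tsize k \<rho>) + q (tsize k \<rho>))
          (st (\<rho>(k := if \<rho> i = [] then \<rho> j else \<rho> l)))"
        using Cons by (simp add: st_def)
    qed
  qed
qed

text \<open>Limited recursion on notation in the sense of Cobham. As \<open>len\<close> speaks about
  all lists, it applies to every prefix and so bounds each intermediate accumulator; this excludes,
  for example, unrestricted repeated doubling.\<close>

lemma fp3_fold:
  assumes F: "\<And>b. fp2 (F b)" and q: "ispoly q"
    and len: "\<And>xs a y. length (fold (\<lambda>b a. F b a y) xs a) \<le> q (length xs + length a + length y)"
  shows "fp3 (\<lambda>xs a y. fold (\<lambda>b a. F b a y) xs a)"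
proof (rule fp3I)
  fix k i j l :: nat assume *: "i < k" "j < k" "l < k"
  let ?K = "Suc (Suc k)"
  have "\<exists>c p. evaluates c p ?K (\<lambda>\<rho>. F b (\<rho> (Suc k)) (\<rho> l))" for b
    using expr_cmp[OF fp2D[OF F[of b] expr_var[of "Suc k" ?K] expr_var[of l ?K]] order_refl] *
    by (simp add: cmp_def)
  then obtain c0 p0 c1 p1 where "evaluates c0 p0 ?K (\<lambda>\<rho>. F False (\<rho> (Suc k)) (\<rho> l))"
      "evaluates c1 p1 ?K (\<lambda>\<rho>. F True (\<rho> (Suc k)) (\<rho> l))"
    by blast
  moreover define c p where "c b = (if b then c1 else c0)" and "p b = (if b then p1 else p0)" for b
  ultimately have ev: "evaluates (c b) (p b) ?K (\<lambda>\<rho>. F b (\<rho> (Suc k)) (\<rho> l))" for b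
    by (cases b) auto
  note c = evaluatesD(1)[OF ev] and p = evaluatesD(2)[OF ev] and rc = evaluatesD(3)[OF ev]
  define body where "body b = Seq (Pop k) (Seq (c b) (Seq (clear (Suc k)) (transfer ?K (Suc ?K) (Suc k))))" for b
  define loop where "loop = Loop k 0 (Branch k 1 (body False) (body True))"
  \<comment> \<open>Cost of one round. During it the scope holds the variables (size at most
    \<open>n\<close>), the rest of the list (at most \<open>n\<close>) and the accumulator (at most
    \<open>A\<close>).\<close>
  define C where "C n A = p False (2 * n + A) + p True (2 * n + A) + 12 * A + 10" for n A
  have loop: "run loop (st (\<rho>(k := ys, Suc k := a))) (length ys * C n A + 1)
      (st (\<rho>(k := [], Suc k := fold (\<lambda>b a. F b a (\<rho> l)) ys a)))"
    if e: "fresh k \<rho>" and n: "tsize k \<rho> \<le> n" "length ys \<le> n"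
      and A: "\<And>t. length (fold (\<lambda>b a. F b a (\<rho> l)) (take t ys) a) \<le> A" for \<rho> n A ys a
    using n(2) A
  proof (induction ys arbitrary: a)
    case Nil
    have "peek (st (\<rho>(k := [], Suc k := a)) k) = 0" by (simp add: st_def)
    then have "run loop (st (\<rho>(k := [], Suc k := a))) 1 (st (\<rho>(k := [], Suc k := a)))"
      unfolding loop_def by (rule run_loop_end)
    then show ?case by (simp del: fun_upd_apply)
  next
    case (Cons b ys)
    let ?\<rho> = "\<rho>(k := ys, Suc k := a)"
    let ?a = "F b a (\<rho> l)"
    have A0: "length a \<le> A" using Cons.prems(2)[of 0] by simp
    have A1: "length ?a \<le> A" using Cons.prems(2)[of 1] by simp
    have 1: "run (Pop k) (st (\<rho>(k := b # ys, Suc k := a))) 1 (st ?\<rho>)"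
      using run_pop[of k "st (\<rho>(k := b # ys, Suc k := a))"]
      by (simp add: st_upd fun_upd_twist)
    have "tsize ?K ?\<rho> \<le> 2 * n + A" using tsize_upd[of "Suc k" "\<rho>(k := ys)" a] A0 Cons.prems(1) n(1)
      by (simp add: tsize_upd)
    then have pb: "p b (tsize ?K ?\<rho>) \<le> p b (2 * n + A)" by (rule ispoly_mono[OF p])
    have "run (c b) (st ?\<rho>) (p b (tsize ?K ?\<rho>)) (st (?\<rho>(?K := F b (?\<rho> (Suc k)) (?\<rho> l))))"
      using e by (intro rc) (auto simp: fresh_def)
    then have 2: "run (c b) (st ?\<rho>) (p b (tsize ?K ?\<rho>)) (st (?\<rho>(?K := ?a)))"
      using * by simp
    have 3: "run (clear (Suc k)) (st (?\<rho>(?K := ?a))) (2 * length (st (?\<rho>(?K := ?a)) (Suc k)) + 1)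
        ((st (?\<rho>(?K := ?a)))(Suc k := []))"
      by (rule run_clear) (auto simp: st_def)
    have 4: "run (transfer ?K (Suc ?K) (Suc k)) ((st (?\<rho>(?K := ?a)))(Suc k := [])) (10 * length ?a + 3)
        ((st (?\<rho>(?K := ?a)))(Suc k := [], ?K := [], Suc k := map bit_sym ?a))"
      using e by (intro run_transfer) (auto simp: st_def fresh_def)
    have 5: "(st (?\<rho>(?K := ?a)))(Suc k := [], ?K := [], Suc k := map bit_sym ?a) = st (\<rho>(k := ys, Suc k := ?a))"
      using e by (auto simp: st_def fun_eq_iff fresh_def)
    have "length (st (?\<rho>(?K := ?a)) (Suc k)) \<le> A" using A0 by (simp add: st_def)
    \<comment> \<open>Two steps of the budget are kept back for the branch and for the loop
      test.\<close>
    then have "run (body b) (st (\<rho>(k := b # ys, Suc k := a))) (C n A - 2) (st (\<rho>(k := ys, Suc k := ?a)))"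
      using run_seq[OF 1 run_seq[OF 2 run_seq[OF 3 4]]] pb A1 unfolding 5 body_def
      by (elim run_mono) (cases b; simp add: C_def)
    then have "run (Branch k 1 (body False) (body True)) (st (\<rho>(k := b # ys, Suc k := a)))
       (Suc (C n A - 2)) (st (\<rho>(k := ys, Suc k := ?a)))"
      by (intro run_branch) (cases b; simp add: st_def bit_sym_def)
    moreover have "run loop (st (\<rho>(k := ys, Suc k := ?a))) (length ys * C n A + 1)
      (st (\<rho>(k := [], Suc k := fold (\<lambda>b a. F b a (\<rho> l)) ys ?a)))"
      using Cons.prems(1) Cons.prems(2)[of "Suc t" for t] by (intro Cons.IH) auto
    ultimately have "run loop (st (\<rho>(k := b # ys, Suc k := a)))
       (Suc (Suc (C n A - 2) + (length ys * C n A + 1)))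
       (st (\<rho>(k := [], Suc k := fold (\<lambda>b a. F b a (\<rho> l)) ys ?a)))"
      unfolding loop_def by (intro run_loop_step) (auto simp: st_def)
    moreover have "2 \<le> C n A" by (simp add: C_def)
    moreover have "fold (\<lambda>b a. F b a (\<rho> l)) (b # ys) a = fold (\<lambda>b a. F b a (\<rho> l)) ys ?a" by simp
    ultimately show ?case by (simp only:) (erule run_mono, simp)
  qed
  show "cmp k (\<lambda>\<rho>. fold (\<lambda>b a. F b a (\<rho> l)) (\<rho> i) (\<rho> j))"
  proof (rule cmpI)
    let ?c = "Seq (copy i (Suc k) k) (Seq (copy j (Suc (Suc k)) (Suc k)) (Seq loop (transfer (Suc k) (Suc (Suc k)) k)))"
    let ?p = "\<lambda>n. (12 * n + 3) + (12 * n + 3) + (n * (p False (2 * n + q (3 * n)) + p True (2 * n + q (3 * n))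
       + 12 * q (3 * n) + 10) + 1) + (10 * q (3 * n) + 3) + 3"
    show "wfc ?c" using c by (simp add: loop_def body_def)
    have q3: "ispoly (\<lambda>n. q (3 * n))"
      using ispoly_comp[OF q ispoly.mult[OF ispoly.const ispoly.id]] .
    have "ispoly (\<lambda>n. p b (2 * n + q (3 * n)))" for b
      using ispoly_comp[OF p ispoly.add[OF ispoly.mult[OF ispoly.const ispoly.id] q3]] .
    then show "ispoly ?p" by (intro ispoly.intros q3)
    fix \<rho> :: "nat \<Rightarrow> bool list" assume e: "fresh k \<rho>"
    let ?n = "tsize k \<rho>"
    let ?xs = "\<rho> i" let ?a = "\<rho> j" let ?R = "fold (\<lambda>b a. F b a (\<rho> l)) ?xs ?a"
    have n: "length ?xs \<le> ?n" "length ?a \<le> ?n" "length (\<rho> l) \<le> ?n" using * by (auto intro: tsize_ge)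
    have A: "length (fold (\<lambda>b a. F b a (\<rho> l)) (take t ?xs) ?a) \<le> q (3 * ?n)" for t
      using n by (intro order.trans[OF len] ispoly_mono[OF q]) auto
    have 1: "run (copy i (Suc k) k) (st \<rho>) (12 * length ?xs + 3) ((st \<rho>)(k := map bit_sym ?xs))"
      using e * by (intro run_copy) (auto simp: st_def fresh_def)
    have 2: "run (copy j (Suc (Suc k)) (Suc k)) ((st \<rho>)(k := map bit_sym ?xs)) (12 * length ?a + 3)
        ((st \<rho>)(k := map bit_sym ?xs, Suc k := map bit_sym ?a))"
      using e * by (intro run_copy) (auto simp: st_def fresh_def)
    have 3: "run loop ((st \<rho>)(k := map bit_sym ?xs, Suc k := map bit_sym ?a)) (length ?xs * C ?n (q (3 * ?n)) + 1)
      (st (\<rho>(k := [], Suc k := ?R)))"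
      using loop[OF e order_refl n(1) A] by (simp add: st_upd)
    have 4: "run (transfer (Suc k) (Suc (Suc k)) k) (st (\<rho>(k := [], Suc k := ?R))) (10 * length ?R + 3)
      ((st (\<rho>(k := [], Suc k := ?R)))(Suc k := [], k := map bit_sym ?R))"
      using e by (intro run_transfer) (auto simp: st_def fresh_def)
    have 5: "(st (\<rho>(k := [], Suc k := ?R)))(Suc k := [], k := map bit_sym ?R) = st (\<rho>(k := ?R))"
      using e by (auto simp: st_def fun_eq_iff fresh_def)
    have "length ?R \<le> q (3 * ?n)" using A[of "length ?xs"] by simp
    moreover have "length ?xs * C ?n (q (3 * ?n)) \<le> ?n * C ?n (q (3 * ?n))" using n by simp
    ultimately show "run ?c (st \<rho>) (?p ?n) (st (\<rho>(k := ?R)))"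
      using run_seq[OF 1 run_seq[OF 2 run_seq[OF 3 4]]] n unfolding 5 C_def
      by (elim run_mono) linarith
  qed
qed

section \<open>Finite transducers\<close>

text \<open>A sequential transducer: \<open>\<delta>\<close> emits a word for every letter, and
  \<open>e\<close> emits a final word that depends on the last state.\<close>

fun transduce :: "(nat \<Rightarrow> bool \<Rightarrow> nat \<times> bool list) \<Rightarrow> (nat \<Rightarrow> bool list) \<Rightarrow> nat \<Rightarrow> bool list \<Rightarrow> bool list" where
  "transduce \<delta> e q [] = e q"
| "transduce \<delta> e q (b # xs) = snd (\<delta> q b) @ transduce \<delta> e (fst (\<delta> q b)) xs"

text \<open>Register \<open>k\<close> holds the unread input, \<open>k + 1\<close> the state as a
  single symbol, and \<open>k + 2\<close> the output in reverse order, which the final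
  \<open>move\<close> turns round.\<close>

lemma fp1_transduce:
  assumes \<delta>: "\<And>q b. q < Q \<Longrightarrow> fst (\<delta> q b) < Q" and q0: "q0 < Q"
  shows "fp1 (transduce \<delta> e q0)"
proof (rule fp1I)
  fix k i :: nat assume i: "i < k"
  define W where "W = (\<Sum>q<Q. length (snd (\<delta> q False)) + length (snd (\<delta> q True)) + length (e q))"
  have W: "length (snd (\<delta> q b)) \<le> W" "length (e q) \<le> W" if "q < Q" for q b
    using member_le_sum[of q "{..<Q}" "\<lambda>q. length (snd (\<delta> q False)) + length (snd (\<delta> q True)) + length (e q)"] that
    by (cases b; simp add: W_def)+
  define act where "act q b = Seq (Pop k) (Seq (Pop (Suc k))
    (Seq (Push (Suc k) (Suc (fst (\<delta> q b)))) (emit (k + 2) (snd (\<delta> q b)))))" for q b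
  define loop where "loop = Loop k 0 (switch (Suc k) Q skip (\<lambda>q. Branch k 1 (act q False) (act q True)))"
  define fin where "fin = switch (Suc k) Q skip (\<lambda>q. Seq (Pop (Suc k)) (emit (k + 2) (e q)))"
  have loop: "\<exists>q'<Q. \<exists>out. transduce \<delta> e q ys = out @ e q' \<and> length out \<le> length ys * W \<and>
     run loop \<sigma> (length ys * (2 * W + Q + 11) + 1)
      (\<sigma>(k := [], Suc k := [Suc q'], k + 2 := map bit_sym (rev out) @ \<sigma> (k + 2)))"
    if "\<sigma> k = map bit_sym ys" "\<sigma> (Suc k) = [Suc q]" "q < Q" for \<sigma> ys q
    using that
  proof (induction ys arbitrary: q \<sigma>)
    case Nil
    then have "run loop \<sigma> 1 \<sigma>" unfolding loop_def by (intro run_loop_end) simp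
    moreover have "\<sigma>(k := [], Suc k := [Suc q], k + 2 := map bit_sym (rev []) @ \<sigma> (k + 2)) = \<sigma>"
      using Nil by (auto simp: fun_eq_iff)
    ultimately show ?case using Nil by (intro exI[of _ q] conjI exI[of _ "[]"]) (simp_all del: fun_upd_apply)
  next
    case (Cons b ys)
    let ?q = "fst (\<delta> q b)" and ?w = "snd (\<delta> q b)"
    let ?\<sigma> = "\<sigma>(k := map bit_sym ys, Suc k := [Suc ?q], k + 2 := map bit_sym (rev ?w) @ \<sigma> (k + 2))"
    have q': "?q < Q" using \<delta> Cons.prems by blast
    have w: "length ?w \<le> W" using W Cons.prems by blast
    let ?\<sigma>1 = "\<sigma>(k := map bit_sym ys)" let ?\<sigma>2 = "?\<sigma>1(Suc k := [])" let ?\<sigma>3 = "?\<sigma>2(Suc k := [Suc ?q])"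
    have 1: "run (Pop k) \<sigma> 1 ?\<sigma>1" using run_pop[of k \<sigma>] Cons.prems by simp
    have 2: "run (Pop (Suc k)) ?\<sigma>1 1 ?\<sigma>2" using run_pop[of "Suc k" ?\<sigma>1] Cons.prems by simp
    have 3: "run (Push (Suc k) (Suc ?q)) ?\<sigma>2 1 ?\<sigma>3" using run_push[of "Suc k" "Suc ?q" ?\<sigma>2] by simp
    have 4: "run (emit (k + 2) ?w) ?\<sigma>3 (2 * length ?w + 3) (?\<sigma>3(k + 2 := map bit_sym (rev ?w) @ ?\<sigma>3 (k + 2)))"
      by (rule run_emit)
    have 5: "?\<sigma>3(k + 2 := map bit_sym (rev ?w) @ ?\<sigma>3 (k + 2)) = ?\<sigma>" by (auto simp: fun_eq_iff)
    have act: "run (act q b) \<sigma> (2 * W + 9) ?\<sigma>"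
      using run_seq[OF 1 run_seq[OF 2 run_seq[OF 3 4]]] w unfolding 5 act_def by (elim run_mono) simp
    have "run (Branch k 1 (act q False) (act q True)) \<sigma> (Suc (2 * W + 9)) ?\<sigma>"
      using Cons.prems act by (intro run_branch) (cases b; simp)
    then have "run (switch (Suc k) Q skip (\<lambda>q. Branch k 1 (act q False) (act q True))) \<sigma> (Suc (2 * W + 9) + Q) ?\<sigma>"
      using Cons.prems by (intro run_switch) auto
    note step = this
    have "?\<sigma> k = map bit_sym ys" "?\<sigma> (Suc k) = [Suc ?q]" by simp_all
    from Cons.IH[OF this q'] obtain q'' out where IH: "q'' < Q" "transduce \<delta> e ?q ys = out @ e q''"
       "length out \<le> length ys * W"
       "run loop ?\<sigma> (length ys * (2 * W + Q + 11) + 1)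
      (?\<sigma>(k := [], Suc k := [Suc q''], k + 2 := map bit_sym (rev out) @ ?\<sigma> (k + 2)))" by blast
    have 6: "?\<sigma>(k := [], Suc k := [Suc q''], k + 2 := map bit_sym (rev out) @ ?\<sigma> (k + 2))
      = \<sigma>(k := [], Suc k := [Suc q''], k + 2 := map bit_sym (rev (?w @ out)) @ \<sigma> (k + 2))"
      by (auto simp: fun_eq_iff)
    have "run loop \<sigma> (Suc (Suc (2 * W + 9) + Q + (length ys * (2 * W + Q + 11) + 1)))
      (\<sigma>(k := [], Suc k := [Suc q''], k + 2 := map bit_sym (rev (?w @ out)) @ \<sigma> (k + 2)))"
      using run_loop_step[of \<sigma> k 0, OF _ step IH(4)[unfolded loop_def]] Cons.prems unfolding 6 loop_def by simp
    then have "run loop \<sigma> (length (b # ys) * (2 * W + Q + 11) + 1)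
      (\<sigma>(k := [], Suc k := [Suc q''], k + 2 := map bit_sym (rev (?w @ out)) @ \<sigma> (k + 2)))"
      by (elim run_mono) simp
    then show ?case using IH(1-3) w by (intro exI[of _ q''] conjI exI[of _ "?w @ out"]) (simp_all del: fun_upd_apply)
  qed
  show "cmp k (\<lambda>\<rho>. transduce \<delta> e q0 (\<rho> i))"
  proof (rule cmpI)
    let ?c = "Seq (copy i (Suc k) k) (Seq (Push (Suc k) (Suc q0)) (Seq loop (Seq fin (move (k + 2) k))))"
    let ?p = "\<lambda>n. (12 * n + 3) + (n * (2 * W + Q + 11) + 1) + (2 * W + 5 + Q) + 5 * (n * W + W) + 6"
    show "wfc ?c" by (auto simp: loop_def fin_def act_def intro!: wfc_switch)
    show "ispoly ?p" by (intro ispoly.intros)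
    fix \<rho> assume e: "fresh k \<rho>"
    let ?n = "tsize k \<rho>" and ?xs = "\<rho> i"
    have n: "length ?xs \<le> ?n" using i by (rule tsize_ge)
    let ?\<sigma>1 = "(st \<rho>)(k := map bit_sym ?xs)" let ?\<sigma>2 = "?\<sigma>1(Suc k := [Suc q0])"
    have 1: "run (copy i (Suc k) k) (st \<rho>) (12 * length ?xs + 3) ?\<sigma>1"
      using e i by (intro run_copy) (auto simp: st_def fresh_def)
    have 2: "run (Push (Suc k) (Suc q0)) ?\<sigma>1 1 ?\<sigma>2"
      using run_push[of "Suc k" "Suc q0" ?\<sigma>1] freshD[OF e, of "Suc k"] by (simp add: st_def)
    from loop[of ?\<sigma>2 ?xs q0] q0 obtain q' out where q': "q' < Q" and out: "transduce \<delta> e q0 ?xs = out @ e q'"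
      "length out \<le> length ?xs * W" and
      3: "run loop ?\<sigma>2 (length ?xs * (2 * W + Q + 11) + 1)
      (?\<sigma>2(k := [], Suc k := [Suc q'], k + 2 := map bit_sym (rev out) @ ?\<sigma>2 (k + 2)))" by auto
    let ?\<sigma>3 = "?\<sigma>2(k := [], Suc k := [Suc q'], k + 2 := map bit_sym (rev out) @ ?\<sigma>2 (k + 2))"
    let ?\<sigma>4 = "?\<sigma>3(Suc k := [])" let ?\<sigma>5 = "?\<sigma>4(k + 2 := map bit_sym (rev (out @ e q')))"
    have 41: "run (Pop (Suc k)) ?\<sigma>3 1 ?\<sigma>4" using run_pop[of "Suc k" ?\<sigma>3] by simp
    have 42: "run (emit (k + 2) (e q')) ?\<sigma>4 (2 * length (e q') + 3) ?\<sigma>5"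
      using run_emit[of "k + 2" "e q'" ?\<sigma>4] freshD[OF e, of "k + 2"] by (simp add: st_def)
    have 4: "run fin ?\<sigma>3 (Suc (1 + (2 * length (e q') + 3)) + Q) ?\<sigma>5"
      unfolding fin_def using q' by (intro run_switch[of _ _ q'] run_seq[OF 41 42]) auto
    have 5: "run (move (k + 2) k) ?\<sigma>5 (5 * length (out @ e q') + 1) (st (\<rho>(k := transduce \<delta> e q0 ?xs)))"
    proof -
      have "?\<sigma>5(k + 2 := [], k := map bit_sym (rev (rev (out @ e q'))) @ ?\<sigma>5 k) = st (\<rho>(k := transduce \<delta> e q0 ?xs))"
        using e by (auto simp: fun_eq_iff st_def fresh_def out)
      then show ?thesis using run_move[of "k + 2" k ?\<sigma>5 "rev (out @ e q')"] by (simp add: algebra_simps)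
    qed
    have e: "length (e q') \<le> W" using W q' by blast
    moreover have "length ?xs * W \<le> ?n * W" using n by simp
    then have "length out + length (e q') \<le> ?n * W + W" using e out(2) by linarith
    moreover have "length ?xs * (2 * W + Q + 11) \<le> ?n * (2 * W + Q + 11)" using n by simp
    ultimately show "run ?c (st \<rho>) (?p ?n) (st (\<rho>(k := transduce \<delta> e q0 ?xs)))"
      using run_seq[OF 1 run_seq[OF 2 run_seq[OF 3 run_seq[OF 4 5]]]] n
      by (elim run_mono) (simp add: algebra_simps)
  qed
qed

lemma ispoly_power: "ispoly (\<lambda>n. n ^ d)"
  by (induction d) (auto intro: ispoly.intros ispoly.const[of 1])

section \<open>Running Turing machines as stack programs\<close>

text \<open>A Turing machine runs on the registers \<open>k\<close> (the head cell and everything right of it),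
  \<open>k + 1\<close> (the cells left of the head) and \<open>k + 2\<close> (the state).
  As 0 cannot be pushed, the blank is represented by \<open>K\<close>.\<close>

context
  fixes Q K :: nat and \<delta> :: tm and k :: nat
  assumes valid: "valid_tm Q K \<delta>"
begin

definition sy :: "nat \<Rightarrow> nat" where
  "sy s = (if s = 0 then K else s)"

text \<open>A stack represents one half of the infinite tape: both the symbol \<open>K\<close> and
  everything beyond the stack are read as blank.\<close>

definition rd :: "nat list \<Rightarrow> nat \<Rightarrow> nat" where
  "rd l i = (if i < length l then if l ! i = K then 0 else l ! i else 0)"

definition rep :: "store \<Rightarrow> conf \<Rightarrow> bool" where
  "rep \<sigma> c \<longleftrightarrow> (case c of (q, tp, h) \<Rightarrow> q < Q \<and> \<sigma> (k + 2) = [Suc q] \<and>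
     (\<forall>i. tp (h + int i) = rd (\<sigma> k) i) \<and> (\<forall>i. tp (h - 1 - int i) = rd (\<sigma> (k + 1)) i) \<and>
     set (\<sigma> k) \<subseteq> {1..K} \<and> set (\<sigma> (k + 1)) \<subseteq> {1..K})"

text \<open>A move to the left fetches its cell from the left stack and creates a blank if that
  stack is exhausted. A move to the right needs no such case, since an empty right stack already
  reads as blank.\<close>

definition act :: "nat \<Rightarrow> nat \<Rightarrow> com" where
  "act q s = (case \<delta> q s of (q', s', d) \<Rightarrow> Seq (Pop k) (Seq (Pop (k + 2)) (Seq (Push (k + 2) (Suc q'))
     (if d = 0 then Push k (sy s') else if d = 1 then Push (k + 1) (sy s')
      else Seq (Push k (sy s')) (switch (k + 1) K (Push k K) (\<lambda>r. Seq (Pop (k + 1)) (Push k (Suc r))))))))"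

definition tm_body :: com where
  "tm_body = switch (k + 2) Q skip (\<lambda>q. switch k K (act q 0) (\<lambda>r. act q (if Suc r = K then 0 else Suc r)))"

lemma K3: "3 \<le> K" "2 \<le> Q"
  using valid by (auto simp: valid_tm_def)

lemma rd_simps: "rd [] i = 0" "rd (v # l) 0 = (if v = K then 0 else v)" "rd (v # l) (Suc i) = rd l i"
  "rd (tl l) i = rd l (Suc i)"
  by (cases l; auto simp: rd_def)+

lemma wfc_tm_body: "wfc tm_body"
  using K3 by (auto simp: tm_body_def act_def sy_def intro!: wfc_switch split: prod.splits)

lemma run_act:
  assumes "rep \<sigma> (q, tp, h)" "q \<noteq> 1"
  shows "\<exists>\<sigma>'. run (act q (tp h)) \<sigma> (K + 12) \<sigma>' \<and> rep \<sigma>' (tm_step \<delta> (q, tp, h)) \<and>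
     (\<forall>j. j \<notin> {k, k + 1, k + 2} \<longrightarrow> \<sigma>' j = \<sigma> j)"
proof -
  define R L where "R = \<sigma> k" and "L = \<sigma> (k + 1)"
  have q: "q < Q" "\<sigma> (k + 2) = [Suc q]" and right: "\<And>i. tp (h + int i) = rd R i"
    and left: "\<And>i. tp (h - 1 - int i) = rd L i" and sets: "set R \<subseteq> {1..K}" "set L \<subseteq> {1..K}"
    using assms(1) by (auto simp: rep_def R_def L_def)
  obtain q' s' d where \<delta>: "\<delta> q (tp h) = (q', s', d)" by (metis prod_cases3)
  have "rd R 0 < K" using sets K3 by (cases R) (auto simp: rd_def)
  then have "tp h < K" using right[of 0] by simp
  then have v: "q' < Q" "s' < K" "d \<in> {-1, 0, 1}"
    using valid q(1) \<delta> unfolding valid_tm_def by fastforce+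
  define T where "T = tp(h := s')"
  have step: "tm_step \<delta> (q, tp, h) = (q', T, h + d)"
    using assms(2) \<delta> by (simp add: tm_step_def T_def)
  have sy: "(if sy s' = K then 0 else sy s') = s'" "sy s' \<in> {1..K}" using v(2) by (auto simp: sy_def)
  have right': "T (h + int i) = rd (sy s' # tl R) i" for i
    using right[of i] sy by (cases i) (auto simp: rd_simps T_def)
  have left': "T (h - 1 - int i) = rd L i" for i using left[of i] by (simp add: T_def)
  have tlR: "set (tl R) \<subseteq> {1..K}" using sets(1) by (cases R) auto
  have tlL: "set (tl L) \<subseteq> {1..K}" using sets(2) by (cases L) auto
  let ?\<sigma>1 = "\<sigma>(k := tl R)" let ?\<sigma>2 = "?\<sigma>1(k + 2 := [])" let ?\<sigma>3 = "?\<sigma>2(k + 2 := [Suc q'])"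
  have 1: "run (Pop k) \<sigma> 1 ?\<sigma>1" using run_pop[of k \<sigma>] by (simp add: R_def)
  have 2: "run (Pop (k + 2)) ?\<sigma>1 1 ?\<sigma>2" using run_pop[of "k + 2" ?\<sigma>1] q by simp
  have 3: "run (Push (k + 2) (Suc q')) ?\<sigma>2 1 ?\<sigma>3" using run_push[of "k + 2" "Suc q'" ?\<sigma>2] by simp
  note pre = run_seq[OF 1 run_seq[OF 2 run_seq[OF 3]]]
  show ?thesis
  proof (cases "d = -1")
    case False
    show ?thesis
    proof (cases "d = 0")
      case True
      let ?\<sigma> = "?\<sigma>3(k := sy s' # tl R)"
      have 4: "run (Push k (sy s')) ?\<sigma>3 1 ?\<sigma>" using run_push[of k "sy s'" ?\<sigma>3] by simp
      have "run (act q (tp h)) \<sigma> (K + 12) ?\<sigma>" using pre[OF 4] True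
        by (auto simp: act_def \<delta> elim!: run_mono)
      moreover have "rep ?\<sigma> (q', T, h + d)"
        using True right' left' sy sets(2) tlR v(1) by (simp add: rep_def L_def)
      ultimately show ?thesis unfolding step by (intro exI[of _ ?\<sigma>]) auto
    next
      case d0: False
      then have d: "d = 1" using v False by auto
      let ?\<sigma> = "?\<sigma>3(k + 1 := sy s' # L)"
      have 4: "run (Push (k + 1) (sy s')) ?\<sigma>3 1 ?\<sigma>" using run_push[of "k + 1" "sy s'" ?\<sigma>3] by (simp add: L_def)
      have "run (act q (tp h)) \<sigma> (K + 12) ?\<sigma>" using pre[OF 4] d
        by (auto simp: act_def \<delta> elim!: run_mono)
      moreover have "T (h + 1 + int i) = rd (tl R) i" for i
        using right'[of "Suc i"] by (simp add: rd_simps algebra_simps)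
      moreover have "T (h + 1 - 1 - int i) = rd (sy s' # L) i" for i
      proof (cases i)
        case (Suc j)
        then show ?thesis using left'[of j] by (simp add: rd_simps algebra_simps)
      qed (use sy in \<open>simp add: rd_simps T_def\<close>)
      ultimately show ?thesis unfolding step using d v(1) sy(2) sets(2) tlR
        by (intro exI[of _ ?\<sigma>]) (simp add: rep_def)
    qed
  next
    case d: True
    let ?\<sigma>4 = "?\<sigma>3(k := sy s' # tl R)"
    have 4: "run (Push k (sy s')) ?\<sigma>3 1 ?\<sigma>4" using run_push[of k "sy s'" ?\<sigma>3] by simp
    define v where "v = (if L = [] then K else hd L)"
    have vK: "v \<in> {1..K}" using sets(2) K3 by (cases L) (auto simp: v_def)
    have v0: "(if v = K then 0 else v) = rd L 0" by (cases L) (auto simp: v_def rd_simps)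
    let ?\<sigma> = "?\<sigma>4(k + 1 := tl L, k := v # sy s' # tl R)"
    have 5: "run (switch (k + 1) K (Push k K) (\<lambda>r. Seq (Pop (k + 1)) (Push k (Suc r)))) ?\<sigma>4 (3 + K) ?\<sigma>"
    proof (cases L)
      case Nil
      then have "?\<sigma> = ?\<sigma>4(k := K # sy s' # tl R)" by (auto simp: fun_eq_iff v_def L_def)
      then have "run (Push k K) ?\<sigma>4 3 ?\<sigma>" using run_mono[OF run_push[of k K ?\<sigma>4]] by simp
      then show ?thesis using Nil by (intro run_switch_default) (auto simp: L_def)
    next
      case (Cons a l)
      obtain r where r: "a = Suc r" "r < K" using sets(2) Cons by (cases a) auto
      have "run (Seq (Pop (k + 1)) (Push k (Suc r))) ?\<sigma>4 (Suc (1 + 1)) ?\<sigma>"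
        using run_seq[OF run_pop[of "k + 1" ?\<sigma>4] run_push[of k "Suc r"]] Cons
        by (simp add: v_def r L_def[symmetric] del: One_nat_def)
      then show ?thesis using r Cons by (intro run_switch[of _ _ r]) (auto simp: L_def eval_nat_numeral)
    qed
    have "run (act q (tp h)) \<sigma> (K + 12) ?\<sigma>" using pre[OF run_seq[OF 4 5]] d
      by (auto simp: act_def \<delta> elim!: run_mono)
    moreover have "T (h - 1 + int i) = rd (v # sy s' # tl R) i" for i
    proof (cases i)
      case 0
      then show ?thesis using left'[of 0] v0 left[of 0] by (simp add: rd_simps)
    next
      case (Suc j)
      then show ?thesis using right'[of j] by (simp add: rd_simps)
    qed
    moreover have "T (h - 1 - 1 - int i) = rd (tl L) i" for i
      using left'[of "Suc i"] by (simp add: rd_simps algebra_simps)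
    ultimately show ?thesis unfolding step using d \<open>q' < Q\<close> sy(2) tlL tlR vK
      by (intro exI[of _ ?\<sigma>]) (simp add: rep_def)
  qed
qed

lemma run_tm_body:
  assumes "rep \<sigma> (q, tp, h)" "q \<noteq> 1"
  shows "\<exists>\<sigma>'. run tm_body \<sigma> (2 * K + Q + 12) \<sigma>' \<and> rep \<sigma>' (tm_step \<delta> (q, tp, h)) \<and>
     (\<forall>j. j \<notin> {k, k + 1, k + 2} \<longrightarrow> \<sigma>' j = \<sigma> j)"
proof -
  obtain \<sigma>' where \<sigma>': "run (act q (tp h)) \<sigma> (K + 12) \<sigma>'" "rep \<sigma>' (tm_step \<delta> (q, tp, h))"
     "\<forall>j. j \<notin> {k, k + 1, k + 2} \<longrightarrow> \<sigma>' j = \<sigma> j"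
    using run_act[OF assms] by blast
  have r: "q < Q" "\<sigma> (k + 2) = [Suc q]" "tp h = rd (\<sigma> k) 0" "set (\<sigma> k) \<subseteq> {1..K}"
    using assms(1) unfolding rep_def by (auto dest: spec[of _ 0])
  have "run (switch k K (act q 0) (\<lambda>r. act q (if Suc r = K then 0 else Suc r))) \<sigma> (K + 12 + K) \<sigma>'"
  proof (cases "\<sigma> k")
    case Nil
    then show ?thesis using \<sigma>'(1) r(3) by (intro run_switch_default) (auto simp: rd_simps)
  next
    case (Cons a l)
    then obtain r where a: "a = Suc r" "r < K" using r(4) by (cases a) auto
    have "tp h = (if Suc r = K then 0 else Suc r)" using Cons a r(3) by (simp add: rd_simps)
    then have "run (act q (if Suc r = K then 0 else Suc r)) \<sigma> (K + 12) \<sigma>'" using \<sigma>'(1) by (simp only:)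
    then show ?thesis by (intro run_switch[where q = r, OF _ a(2)]) (simp_all only: Cons a(1) peek_simps)
  qed
  then have "run tm_body \<sigma> (K + 12 + K + Q) \<sigma>'" unfolding tm_body_def
    using r(1,2) by (intro run_switch[where q = q and n = Q]) simp_all
  then have "run tm_body \<sigma> (2 * K + Q + 12) \<sigma>'" by (rule run_mono) simp
  then show ?thesis using \<sigma>' by blast
qed

text \<open>The loop stops at symbol 2, the code of the halting state 1. If the machine halts before
  step \<open>t\<close>, its configuration stays fixed from then on, so the loop may stop
  early.\<close>

lemma run_tm_loop:
  assumes "rep \<sigma> c" "fst ((tm_step \<delta> ^^ t) c) = 1"
  shows "\<exists>\<sigma>'. run (Loop (k + 2) 2 tm_body) \<sigma> (t * (2 * K + Q + 13) + 1) \<sigma>' \<and>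
    rep \<sigma>' ((tm_step \<delta> ^^ t) c) \<and> (\<forall>j. j \<notin> {k, k + 1, k + 2} \<longrightarrow> \<sigma>' j = \<sigma> j)"
  using assms
proof (induction t arbitrary: \<sigma> c)
  case 0
  obtain q tp h where c: "c = (q, tp, h)" by (metis prod_cases3)
  have "run (Loop (k + 2) 2 tm_body) \<sigma> 1 \<sigma>"
    using 0 by (intro run_loop_end) (simp add: c rep_def)
  then show ?case using 0 by auto
next
  case (Suc t)
  obtain q tp h where c: "c = (q, tp, h)" by (metis prod_cases3)
  show ?case
  proof (cases "q = 1")
    case True
    then have "tm_step \<delta> c = c" by (simp add: c tm_step_def)
    moreover from this have "(tm_step \<delta> ^^ t') c = c" for t' by (induction t') auto
    moreover have "run (Loop (k + 2) 2 tm_body) \<sigma> 1 \<sigma>"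
      using Suc.prems True by (intro run_loop_end) (simp add: c rep_def)
    ultimately show ?thesis using Suc.prems by (intro exI[of _ \<sigma>]) (auto elim: run_mono)
  next
    case False
    obtain \<sigma>1 where \<sigma>1: "run tm_body \<sigma> (2 * K + Q + 12) \<sigma>1" "rep \<sigma>1 (tm_step \<delta> c)"
       "\<forall>j. j \<notin> {k, k + 1, k + 2} \<longrightarrow> \<sigma>1 j = \<sigma> j"
      using run_tm_body[of \<sigma> q tp h] False Suc.prems c by auto
    have "(tm_step \<delta> ^^ Suc t) c = (tm_step \<delta> ^^ t) (tm_step \<delta> c)" by (simp add: funpow_swap1)
    then obtain \<sigma>' where \<sigma>': "run (Loop (k + 2) 2 tm_body) \<sigma>1 (t * (2 * K + Q + 13) + 1) \<sigma>'"
       "rep \<sigma>' ((tm_step \<delta> ^^ Suc t) c)" "\<forall>j. j \<notin> {k, k + 1, k + 2} \<longrightarrow> \<sigma>' j = \<sigma>1 j"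
      using Suc.IH[OF \<sigma>1(2)] Suc.prems(2) by auto
    have "peek (\<sigma> (k + 2)) \<noteq> 2" using Suc.prems False by (simp add: c rep_def)
    from run_loop_step[OF this \<sigma>1(1) \<sigma>'(1)]
    have "run (Loop (k + 2) 2 tm_body) \<sigma> (Suc t * (2 * K + Q + 13) + 1) \<sigma>'"
      by (rule run_mono) simp
    then show ?thesis using \<sigma>'(2,3) \<sigma>1(3) by (intro exI[of _ \<sigma>']) auto
  qed
qed

text \<open>The output is the maximal block of bits from the head onwards. Register
  \<open>k + 3\<close> is a flag whose removal ends the loop at the first symbol that is no
  bit.\<close>

definition out_loop :: com where
  "out_loop = Loop (k + 3) 0 (Branch k 1 (Seq (Pop k) (Push (k + 4) 1))
     (Branch k 2 (Seq (Pop k) (Push (k + 4) 2)) (Pop (k + 3))))"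

lemma run_out_loop:
  assumes "\<sigma> (k + 3) = [1]" "\<And>i. i < length y \<Longrightarrow> rd (\<sigma> k) i = bit_sym (y ! i)"
    "rd (\<sigma> k) (length y) \<notin> {1, 2}"
  shows "run out_loop \<sigma> (6 * length y + 5)
    (\<sigma>(k := drop (length y) (\<sigma> k), k + 3 := [], k + 4 := map bit_sym (rev y) @ \<sigma> (k + 4)))"
  using assms
proof (induction y arbitrary: \<sigma>)
  case Nil
  have "peek (\<sigma> k) \<noteq> 1 \<and> peek (\<sigma> k) \<noteq> 2"
    using Nil(3) K3 by (cases "\<sigma> k") (auto simp: rd_simps split: if_splits)
  then have 1: "run (Branch k 1 (Seq (Pop k) (Push (k + 4) 1))
     (Branch k 2 (Seq (Pop k) (Push (k + 4) 2)) (Pop (k + 3)))) \<sigma> (Suc (Suc 1)) (\<sigma>(k + 3 := []))"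
    using run_pop[of "k + 3" \<sigma>] Nil(1) by (intro run_branch) (simp add: run_branch)
  have 2: "run out_loop (\<sigma>(k + 3 := [])) 1 (\<sigma>(k + 3 := []))"
    unfolding out_loop_def by (rule run_loop_end) simp
  have "run out_loop \<sigma> (Suc (Suc (Suc 1) + 1)) (\<sigma>(k + 3 := []))"
    using run_loop_step[OF _ 1 2[unfolded out_loop_def]] Nil(1) unfolding out_loop_def by simp
  moreover have "\<sigma>(k := drop (length []) (\<sigma> k), k + 3 := [], k + 4 := map bit_sym (rev []) @ \<sigma> (k + 4)) = \<sigma>(k + 3 := [])"
    by (auto simp: fun_eq_iff)
  ultimately show ?case by (auto simp del: fun_upd_apply elim!: run_mono)
next
  case (Cons b y)
  have "rd (\<sigma> k) 0 = bit_sym b" using Cons.prems(2)[of 0] by simp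
  then obtain R where R: "\<sigma> k = bit_sym b # R"
    by (cases "\<sigma> k") (auto simp: rd_simps split: if_splits)
  let ?\<sigma> = "\<sigma>(k := R, k + 4 := bit_sym b # \<sigma> (k + 4))"
  have s: "run (Seq (Pop k) (Push (k + 4) (bit_sym b))) \<sigma> (Suc (1 + 1)) ?\<sigma>"
    using run_seq[OF run_pop[of k \<sigma>] run_push[of "k + 4" "bit_sym b"]] R by simp
  have 1: "run (Branch k 1 (Seq (Pop k) (Push (k + 4) 1))
     (Branch k 2 (Seq (Pop k) (Push (k + 4) 2)) (Pop (k + 3)))) \<sigma> (Suc (Suc (Suc (1 + 1)))) ?\<sigma>"
  proof (cases b)
    case True
    then have "run (Branch k 2 (Seq (Pop k) (Push (k + 4) 2)) (Pop (k + 3))) \<sigma> (Suc (Suc (1 + 1))) ?\<sigma>"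
      using s R by (intro run_branch) simp
    then show ?thesis using True R by (intro run_branch) simp
  next
    case False
    then show ?thesis using run_mono[OF s, of "Suc (Suc (1 + 1))"] R by (intro run_branch) simp
  qed
  have rdR: "rd R i = rd (\<sigma> k) (Suc i)" for i by (simp add: R rd_simps)
  have "run out_loop ?\<sigma> (6 * length y + 5)
    (?\<sigma>(k := drop (length y) (?\<sigma> k), k + 3 := [], k + 4 := map bit_sym (rev y) @ ?\<sigma> (k + 4)))"
    using Cons.prems(1) Cons.prems(2)[of "Suc i" for i] Cons.prems(3) by (intro Cons.IH) (auto simp: rdR)
  from run_loop_step[OF _ 1 this[unfolded out_loop_def]]
  have "run out_loop \<sigma> (Suc (Suc (Suc (Suc (1 + 1))) + (6 * length y + 5)))
    (?\<sigma>(k := drop (length y) (?\<sigma> k), k + 3 := [], k + 4 := map bit_sym (rev y) @ ?\<sigma> (k + 4)))"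
    unfolding out_loop_def using Cons.prems(1) by simp
  moreover have "?\<sigma>(k := drop (length y) (?\<sigma> k), k + 3 := [], k + 4 := map bit_sym (rev y) @ ?\<sigma> (k + 4))
     = \<sigma>(k := drop (length (b # y)) (\<sigma> k), k + 3 := [], k + 4 := map bit_sym (rev (b # y)) @ \<sigma> (k + 4))"
    by (auto simp: fun_eq_iff R)
  ultimately show ?case by (auto simp del: fun_upd_apply elim!: run_mono)
qed

end

text \<open>Polynomial time computability says nothing about the empty string, hence the default
  value. After the output has been collected, both halves of the tape are erased, as later
  evaluations rely on empty scratch registers.\<close>

theorem fp1_tm:
  assumes "poly_time_computable \<mu>"
  shows "fp1 (\<lambda>x. if x = [] then [] else \<mu> x)"
proof (rule fp1I)
  fix k i :: nat assume i: "i < k"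
  obtain Q K \<delta> c d where valid: "valid_tm Q K \<delta>" and
    tm: "\<And>x. x \<noteq> [] \<Longrightarrow> \<exists>t \<le> c * length x ^ d + c. fst ((tm_step \<delta> ^^ t) (tm_init x)) = 1 \<and>
              tm_output ((tm_step \<delta> ^^ t) (tm_init x)) (\<mu> x)"
    using assms unfolding poly_time_computable_def by blast
  note K3 = K3[OF valid]
  define U where "U n = (c * n ^ d + c) * (2 * K + Q + 13) + 1" for n
  let ?tm = "Loop (k + 2) 2 (tm_body Q K \<delta> k)"
  let ?P = "Seq (Push (k + 2) 1) (Seq ?tm (Seq (Pop (k + 2)) (Seq (Push (k + 3) 1) (Seq (out_loop k)
     (Seq (clear k) (Seq (clear (k + 1)) (move (k + 4) k)))))))"
  let ?c = "Seq (copy i (Suc k) k) (Branch k 0 skip ?P)"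
  let ?p = "\<lambda>n. (12 * n + 3) + U n + 20 * (n + U n) + 40"
  show "cmp k (\<lambda>\<rho>. if \<rho> i = [] then [] else \<mu> (\<rho> i))"
  proof (rule cmpI)
    show "wfc ?c" using wfc_tm_body[OF valid] by (simp add: out_loop_def[OF valid])
    have "ispoly U" unfolding U_def by (intro ispoly.intros ispoly_power)
    then show "ispoly ?p" by (intro ispoly.intros)
    fix \<rho> assume e: "fresh k \<rho>"
    let ?n = "tsize k \<rho>" let ?x = "\<rho> i"
    have n: "length ?x \<le> ?n" using i by (rule tsize_ge)
    let ?\<sigma>1 = "(st \<rho>)(k := map bit_sym ?x)"
    have 1: "run (copy i (Suc k) k) (st \<rho>) (12 * length ?x + 3) ?\<sigma>1"
      using e i by (intro run_copy) (auto simp: st_def fresh_def)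
    show "run ?c (st \<rho>) (?p ?n) (st (\<rho>(k := if ?x = [] then [] else \<mu> ?x)))"
    proof (cases "?x = []")
      case True
      have "run (Branch k 0 skip ?P) ?\<sigma>1 (Suc 3) ?\<sigma>1"
        using True by (intro run_branch) (simp add: run_skip del: fun_upd_apply, simp)
      from run_seq[OF 1 this] show ?thesis using True by (auto simp: st_upd del: fun_upd_apply elim!: run_mono)
    next
      case False
      let ?y = "\<mu> ?x"
      obtain t where t: "t \<le> c * length ?x ^ d + c" and halt: "fst ((tm_step \<delta> ^^ t) (tm_init ?x)) = 1"
        and out: "tm_output ((tm_step \<delta> ^^ t) (tm_init ?x)) ?y" using tm[OF False] by blast
      \<comment> \<open>The symbol 1 is the code of the start state 0.\<close>
      let ?\<sigma>2 = "?\<sigma>1(k + 2 := [1])"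
      have 2: "run (Push (k + 2) 1) ?\<sigma>1 1 ?\<sigma>2"
        using run_push[of "k + 2" 1 ?\<sigma>1] freshD[OF e, of "k + 2"] by (simp add: st_def)
      have bs: "bit_sym b \<noteq> K" "1 \<le> bit_sym b" "bit_sym b \<le> K" for b
        using K3 by (cases b; simp)+
      have "rep Q K k ?\<sigma>2 (tm_init ?x)"
        using K3 bs freshD[OF e, of "Suc k"]
        by (auto simp: rep_def[OF valid] tm_init_def rd_def[OF valid] st_def)
      from run_tm_loop[OF valid this halt] obtain \<sigma>3 where
        3: "run ?tm ?\<sigma>2 (t * (2 * K + Q + 13) + 1) \<sigma>3" and
        rep: "rep Q K k \<sigma>3 ((tm_step \<delta> ^^ t) (tm_init ?x))" and
        same: "\<And>j. j \<notin> {k, k + 1, k + 2} \<Longrightarrow> \<sigma>3 j = ?\<sigma>2 j" by blast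
      have U: "t * (2 * K + Q + 13) + 1 \<le> U ?n"
      proof -
        have "c * length ?x ^ d \<le> c * ?n ^ d" using n by (intro mult_le_mono2 power_mono) auto
        then have "t \<le> c * ?n ^ d + c" using t by linarith
        then show ?thesis unfolding U_def by (intro add_right_mono mult_right_mono) auto
      qed
      have len: "length (\<sigma>3 k) \<le> ?n + U ?n" "length (\<sigma>3 (k + 1)) \<le> U ?n"
        using run_length[OF 3, of k] run_length[OF 3, of "k + 1"] n U freshD[OF e, of "Suc k"]
        by (auto simp: st_def)
      obtain q tp h where conf: "(tm_step \<delta> ^^ t) (tm_init ?x) = (q, tp, h)" by (metis prod_cases3)
      have rd: "rd K (\<sigma>3 k) j = tp (h + int j)" for j using rep by (simp add: conf rep_def[OF valid])
      have y: "\<And>j. j < length ?y \<Longrightarrow> rd K (\<sigma>3 k) j = bit_sym (?y ! j)" "rd K (\<sigma>3 k) (length ?y) \<notin> {1, 2}"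
        using out by (auto simp: conf tm_output_def rd)
      have sets: "0 \<notin> set (\<sigma>3 k)" "0 \<notin> set (\<sigma>3 (k + 1))" and s2: "tl (\<sigma>3 (k + 2)) = []"
        using rep by (auto simp: conf rep_def[OF valid])
      \<comment> \<open>Output bits are not blank, so they lie inside the stack, whose length is
        bounded by the running time.\<close>
      have leny: "length ?y \<le> ?n + U ?n"
      proof (cases "length ?y")
        case (Suc l)
        then have "rd K (\<sigma>3 k) l \<noteq> 0" using y(1)[of l] by simp
        then have "l < length (\<sigma>3 k)" by (auto simp: rd_def[OF valid] split: if_splits)
        then show ?thesis using len Suc by simp
      qed simp
      have fresh3: "\<sigma>3 (k + 3) = []" "\<sigma>3 (k + 4) = []"
        using freshD[OF e] same[of "k + 3"] same[of "k + 4"] by (simp_all add: st_def)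
      let ?\<sigma>4 = "\<sigma>3(k + 2 := [])" let ?\<sigma>5 = "?\<sigma>4(k + 3 := [1])"
      have 4: "run (Pop (k + 2)) \<sigma>3 1 ?\<sigma>4" using run_pop[of "k + 2" \<sigma>3] s2 by simp
      have 5: "run (Push (k + 3) 1) ?\<sigma>4 1 ?\<sigma>5" using run_push[of "k + 3" 1 ?\<sigma>4] fresh3 by simp
      let ?\<sigma>6 = "?\<sigma>5(k := drop (length ?y) (\<sigma>3 k), k + 3 := [], k + 4 := map bit_sym (rev ?y))"
      have 6: "run (out_loop k) ?\<sigma>5 (6 * length ?y + 5) ?\<sigma>6"
        using run_out_loop[OF valid, of ?\<sigma>5 k ?y] y fresh3 by simp
      let ?\<sigma>7 = "?\<sigma>6(k := [])" let ?\<sigma>8 = "?\<sigma>7(k + 1 := [])"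
      have 7: "run (clear k) ?\<sigma>6 (2 * length (?\<sigma>6 k) + 1) ?\<sigma>7"
        using sets by (intro run_clear) (auto dest: in_set_dropD)
      have 8: "run (clear (k + 1)) ?\<sigma>7 (2 * length (?\<sigma>7 (k + 1)) + 1) ?\<sigma>8"
        using sets by (intro run_clear) auto
      have 9: "run (move (k + 4) k) ?\<sigma>8 (5 * length ?y + 1) (st (\<rho>(k := ?y)))"
      proof -
        have "?\<sigma>8(k + 4 := [], k := map bit_sym (rev (rev ?y)) @ ?\<sigma>8 k) = st (\<rho>(k := ?y))"
          using freshD[OF e] same by (auto simp: fun_eq_iff st_def)
        then show ?thesis using run_move[of "k + 4" k ?\<sigma>8 "rev ?y"] by simp
      qed
      note R = run_seq[OF 2 run_seq[OF 3 run_seq[OF 4 run_seq[OF 5 run_seq[OF 6 run_seq[OF 7 run_seq[OF 8 9]]]]]]]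
      have l7: "length (?\<sigma>6 k) \<le> ?n + U ?n" "length (?\<sigma>7 (k + 1)) \<le> ?n + U ?n" using len by auto
      have "run ?P ?\<sigma>1 (U ?n + 20 * (?n + U ?n) + 35) (st (\<rho>(k := ?y)))"
        using leny l7 U by (intro run_mono[OF R]) simp
      moreover have "peek (?\<sigma>1 k) \<noteq> 0" using False by (cases ?x) auto
      ultimately have "run (Branch k 0 skip ?P) ?\<sigma>1 (Suc (U ?n + 20 * (?n + U ?n) + 35)) (st (\<rho>(k := ?y)))"
        by (intro run_branch) (simp only: if_False)
      from run_seq[OF 1 this] show ?thesis using False n by (auto simp del: fun_upd_apply elim!: run_mono)
    qed
  qed
qed

section \<open>Instances and witnesses\<close>

declare bin.simps [simp del]

text \<open>The self-delimiting format without the binary numeral inside it. Transducers act on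
  arbitrary bit lists in this format, whether or not these are canonical numerals.\<close>

definition tok :: "bool list \<Rightarrow> bool list" where
  "tok bs = concat (map (\<lambda>b. [True, b]) bs) @ [False]"

lemma tok_simps [simp]: "tok [] = [False]" "tok (b # bs) = True # b # tok bs"
  by (simp_all add: tok_def)

lemma enc_nat_tok: "enc_nat n = tok (bin n)"
  by (simp add: enc_nat_def tok_def)

lemma length_tok [simp]: "length (tok bs) = 2 * length bs + 1"
  by (induction bs) auto

lemma tok_prefix_free: "tok bs @ u = tok bs' @ v \<Longrightarrow> bs = bs' \<and> u = v"
proof (induction bs arbitrary: bs')
  case Nil
  then show ?case by (cases bs') auto
next
  case (Cons b bs)
  then show ?case by (cases bs') auto
qed

lemma bin_0 [simp]: "bin 0 = []"
  by (simp add: bin.simps)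

lemma bin_pos: "0 < n \<Longrightarrow> bin n = odd n # bin (n div 2)"
  by (subst bin.simps) simp

lemma bin_odd: "bin (Suc (2 * n)) = True # bin n"
  by (subst bin.simps) simp

lemma bin_even: "0 < n \<Longrightarrow> bin (2 * n) = False # bin n"
  by (subst bin.simps) simp

fun val :: "bool list \<Rightarrow> nat" where
  "val [] = 0"
| "val (b # bs) = of_bool b + 2 * val bs"

lemma val_bin [simp]: "val (bin n) = n"
proof (induction n rule: less_induct)
  case (less n)
  show ?case
  proof (cases "n = 0")
    case False
    then show ?thesis using less[of "n div 2"] by (simp add: bin_pos)
  qed simp
qed

lemma enc_nat_prefix_free: "enc_nat m @ u = enc_nat n @ v \<Longrightarrow> m = n \<and> u = v"
  by (metis enc_nat_tok tok_prefix_free val_bin)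

lemma enc_form_prefix_free: "enc_form p @ u = enc_form q @ v \<Longrightarrow> p = q \<and> u = v"
proof (induction p arbitrary: q u v)
  case (Var i j)
  then show ?case by (cases q) (auto dest: enc_nat_prefix_free)
next
  case (Neg p)
  then show ?case by (cases q) (auto dest: Neg.IH)
next
  case (And p p')
  show ?case
  proof (cases q)
    case q: (And q1 q2)
    have *: "enc_form p @ (enc_form p' @ u) = enc_form q1 @ (enc_form q2 @ v)"
      using And.prems by (simp add: q)
    show ?thesis using And.IH(1)[OF *] And.IH(2)[of u q2 v] by (simp add: q)
  qed (use And.prems in simp_all)
next
  case (Or p p')
  show ?case
  proof (cases q)
    case q: (Or q1 q2)
    have *: "enc_form p @ (enc_form p' @ u) = enc_form q1 @ (enc_form q2 @ v)"
      using Or.prems by (simp add: q)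
    show ?thesis using Or.IH(1)[OF *] Or.IH(2)[of u q2 v] by (simp add: q)
  qed (use Or.prems in simp_all)
qed

definition enc_dims :: "nat list \<Rightarrow> bool list" where
  "enc_dims ms = concat (map (\<lambda>m. True # enc_nat m) ms) @ [False]"

lemma enc_dims_simps [simp]: "enc_dims [] = [False]" "enc_dims (m # ms) = True # enc_nat m @ enc_dims ms"
  by (simp_all add: enc_dims_def)

lemma enc_inst_eq: "enc_inst (ms, p) = enc_dims ms @ enc_form p"
  by (simp add: enc_inst_def enc_dims_def)

lemma enc_dims_prefix_free: "enc_dims ms @ u = enc_dims ms' @ v \<Longrightarrow> ms = ms' \<and> u = v"
proof (induction ms arbitrary: ms')
  case Nil
  then show ?case by (cases ms') auto
next
  case (Cons m ms)
  then show ?case by (cases ms') (auto dest!: enc_nat_prefix_free)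
qed

lemma enc_inst_inj: "enc_inst I = enc_inst J \<Longrightarrow> I = J"
  by (cases I; cases J) (metis append_Nil2 enc_dims_prefix_free enc_form_prefix_free enc_inst_eq)

lemma decode_enc: "wf_inst n I \<Longrightarrow> decode n (enc_inst I) = Some I"
  unfolding decode_def by (auto simp del: split_paired_Ex split_paired_All intro!: the_equality dest: enc_inst_inj)

lemma decode_SomeD:
  assumes "decode n s = Some I"
  shows "wf_inst n I" "s = enc_inst I"
proof -
  obtain J where "wf_inst n J" "enc_inst J = s"
    using assms unfolding decode_def by (auto split: if_splits)
  with decode_enc[of n J] assms show "wf_inst n I" "s = enc_inst I" by auto
qed

section \<open>Constants, negation and padding under alternating quantifiers\<close>

lemma sat_nsat_const: "sat ms (\<lambda>_. c) = c" "nsat ms (\<lambda>_. c) = c"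
proof (induction ms)
  case (Cons m ms)
  have "\<exists>x :: bool list. length x = m" by (rule exI[of _ "replicate m False"]) simp
  then show "sat (m # ms) (\<lambda>_. c) = c" "nsat (m # ms) (\<lambda>_. c) = c" using Cons by auto
qed auto

lemma sat_nsat_neg: "sat ms (\<lambda>ys. \<not> f ys) = (\<not> nsat ms f)" "nsat ms (\<lambda>ys. \<not> f ys) = (\<not> sat ms f)"
  by (induction ms arbitrary: f) auto

lemma sat_nsat_conj: "sat ms (\<lambda>ys. c \<and> f ys) = (c \<and> sat ms f)" "nsat ms (\<lambda>ys. c \<and> f ys) = (c \<and> nsat ms f)"
  by (cases c; simp add: sat_nsat_const)+

lemma sat_nsat_cong:
  "(\<And>ys. map length ys = ms \<Longrightarrow> f ys = g ys) \<Longrightarrow> sat ms f = sat ms g"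
  "(\<And>ys. map length ys = ms \<Longrightarrow> f ys = g ys) \<Longrightarrow> nsat ms f = nsat ms g"
proof (induction ms arbitrary: f g)
  case (Cons m ms)
  {
    case 1
    have "nsat ms (\<lambda>ys. f (x # ys)) = nsat ms (\<lambda>ys. g (x # ys))" if "length x = m" for x
      using that 1 by (intro Cons.IH) auto
    then show ?case by auto
  next
    case 2
    have "sat ms (\<lambda>ys. f (x # ys)) = sat ms (\<lambda>ys. g (x # ys))" if "length x = m" for x
      using that 2 by (intro Cons.IH) auto
    then show ?case by auto
  }
qed auto

text \<open>Every block of the shorter length is a prefix of one of the longer length, so
  quantifying over additional bits that are ignored changes no truth value. It may change the number
  of witnesses, so this serves only for the blocks after the first.\<close>

lemma sat_nsat_take:
  assumes "list_all2 (\<le>) ms ms'"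
  shows "sat ms' (\<lambda>ys. f (map2 take ms ys)) = sat ms f"
    "nsat ms' (\<lambda>ys. f (map2 take ms ys)) = nsat ms f"
  using assms
proof (induction ms arbitrary: ms' f)
  case (Cons m ms)
  have ex: "\<exists>x'. length x' = m' \<and> take m x' = x" if "length x = m" "m \<le> m'" for m' and x :: "bool list"
    using that by (intro exI[of _ "x @ replicate (m' - m) False"]) auto
  {
    case 1
    then obtain m' ms'' where ms': "ms' = m' # ms''" "m \<le> m'" "list_all2 (\<le>) ms ms''"
      by (auto simp: list_all2_Cons1)
    have IH: "nsat ms'' (\<lambda>ys. f (take m x # map2 take ms ys)) = nsat ms (\<lambda>ys. f (take m x # ys))" for x
      using Cons.IH(2)[OF ms'(3), of "\<lambda>ys. f (take m x # ys)"] .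
    show ?case unfolding ms' using ex[OF _ ms'(2)] ms'(2) by (auto simp: IH) (metis length_take min.absorb2)+
  next
    case 2
    then obtain m' ms'' where ms': "ms' = m' # ms''" "m \<le> m'" "list_all2 (\<le>) ms ms''"
      by (auto simp: list_all2_Cons1)
    have IH: "sat ms'' (\<lambda>ys. f (take m x # map2 take ms ys)) = sat ms (\<lambda>ys. f (take m x # ys))" for x
      using Cons.IH(1)[OF ms'(3), of "\<lambda>ys. f (take m x # ys)"] .
    show ?case unfolding ms' using ex[OF _ ms'(2)] ms'(2) by (auto simp: IH) metis
  }
qed auto

section \<open>Occurring variables and witness sets\<close>

fun vset :: "bform \<Rightarrow> (nat \<times> nat) set" where
  "vset (Var i j) = {(i, j)}"
| "vset (Neg p) = vset p"
| "vset (And p q) = vset p \<union> vset q"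
| "vset (Or p q) = vset p \<union> vset q"

lemma vars_ok_iff: "vars_ok ms p \<longleftrightarrow> (\<forall>(i, j)\<in>vset p. i < length ms \<and> j < ms ! i)"
  by (induction p) auto

lemma eval_cong: "(\<And>i j. (i, j) \<in> vset p \<Longrightarrow> ys ! i ! j = zs ! i ! j) \<Longrightarrow> eval p ys = eval p zs"
  by (induction p) auto

lemma finite_vset: "finite (vset p)"
  by (induction p) auto

lemma card_vset: "card (vset p) \<le> length (enc_form p)"
proof (induction p)
  case (And p q)
  then show ?case using card_Un_le[of "vset p" "vset q"] by simp
next
  case (Or p q)
  then show ?case using card_Un_le[of "vset p" "vset q"] by simp
qed auto

lemma finite_bool_lists: "finite {x :: bool list. length x = m}"
  using finite_lists_length_eq[of "UNIV :: bool set" m] by simp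

lemma finite_wit_set: "finite (wit_set ms f)" "finite (cowit_set ms f)"
  by (auto simp: wit_set_def cowit_set_def intro: finite_subset[OF _ finite_bool_lists[of "hd ms"]])

lemma cowit_set_neg: "cowit_set ms f = wit_set ms (\<lambda>ys. \<not> f ys)"
  by (simp add: cowit_set_def wit_set_def sat_nsat_neg)

lemma sat_iff_wit_set: "ms \<noteq> [] \<Longrightarrow> sat ms f \<longleftrightarrow> wit_set ms f \<noteq> {}"
  by (cases ms) (auto simp: wit_set_def)

lemma nsat_iff_cowit_set: "ms \<noteq> [] \<Longrightarrow> nsat ms f \<longleftrightarrow> cowit_set ms f = {}"
  by (cases ms) (auto simp: cowit_set_def)

text \<open>Flipping a bit that does not occur in the formula turns a witness into another one.\<close>

lemma unique_witness_dim:
  assumes "card (wit_set ms (eval p)) = 1"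
  shows "hd ms \<le> card (vset p)"
proof -
  obtain x where x: "wit_set ms (eval p) = {x}" using assms by (auto simp: card_1_singleton_iff)
  have "Pair 0 ` {..<hd ms} \<subseteq> vset p"
  proof (rule ccontr)
    assume "\<not> ?thesis"
    then obtain j where j: "j < hd ms" "(0, j) \<notin> vset p" by auto
    let ?x = "x[j := \<not> x ! j]"
    have len: "length x = hd ms" and "nsat (tl ms) (\<lambda>ys. eval p (x # ys))"
      using x by (auto simp: wit_set_def)
    moreover have "eval p (x # ys) = eval p (?x # ys)" for ys
    proof (rule eval_cong)
      fix i k assume "(i, k) \<in> vset p"
      then show "(x # ys) ! i ! k = (?x # ys) ! i ! k" using j by (cases i; cases "k = j") auto
    qed
    ultimately have "?x \<in> wit_set ms (eval p)" by (simp add: wit_set_def)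
    then have "?x = x" using x by simp
    then have "?x ! j = x ! j" by simp
    then show False using j len by simp
  qed
  from card_mono[OF finite_vset this] show ?thesis by (simp add: card_image inj_on_def)
qed

text \<open>The new conjunct reads only the first block; it is constant for the remaining
  quantifiers and merely intersects the witness set. Without a unique witness the value of
  \<open>UVAL\<close> is \<open>UNIV\<close>.\<close>

lemma USAT_And_first:
  assumes wf: "wf_inst n (ms, p)" and n: "n \<ge> 1"
  shows "USAT n (enc_inst (ms, And (Var 0 0) p)) \<subseteq> UVAL n (enc_inst (ms, p))"
proof (cases "card (wit_set ms (eval p)) = 1")
  case True
  then obtain x where x: "wit_set ms (eval p) = {x}" by (auto simp: card_1_singleton_iff)
  have ms: "ms \<noteq> []" "1 \<le> hd ms" using wf n by (cases ms; auto simp: wf_inst_def)+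
  have wf': "wf_inst n (ms, And (Var 0 0) p)" using wf ms by (cases ms) (auto simp: wf_inst_def)
  have "x \<in> wit_set ms (eval p)" using x by simp
  then have "x \<noteq> []" using ms by (auto simp: wit_set_def)
  then have hd: "hd x = x ! 0" by (simp add: hd_conv_nth)
  have "wit_set ms (eval (And (Var 0 0) p)) = {y. y ! 0} \<inter> wit_set ms (eval p)"
    by (auto simp: wit_set_def sat_nsat_conj)
  then have w: "wit_set ms (eval (And (Var 0 0) p)) = (if x ! 0 then {x} else {})" using x by auto
  show ?thesis using ms True by (simp add: USAT_def UVAL_def decode_enc wf wf' w x hd sat_iff_wit_set)
qed (simp add: UVAL_def decode_enc wf)

text \<open>Co-witnesses of a negation are witnesses of the negated formula, so again a set of
  witnesses is intersected. The unique witness survives as a co-witness exactly if its first bit is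
  0, and then \<open>nsat\<close> is false.\<close>

lemma coUSAT_Neg_And_first:
  assumes wf: "wf_inst n (ms, p)" and n: "n \<ge> 1"
  shows "coUSAT n (enc_inst (ms, Neg (And (Neg (Var 0 0)) p))) \<subseteq> UVAL n (enc_inst (ms, p))"
proof (cases "card (wit_set ms (eval p)) = 1")
  case True
  then obtain x where x: "wit_set ms (eval p) = {x}" by (auto simp: card_1_singleton_iff)
  have ms: "ms \<noteq> []" "1 \<le> hd ms" using wf n by (cases ms; auto simp: wf_inst_def)+
  let ?q = "Neg (And (Neg (Var 0 0)) p)"
  have wf': "wf_inst n (ms, ?q)" using wf ms by (cases ms) (auto simp: wf_inst_def)
  have "x \<in> wit_set ms (eval p)" using x by simp
  then have "x \<noteq> []" using ms by (auto simp: wit_set_def)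
  then have hd: "hd x = x ! 0" by (simp add: hd_conv_nth)
  have "cowit_set ms (eval ?q) = {y. \<not> y ! 0} \<inter> wit_set ms (eval p)"
    by (auto simp: cowit_set_neg wit_set_def sat_nsat_conj)
  then have w: "cowit_set ms (eval ?q) = (if x ! 0 then {} else {x})" using x by auto
  show ?thesis using ms True by (simp add: coUSAT_def UVAL_def decode_enc wf wf' w x hd nsat_iff_cowit_set)
qed (simp add: UVAL_def decode_enc wf)

section \<open>Combining two instances\<close>

text \<open>Odd positions leave position 0 free for the tag bit, and on binary codes this renaming
  involves no carries.\<close>

fun ren :: "bform \<Rightarrow> bform" where
  "ren (Var i j) = Var i (if i = 0 then Suc (2 * j) else j)"
| "ren (Neg p) = Neg (ren p)"
| "ren (And p q) = And (ren p) (ren q)"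
| "ren (Or p q) = Or (ren p) (ren q)"

lemma eval_ren:
  "(\<And>j. (0, j) \<in> vset p \<Longrightarrow> z ! Suc (2 * j) = x ! j) \<Longrightarrow>
   (\<And>i j. (Suc i, j) \<in> vset p \<Longrightarrow> ys ! i ! j = zs ! i ! j) \<Longrightarrow>
   eval (ren p) (z # ys) = eval p (x # zs)"
proof (induction p)
  case (Var i j)
  then show ?case by (cases i) auto
qed auto

lemma vset_ren: "vset (ren p) = (\<lambda>(i, j). (i, if i = 0 then Suc (2 * j) else j)) ` vset p"
  by (induction p) auto

text \<open>Used with \<open>c = 0\<close> for the even and with \<open>c = 1\<close> for the odd
  positions of the first block.\<close>

fun force :: "nat \<Rightarrow> nat list \<Rightarrow> bform \<Rightarrow> bform" where
  "force c [] p = p"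
| "force c (i # is) p = And (Neg (Var 0 (c + 2 * i))) (force c is p)"

lemma eval_force: "eval (force c is p) (z # ys) \<longleftrightarrow> (\<forall>i\<in>set is. \<not> z ! (c + 2 * i)) \<and> eval p (z # ys)"
  by (induction "is") auto

lemma vars_ok_force:
  "vars_ok (m # ms) (force c is p) \<longleftrightarrow> (\<forall>i\<in>set is. c + 2 * i < m) \<and> vars_ok (m # ms) p"
  by (induction "is") auto

definition contradiction :: bform where
  "contradiction = And (Var 0 0) (Neg (Var 0 0))"

text \<open>If \<open>m \<ge> X\<close>, then the formula cannot have a unique witness.\<close>

definition guard :: "nat \<Rightarrow> nat \<Rightarrow> bform \<Rightarrow> bform" where
  "guard X m p = (if m < X then force 1 (rev [m..<Suc X]) p else contradiction)"

text \<open>A witness of the combined formula consists of a tag bit at position 0, which tells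
  whether it stems from \<open>p\<close> or from \<open>q\<close>, and of the bits of a witness at the odd positions; all other
  bits are forced to be 0.\<close>

definition combine :: "nat \<Rightarrow> nat \<Rightarrow> nat \<Rightarrow> inst \<Rightarrow> inst \<Rightarrow> inst" where
  "combine n X Y = (\<lambda>(ms, p) (ms', q). (2 * Suc X # replicate (n - 1) Y, force 0 (rev [1..<Suc X])
     (Or (And (Var 0 0) (guard X (hd ms) (ren p)))
         (And (Neg (Var 0 0)) (guard X (hd ms') (Neg (ren q)))))))"

definition spread :: "nat \<Rightarrow> bool \<Rightarrow> bool list \<Rightarrow> bool list" where
  "spread X b x = map (\<lambda>i. if i = 0 then b else odd i \<and> i div 2 < length x \<and> x ! (i div 2)) [0..<2 * Suc X]"

definition gather :: "nat \<Rightarrow> bool list \<Rightarrow> bool list" where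
  "gather m z = map (\<lambda>j. z ! Suc (2 * j)) [0..<m]"

lemma length_spread [simp]: "length (spread X b x) = 2 * Suc X"
  by (simp add: spread_def)

lemma spread_nth:
  "spread X b x ! 0 = b"
  "0 < i \<Longrightarrow> i \<le> X \<Longrightarrow> \<not> spread X b x ! (2 * i)"
  "i \<le> X \<Longrightarrow> spread X b x ! Suc (2 * i) \<longleftrightarrow> i < length x \<and> x ! i"
  by (simp_all add: spread_def del: upt_Suc)

lemma length_gather [simp]: "length (gather m z) = m"
  by (simp add: gather_def)

lemma gather_spread: "length x = m \<Longrightarrow> m \<le> X \<Longrightarrow> gather m (spread X b x) = x"
  by (auto simp: gather_def spread_nth intro!: nth_equalityI)

text \<open>As all padding bits are forced to 0, a long witness is determined by its tag and the
  gathered bits; this is what preserves the number of witnesses.\<close>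

lemma spread_gather:
  assumes "length z = 2 * Suc X" "\<And>i. 1 \<le> i \<Longrightarrow> i \<le> X \<Longrightarrow> \<not> z ! (2 * i)"
    "\<And>i. m \<le> i \<Longrightarrow> i \<le> X \<Longrightarrow> \<not> z ! Suc (2 * i)"
  shows "z = spread X (z ! 0) (gather m z)"
proof (rule nth_equalityI)
  fix i assume i: "i < length z"
  show "z ! i = spread X (z ! 0) (gather m z) ! i"
  proof (cases "even i")
    case True
    then obtain k where k: "i = 2 * k" by blast
    then show ?thesis using assms(1,2) i by (cases "k = 0") (auto simp: spread_nth)
  next
    case False
    then obtain k where k: "i = Suc (2 * k)" by (auto elim: oddE)
    then show ?thesis using assms(1,3) i by (cases "k < m") (auto simp: spread_nth gather_def)
  qed
qed (use assms in simp)

context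
  fixes n X Y :: nat and ms ms' :: "nat list" and p q :: bform
  assumes n: "n \<ge> 1" and X: "X \<ge> 1" and Y: "Y \<ge> 1"
    and wfp: "wf_inst n (ms, p)" and wfq: "wf_inst n (ms', q)"
    and Yp: "\<And>m. m \<in> set ms \<Longrightarrow> m \<le> Y" and Yq: "\<And>m. m \<in> set ms' \<Longrightarrow> m \<le> Y"
begin

lemma wf_vars_ren:
  assumes "wf_inst n (ls, r)" "\<And>m. m \<in> set ls \<Longrightarrow> m \<le> Y" "hd ls < X"
  shows "vars_ok (2 * Suc X # replicate (n - 1) Y) (ren r)"
proof -
  obtain l ls' where ls: "ls = l # ls'" using assms(1) n by (cases ls) (auto simp: wf_inst_def)
  show ?thesis unfolding vars_ok_iff vset_ren
  proof safe
    fix i j assume "(i, j) \<in> vset r"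
    then have ij: "i < n" "j < ls ! i" "length ls = n" using assms(1) by (auto simp: wf_inst_def vars_ok_iff)
    then have "ls ! i \<le> Y" using assms(2) by simp
    then show "i < length (2 * Suc X # replicate (n - 1) Y)"
      "(if i = 0 then Suc (2 * j) else j) < (2 * Suc X # replicate (n - 1) Y) ! i"
      using ij assms(3) by (cases i; simp add: ls)+
  qed
qed

lemma wf_combine: "wf_inst n (combine n X Y (ms, p) (ms', q))"
proof -
  have "vars_ok (2 * Suc X # replicate (n - 1) Y) (guard X (hd ms) (ren p))"
    "vars_ok (2 * Suc X # replicate (n - 1) Y) (guard X (hd ms') (Neg (ren q)))"
    using wf_vars_ren[OF wfp Yp] wf_vars_ren[OF wfq Yq]
    by (auto simp: guard_def vars_ok_force contradiction_def)
  then show ?thesis using n Y by (auto simp: combine_def wf_inst_def vars_ok_force)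
qed

text \<open>In the later blocks a formula keeps its variables and ignores the bits beyond its own
  dimensions, so that one length \<open>Y\<close> serves both formulas.\<close>

lemma nsat_ren:
  assumes "wf_inst n (ls, r)" "\<And>m. m \<in> set ls \<Longrightarrow> m \<le> Y"
  shows "sat (replicate (n - 1) Y) (\<lambda>ys. eval (ren r) (z # ys)) = sat (tl ls) (\<lambda>ys. eval r (gather (hd ls) z # ys))"
    "nsat (replicate (n - 1) Y) (\<lambda>ys. eval (ren r) (z # ys)) = nsat (tl ls) (\<lambda>ys. eval r (gather (hd ls) z # ys))"
proof -
  obtain l ls' where ls: "ls = l # ls'" "length ls' = n - 1"
    using assms(1) n by (cases ls) (auto simp: wf_inst_def)
  have le: "list_all2 (\<le>) (tl ls) (replicate (n - 1) Y)"
    using assms(2) ls by (auto simp: list_all2_conv_all_nth)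
  have eq: "eval (ren r) (z # ys) = eval r (gather (hd ls) z # map2 take (tl ls) ys)"
    if "map length ys = replicate (n - 1) Y" for ys
  proof (rule eval_ren)
    fix i j
    have len: "length ys = n - 1" using arg_cong[OF that, of length] by simp
    have ok: "(i, j) \<in> vset r \<Longrightarrow> i < n \<and> j < ls ! i" for i j
      using assms(1) by (auto simp: wf_inst_def vars_ok_iff)
    show "z ! Suc (2 * j) = gather (hd ls) z ! j" if "(0, j) \<in> vset r"
      using ok[OF that] by (simp add: gather_def ls)
    show "ys ! i ! j = map2 take (tl ls) ys ! i ! j" if "(Suc i, j) \<in> vset r"
    proof -
      have "i < length ls'" "j < ls' ! i" using ok[OF that] ls by auto
      then show ?thesis using len ls by simp
    qed
  qed
  show "sat (replicate (n - 1) Y) (\<lambda>ys. eval (ren r) (z # ys)) = sat (tl ls) (\<lambda>ys. eval r (gather (hd ls) z # ys))"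
    using sat_nsat_cong(1)[OF eq] sat_nsat_take(1)[OF le, of "\<lambda>ys. eval r (gather (hd ls) z # ys)"]
    by (simp only:)
  show "nsat (replicate (n - 1) Y) (\<lambda>ys. eval (ren r) (z # ys)) = nsat (tl ls) (\<lambda>ys. eval r (gather (hd ls) z # ys))"
    using sat_nsat_cong(2)[OF eq] sat_nsat_take(2)[OF le, of "\<lambda>ys. eval r (gather (hd ls) z # ys)"]
    by (simp only:)
qed

text \<open>Once the first block \<open>z\<close> is fixed, the tag and the side conditions
  \<open>E\<close> and \<open>F\<close> are constants and leave the quantifiers by
  \<open>sat_nsat_conj\<close>. What remains is one renamed formula or the negation of the other,
  and the negation turns witnesses into co-witnesses.\<close>

lemma wit_set_combine:
  assumes "combine n X Y (ms, p) (ms', q) = (ls, r)"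
  shows "wit_set ls (eval r) =
    spread X True ` (if hd ms < X then wit_set ms (eval p) else {}) \<union>
    spread X False ` (if hd ms' < X then cowit_set ms' (eval q) else {})" (is "_ = ?A \<union> ?B")
proof -
  have hd: "hd ls = 2 * Suc X" "tl ls = replicate (n - 1) Y"
    and r: "r = force 0 (rev [1..<Suc X]) (Or (And (Var 0 0) (guard X (hd ms) (ren p)))
         (And (Neg (Var 0 0)) (guard X (hd ms') (Neg (ren q)))))"
    using assms by (auto simp: combine_def)
  define E where "E z \<longleftrightarrow> (\<forall>i\<in>{1..X}. \<not> z ! (2 * i))" for z :: "bool list"
  define F where "F m z \<longleftrightarrow> m < X \<and> (\<forall>i\<in>{m..X}. \<not> z ! Suc (2 * i))" for m and z :: "bool list"
  have g: "eval (guard X m s) (z # ys) \<longleftrightarrow> F m z \<and> eval s (z # ys)" for m s z ys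
    by (auto simp: guard_def eval_force F_def contradiction_def atLeastLessThanSuc_atLeastAtMost simp del: upt_Suc)
  have ev: "eval r (z # ys) \<longleftrightarrow> (E z \<and> (if z ! 0 then F (hd ms) z else F (hd ms') z)) \<and>
      (if z ! 0 then eval (ren p) (z # ys) else \<not> eval (ren q) (z # ys))" for z ys
    by (auto simp: r eval_force g E_def atLeastLessThanSuc_atLeastAtMost simp del: upt_Suc)
  have wit: "z \<in> wit_set ls (eval r) \<longleftrightarrow> length z = 2 * Suc X \<and> E z \<and>
     (if z ! 0 then F (hd ms) z \<and> gather (hd ms) z \<in> wit_set ms (eval p)
      else F (hd ms') z \<and> gather (hd ms') z \<in> cowit_set ms' (eval q))" for z
    by (cases "z ! 0")
      (simp_all add: wit_set_def cowit_set_def hd ev sat_nsat_conj nsat_ren[OF wfp Yp]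
        sat_nsat_neg nsat_ren[OF wfq Yq] conj_ac del: One_nat_def)
  have sp: "E (spread X b x)" "length x < X \<Longrightarrow> F (length x) (spread X b x)" for b x
    by (auto simp: E_def F_def spread_nth)
  show ?thesis
  proof (intro equalityI subsetI)
    fix z assume "z \<in> wit_set ls (eval r)"
    then have z: "length z = 2 * Suc X" "E z" and
      z': "if z ! 0 then F (hd ms) z \<and> gather (hd ms) z \<in> wit_set ms (eval p)
      else F (hd ms') z \<and> gather (hd ms') z \<in> cowit_set ms' (eval q)" unfolding wit by blast+
    show "z \<in> ?A \<union> ?B"
    proof (cases "z ! 0")
      case True
      then have "z = spread X True (gather (hd ms) z)"
        using z z' spread_gather[of z X "hd ms"] by (auto simp: E_def F_def)
      then show ?thesis using True z' by (auto simp: F_def)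
    next
      case False
      then have "z = spread X False (gather (hd ms') z)"
        using z z' spread_gather[of z X "hd ms'"] by (auto simp: E_def F_def)
      then show ?thesis using False z' by (auto simp: F_def)
    qed
  next
    fix z assume "z \<in> ?A \<union> ?B"
    then consider x where "hd ms < X" "x \<in> wit_set ms (eval p)" "z = spread X True x"
      | x where "hd ms' < X" "x \<in> cowit_set ms' (eval q)" "z = spread X False x"
      by (auto split: if_splits)
    then show "z \<in> wit_set ls (eval r)"
    proof cases
      case 1
      then have "length x = hd ms" by (simp add: wit_set_def)
      then show ?thesis using 1 sp(1)[of True x] sp(2)[of x True] gather_spread[of x "hd ms" X True]
        by (simp add: wit spread_nth)
    next
      case 2
      then have "length x = hd ms'" by (simp add: cowit_set_def)
      then show ?thesis using 2 sp(1)[of False x] sp(2)[of x False] gather_spread[of x "hd ms'" X False]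
        by (simp add: wit spread_nth)
    qed
  qed
qed

text \<open>Only the side that has a witness must pass its guard, and for that side uniqueness
  bounds the dimension by the number of variables. The other side contributes nothing, whichever way
  its guard decides.\<close>

lemma UVAL_combine:
  assumes "card (vset p) < X" "card (vset q) < X"
    and "card (wit_set ms (eval p)) \<le> 1" "card (cowit_set ms' (eval q)) \<le> 1"
    and "sat ms (eval p) = b" "nsat ms' (eval q) = b"
  shows "UVAL n (enc_inst (combine n X Y (ms, p) (ms', q))) = {b}"
proof -
  obtain ls r where c: "combine n X Y (ms, p) (ms', q) = (ls, r)" by fastforce
  have ms: "ms \<noteq> []" "ms' \<noteq> []" using wfp wfq n by (auto simp: wf_inst_def)
  have "\<exists>x. wit_set ls (eval r) = {spread X b x}"
  proof (cases b)
    case True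
    then have "wit_set ms (eval p) \<noteq> {}" and B: "cowit_set ms' (eval q) = {}"
      using assms(5,6) ms by (simp_all add: sat_iff_wit_set nsat_iff_cowit_set)
    then have 1: "card (wit_set ms (eval p)) = 1"
      using assms(3) finite_wit_set(1)[of ms "eval p"] by (simp add: le_Suc_eq)
    then have "hd ms < X" using unique_witness_dim[OF 1] assms(1) by simp
    moreover obtain x where "wit_set ms (eval p) = {x}" using 1 by (auto simp: card_1_singleton_iff)
    ultimately show ?thesis using B True by (auto simp: wit_set_combine[OF c])
  next
    case False
    then have A: "wit_set ms (eval p) = {}" and "cowit_set ms' (eval q) \<noteq> {}"
      using assms(5,6) ms by (simp_all add: sat_iff_wit_set nsat_iff_cowit_set)
    then have 1: "card (cowit_set ms' (eval q)) = 1"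
      using assms(4) finite_wit_set(2)[of ms' "eval q"] by (simp add: le_Suc_eq)
    \<comment> \<open>The dimension bound is applied to \<open>Neg q\<close>, which has the same
      variables as \<open>q\<close>.\<close>
    have "cowit_set ms' (eval q) = wit_set ms' (eval (Neg q))" by (simp add: cowit_set_neg wit_set_def)
    then have "hd ms' < X" using unique_witness_dim[of ms' "Neg q"] 1 assms(2) by simp
    moreover obtain x where "cowit_set ms' (eval q) = {x}" using 1 by (auto simp: card_1_singleton_iff)
    ultimately show ?thesis using A False by (auto simp: wit_set_combine[OF c])
  qed
  then obtain x where x: "wit_set ls (eval r) = {spread X b x}" by blast
  have "hd (spread X b x) = spread X b x ! 0" by (intro hd_conv_nth) (auto simp: spread_def)
  then show ?thesis using wf_combine by (simp add: c UVAL_def decode_enc x spread_nth)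
qed

end

section \<open>The reductions in polynomial time\<close>

lemma fp1_exprI: "(\<And>m f. expr m f \<Longrightarrow> expr m (\<lambda>\<rho>. F (f \<rho>))) \<Longrightarrow> fp1 F"
  by (simp add: fp1_def)

lemma fp2_exprI: "(\<And>m f g. expr m f \<Longrightarrow> expr m g \<Longrightarrow> expr m (\<lambda>\<rho>. F (f \<rho>) (g \<rho>))) \<Longrightarrow> fp2 F"
  by (simp add: fp2_def)

lemma fp1_cons: "fp1 ((#) b)"
proof -
  let ?\<delta> = "\<lambda>q a. (1 :: nat, if q = (0 :: nat) then [b, a] else [a])"
  let ?e = "\<lambda>q. if q = (0 :: nat) then [b] else []"
  have "transduce ?\<delta> ?e 1 x = x" for x by (induction x) auto
  then have "transduce ?\<delta> ?e 0 x = b # x" for x by (cases x) auto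
  moreover have "fp1 (transduce ?\<delta> ?e 0)" by (rule fp1_transduce[of 2]) auto
  ultimately show ?thesis by (simp add: fp1_def)
qed

lemma fp1_tl: "fp1 tl"
proof -
  let ?\<delta> = "\<lambda>q a. (1 :: nat, if q = (0 :: nat) then [] else [a])"
  let ?e = "\<lambda>q :: nat. [] :: bool list"
  have "transduce ?\<delta> ?e 1 x = x" for x by (induction x) auto
  then have "transduce ?\<delta> ?e 0 x = tl x" for x by (cases x) auto
  moreover have "fp1 (transduce ?\<delta> ?e 0)" by (rule fp1_transduce[of 2]) auto
  ultimately show ?thesis by (simp add: fp1_def)
qed

lemmas expr_cons = fp1D[OF fp1_cons] and expr_tl = fp1D[OF fp1_tl]
  and expr_if = fp3D[OF fp3_if]

lemma expr_rev_append: "expr m f \<Longrightarrow> expr m g \<Longrightarrow> expr m (\<lambda>\<rho>. rev (f \<rho>) @ g \<rho>)"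
proof -
  have eq: "fold (\<lambda>b a. b # a) xs a = rev xs @ a" for xs a :: "bool list"
    by (induction xs arbitrary: a) auto
  have "fp3 (\<lambda>xs a y. fold (\<lambda>b a. (\<lambda>b a y. b # a) b a y) xs a)"
    by (rule fp3_fold[OF _ ispoly.id]) (auto simp: eq intro: fp2_exprI expr_cons)
  from fp3D[OF this _ _ expr_const[of _ "[]"]] show "expr m f \<Longrightarrow> expr m g \<Longrightarrow> ?thesis"
    by (simp add: eq)
qed

lemma expr_rev: "expr m f \<Longrightarrow> expr m (\<lambda>\<rho>. rev (f \<rho>))"
  using expr_rev_append[OF _ expr_const[of m "[]"]] by simp

lemma expr_append: "expr m f \<Longrightarrow> expr m g \<Longrightarrow> expr m (\<lambda>\<rho>. f \<rho> @ g \<rho>)"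
  using expr_rev_append[OF expr_rev] by simp

text \<open>With lists standing for their lengths this is truncated subtraction of unary numbers,
  and testing the result for emptiness is a comparison.\<close>

lemma expr_drop: "expr m f \<Longrightarrow> expr m g \<Longrightarrow> expr m (\<lambda>\<rho>. drop (length (f \<rho>)) (g \<rho>))"
proof -
  have eq: "fold (\<lambda>b a. tl a) xs a = drop (length xs) a" for xs a :: "bool list"
    by (induction xs arbitrary: a) (auto simp: drop_Suc)
  have "fp3 (\<lambda>xs a y. fold (\<lambda>b a. (\<lambda>b a y. tl a) b a y) xs a)"
    by (rule fp3_fold[OF _ ispoly.id]) (auto simp: eq intro: fp2_exprI expr_tl)
  from fp3D[OF this _ _ expr_const[of _ "[]"]] show "expr m f \<Longrightarrow> expr m g \<Longrightarrow> ?thesis"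
    by (simp add: eq)
qed

text \<open>Register 0 receives the reversed input and has to end with the reversed output, so the
  program run is one for \<open>F\<close> conjugated by \<open>rev\<close>.\<close>

theorem fp1_poly_time:
  assumes "fp1 F"
  shows "poly_time_computable F"
proof -
  have "expr 1 (\<lambda>\<rho>. rev (F (rev (\<rho> 0))))"
    by (intro expr_rev fp1D[OF assms] expr_var) simp
  then have "cmp 1 (\<lambda>\<rho>. rev (F (rev (\<rho> 0))))" by (rule expr_cmp) simp
  then obtain c p where ev: "evaluates c p 1 (\<lambda>\<rho>. rev (F (rev (\<rho> 0))))" by (auto simp: cmp_def)
  note c = evaluatesD(1,2)[OF ev]
  show ?thesis
  proof (rule com_poly_time)
    show "wfc (Seq c (Seq (clear 0) (transfer 1 2 0)))" using c by simp
    show "ispoly (\<lambda>n. p n + (2 * n + 1) + (10 * p n + 3) + 2)" by (intro ispoly.intros c)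
    fix x :: "bool list"
    let ?\<rho> = "(\<lambda>_. [])(0 := rev x) :: nat \<Rightarrow> bool list"
    have fr: "fresh 1 ?\<rho>" by (simp add: fresh_def)
    have sz: "tsize 1 ?\<rho> = length x" by (simp add: tsize_def)
    let ?\<rho>' = "?\<rho>(1 := rev (F x))"
    have 1: "run c (st ?\<rho>) (p (length x)) (st ?\<rho>')"
      using evaluatesD(3)[OF ev fr] sz by simp
    have len: "length (F x) \<le> p (length x)"
      using evaluatesD(4)[OF ev fr] sz by simp
    have 2: "run (clear 0) (st ?\<rho>') (2 * length (st ?\<rho>' 0) + 1) ((st ?\<rho>')(0 := []))"
      by (rule run_clear) (auto simp: st_def)
    have 3: "run (transfer 1 2 0) ((st ?\<rho>')(0 := [])) (10 * length (rev (F x)) + 3)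
       ((st ?\<rho>')(0 := [], 1 := [], 0 := map bit_sym (rev (F x))))"
      by (rule run_transfer) (auto simp: st_def)
    have "run (Seq c (Seq (clear 0) (transfer 1 2 0))) (st ?\<rho>)
       (p (length x) + (2 * length x + 1) + (10 * p (length x) + 3) + 2)
       ((st ?\<rho>')(0 := [], 1 := [], 0 := map bit_sym (rev (F x))))"
      using len by (intro run_mono[OF run_seq[OF 1 run_seq[OF 2 3]]]) (simp add: st_def)
    moreover have "st ?\<rho> = (\<lambda>_. [])(0 := rev (map bit_sym x))"
      by (auto simp: st_def rev_map)
    ultimately obtain n where "n \<le> p (length x) + (2 * length x + 1) + (10 * p (length x) + 3) + 2"
      "exec (Seq c (Seq (clear 0) (transfer 1 2 0))) ((\<lambda>_. [])(0 := rev (map bit_sym x))) n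
         ((st ?\<rho>')(0 := [], 1 := [], 0 := map bit_sym (rev (F x))))"
      unfolding run_def by metis
    moreover have "((st ?\<rho>')(0 := [], 1 := [], 0 := map bit_sym (rev (F x)))) 0 = rev (map bit_sym (F x))"
      by (simp add: rev_map)
    ultimately show "\<exists>n\<le>p (length x) + (2 * length x + 1) + (10 * p (length x) + 3) + 2. \<exists>\<sigma>'.
        exec (Seq c (Seq (clear 0) (transfer 1 2 0))) ((\<lambda>_. [])(0 := rev (map bit_sym x))) n \<sigma>' \<and>
        \<sigma>' 0 = rev (map bit_sym (F x))"
      by blast
  qed
qed

section \<open>Transducers on codes of instances\<close>

definition ins_step :: "bool list \<Rightarrow> nat \<Rightarrow> bool \<Rightarrow> nat \<times> bool list" where
  "ins_step w q b = (if q = 0 then if b then (1, [b]) else (3, b # w)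
     else if q = 1 then if b then (2, [b]) else (0, [b])
     else if q = 2 then (1, [b]) else (3, [b]))"

lemma ins_step_simps [simp]:
  "ins_step w 0 b = (if b then (1, [b]) else (3, b # w))"
  "ins_step w (Suc 0) b = (if b then 2 else 0, [b])"
  "ins_step w 2 b = (1, [b])"
  "ins_step w 3 b = (3, [b])"
  by (simp_all add: ins_step_def)

text \<open>State 0 reads the bit that announces another dimension or the end of the dimensions,
  states 1 and 2 copy the bit pairs of a dimension, and state 3 copies the formula.\<close>

definition insert_after_dims :: "bool list \<Rightarrow> bool list \<Rightarrow> bool list" where
  "insert_after_dims w = transduce (ins_step w) (\<lambda>_. []) 0"

lemma fp1_insert_after_dims: "fp1 (insert_after_dims w)"
  unfolding insert_after_dims_def by (rule fp1_transduce[of 4]) (auto simp: ins_step_def)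

lemma insert_after_dims_nonempty: "x \<noteq> [] \<Longrightarrow> insert_after_dims w x \<noteq> []"
  by (cases x) (auto simp: insert_after_dims_def)

lemma insert_after_dims: "insert_after_dims w (enc_dims ms @ r) = enc_dims ms @ w @ r"
proof -
  have 3: "transduce (ins_step w) (\<lambda>_. []) 3 r = r" for r by (induction r) auto
  have 1: "transduce (ins_step w) (\<lambda>_. []) (Suc 0) (tok bs @ r) = tok bs @ transduce (ins_step w) (\<lambda>_. []) 0 r" for bs r
    by (induction bs) auto
  show ?thesis unfolding insert_after_dims_def
    by (induction ms) (auto simp: 3 1 enc_nat_tok)
qed

text \<open>States 0 to 2 skip the dimensions, 3 to 5 read the two bits of a constructor, 6 to 8 the block
  index of a variable and 9 to 10 its index within the block. In block 0, prefixing the bit 1 turns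
  the code of \<open>j\<close> into the code of \<open>2 j + 1\<close>.\<close>

definition ren_step :: "nat \<Rightarrow> bool \<Rightarrow> nat \<times> bool list" where
  "ren_step q b = (if q = 0 then (if b then 1 else 3, [])
     else if q = 1 then (if b then 2 else 0, [])
     else if q = 2 then (1, [])
     else if q = 3 then (if b then 5 else 4, [])
     else if q = 4 then (if b then 3 else 6, [False, b])
     else if q = 5 then (3, [True, b])
     else if q = 6 then if b then (7, [b]) else (9, [b, True, True])
     else if q = 7 then (8, [b])
     else if q = 8 then (if b then 7 else 9, [b])
     else if q = 9 then (if b then 10 else 3, [b])
     else (9, [b]))"

lemma ren_step_simps [simp]:
  "ren_step 0 b = (if b then 1 else 3, [])"
  "ren_step (Suc 0) b = (if b then 2 else 0, [])"
  "ren_step 2 b = (1, [])"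
  "ren_step 3 b = (if b then 5 else 4, [])"
  "ren_step 4 b = (if b then 3 else 6, [False, b])"
  "ren_step 5 b = (3, [True, b])"
  "ren_step 6 b = (if b then (7, [b]) else (9, [b, True, True]))"
  "ren_step 7 b = (8, [b])"
  "ren_step 8 b = (if b then 7 else 9, [b])"
  "ren_step 9 b = (if b then 10 else 3, [b])"
  "ren_step 10 b = (9, [b])"
  by (simp_all add: ren_step_def)

definition ren_code :: "bool list \<Rightarrow> bool list" where
  "ren_code = transduce ren_step (\<lambda>_. []) 0"

lemma expr_ren_code: "expr m f \<Longrightarrow> expr m (\<lambda>\<rho>. ren_code (f \<rho>))"
  unfolding ren_code_def by (rule fp1D, rule fp1_transduce[of 11]) (auto simp: ren_step_def)

lemma ren_code: "ren_code (enc_dims ms @ enc_form p) = enc_form (ren p)"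
proof -
  let ?R = "transduce ren_step (\<lambda>_. [])"
  have 1: "?R (Suc 0) (tok bs @ r) = ?R 0 r" for bs r by (induction bs) auto
  have 8: "?R 8 (tok bs @ r) = tok bs @ ?R 9 r" for bs r by (induction bs) auto
  have 9: "?R 9 (tok bs @ r) = tok bs @ ?R 3 r" for bs r by (induction bs) auto
  have 6: "?R 6 (tok bs @ r) = tok bs @ (if bs = [] then [True, True] else []) @ ?R 9 r" for bs r
    by (cases bs) (auto simp: 8)
  have bin: "bin i = [] \<longleftrightarrow> i = 0" for i by (cases "i = 0") (auto simp: bin_pos)
  have 3: "?R 3 (enc_form p @ r) = enc_form (ren p) @ ?R 3 r" for r
  proof (induction p arbitrary: r)
    case (Var i j)
    then show ?case by (cases "i = 0") (simp_all add: enc_nat_tok 6 9 bin bin_odd)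
  qed auto
  have "?R 0 (enc_dims ms @ r) = ?R 3 r" for r by (induction ms) (auto simp: 1 enc_nat_tok)
  then show ?thesis using 3[of "[]"] by (simp add: ren_code_def)
qed

definition dim_step :: "nat \<Rightarrow> bool \<Rightarrow> nat \<times> bool list" where
  "dim_step q b = (if q = 0 then (if b then 1 else 3, [])
     else if q = 1 then (if b then 2 else 3, [b])
     else if q = 2 then (1, [b]) else (3, []))"

lemma dim_step_simps [simp]:
  "dim_step 0 b = (if b then 1 else 3, [])"
  "dim_step (Suc 0) b = (if b then 2 else 3, [b])"
  "dim_step 2 b = (1, [b])"
  "dim_step 3 b = (3, [])"
  by (simp_all add: dim_step_def)

definition first_dim :: "bool list \<Rightarrow> bool list" where
  "first_dim = transduce dim_step (\<lambda>_. []) 0"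

lemma expr_first_dim: "expr m f \<Longrightarrow> expr m (\<lambda>\<rho>. first_dim (f \<rho>))"
  unfolding first_dim_def by (rule fp1D, rule fp1_transduce[of 4]) (auto simp: dim_step_def)

lemma first_dim: "first_dim (enc_dims (m # ms) @ r) = tok (bin m)"
proof -
  have 3: "transduce dim_step (\<lambda>_. []) 3 r = []" for r by (induction r) auto
  have "transduce dim_step (\<lambda>_. []) (Suc 0) (tok bs @ r) = tok bs" for bs r
    by (induction bs) (auto simp: 3)
  then show ?thesis by (simp add: first_dim_def enc_nat_tok)
qed

definition bits_step :: "nat \<Rightarrow> bool \<Rightarrow> nat \<times> bool list" where
  "bits_step q b = (if q = 0 then (if b then 1 else 2, [])
     else if q = 1 then (0, [b]) else (2, []))"

lemma bits_step_simps [simp]: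
  "bits_step 0 b = (if b then 1 else 2, [])"
  "bits_step (Suc 0) b = (0, [b])"
  "bits_step 2 b = (2, [])"
  by (simp_all add: bits_step_def)

definition tok_bits :: "bool list \<Rightarrow> bool list" where
  "tok_bits = transduce bits_step (\<lambda>_. []) 0"

lemma expr_tok_bits: "expr m f \<Longrightarrow> expr m (\<lambda>\<rho>. tok_bits (f \<rho>))"
  unfolding tok_bits_def by (rule fp1D, rule fp1_transduce[of 3]) (auto simp: bits_step_def)

lemma tok_bits: "tok_bits (tok bs) = bs"
  by (induction bs) (auto simp: tok_bits_def)

text \<open>As many binary ones as the argument has bits: a number at least as large as every
  dimension that fits into a code of this length, and one that can be written without
  arithmetic.\<close>

definition ones :: "bool list \<Rightarrow> bool list" where
  "ones = transduce (\<lambda>q b. (0, [True, True])) (\<lambda>_. [False]) 0"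

lemma expr_ones: "expr m f \<Longrightarrow> expr m (\<lambda>\<rho>. ones (f \<rho>))"
  unfolding ones_def by (rule fp1D, rule fp1_transduce[of 1]) auto

lemma bin_ones: "bin (2 ^ k - 1) = replicate k True"
proof (induction k)
  case (Suc k)
  have "2 ^ Suc k - 1 = Suc (2 * (2 ^ k - 1))" 
  proof -
    have "0 < (2 :: nat) ^ k" by simp
    then obtain c where "2 ^ k = Suc c" using gr0_implies_Suc by blast
    then show ?thesis by simp
  qed
  then show ?case using Suc by (simp add: bin_odd)
qed simp

lemma ones: "ones xs = enc_nat (2 ^ length xs - 1)"
  unfolding enc_nat_tok bin_ones by (induction xs) (auto simp: ones_def)

text \<open>The emitted literals are the codes of \<open>And\<close>, \<open>Neg\<close>, \<open>Var\<close>, the block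
  index 0 and the lowest bit \<open>c\<close> of the variable index.\<close>

definition clause_step :: "bool \<Rightarrow> nat \<Rightarrow> bool \<Rightarrow> nat \<times> bool list" where
  "clause_step c q b = (if q = 0 then
       (if b then 1 else 0, [True, False, False, True, False, False, False, True, c, b])
     else if q = 1 then (2, [b]) else (if b then 1 else 0, [b]))"

lemma clause_step_simps [simp]:
  "clause_step c 0 b = (if b then 1 else 0, [True, False, False, True, False, False, False, True, c, b])"
  "clause_step c (Suc 0) b = (2, [b])"
  "clause_step c 2 b = (if b then 1 else 0, [b])"
  by (simp_all add: clause_step_def)

definition clauses :: "bool \<Rightarrow> bool list \<Rightarrow> bool list" where
  "clauses c = transduce (clause_step c) (\<lambda>_. []) 0"

lemma expr_clauses: "expr m f \<Longrightarrow> expr m (\<lambda>\<rho>. clauses c (f \<rho>))"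
  unfolding clauses_def by (rule fp1D, rule fp1_transduce[of 3]) (auto simp: clause_step_def)

text \<open>The code of 0 is empty, so for \<open>c = False\<close> and \<open>i = 0\<close> the
  prefixed bit would be a leading zero and no canonical numeral; the assumption excludes this
  case.\<close>

lemma clauses:
  assumes "\<And>i. i \<in> set is \<Longrightarrow> 0 < of_bool c + 2 * i"
  shows "clauses c (concat (map enc_nat is)) @ enc_form p = enc_form (force (of_bool c) is p)"
  using assms
proof (induction "is")
  case (Cons i "is")
  let ?C = "transduce (clause_step c) (\<lambda>_. [])"
  have 2: "?C 2 (tok bs @ r) = tok bs @ ?C 0 r" for bs r by (induction bs) auto
  have 0: "?C 0 (tok bs @ r) = [True, False, False, True, False, False, False, True, c] @ tok bs @ ?C 0 r" for bs r
    by (cases bs) (auto simp: 2)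
  have "bin (of_bool c + 2 * i) = c # bin i"
    using Cons.prems[of i] by (cases c) (auto simp: bin_odd bin_even)
  then show ?case using Cons by (simp add: clauses_def enc_nat_tok 0)
qed (simp add: clauses_def)

section \<open>Counting in binary and in unary\<close>

definition inc_step :: "nat \<Rightarrow> bool \<Rightarrow> nat \<times> bool list" where
  "inc_step q b = (if q = 0 then if b then (1, []) else (4, [True, True, False])
     else if q = 1 then if b then (0, [True, False]) else (2, [True, True])
     else if q = 2 then (if b then 3 else 4, [b])
     else if q = 3 then (2, [b]) else (4, []))"

lemma inc_step_simps [simp]:
  "inc_step 0 b = (if b then (1, []) else (4, [True, True, False]))"
  "inc_step (Suc 0) b = (if b then (0, [True, False]) else (2, [True, True]))"
  "inc_step 2 b = (if b then 3 else 4, [b])"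
  "inc_step 3 b = (2, [b])"
  "inc_step 4 b = (4, [])"
  by (simp_all add: inc_step_def)

definition inc_end :: "nat \<Rightarrow> bool list" where
  "inc_end q = (if q = 0 \<or> q = 1 then [True, True, False]
     else if q = 2 then [False] else if q = 3 then [False, False] else [])"

lemma inc_end_simps [simp]:
  "inc_end 0 = [True, True, False]"
  "inc_end (Suc 0) = [True, True, False]"
  "inc_end 2 = [False]"
  "inc_end 3 = [False, False]"
  "inc_end 4 = []"
  by (simp_all add: inc_end_def)

text \<open>Truncated input is completed, so that the output is the code of a number for every input;
  the bound on the length of \<open>count_up\<close> for arbitrary arguments relies on this.\<close>

definition inc :: "bool list \<Rightarrow> bool list" where
  "inc = transduce inc_step inc_end 0"

lemma expr_inc: "expr m f \<Longrightarrow> expr m (\<lambda>\<rho>. inc (f \<rho>))"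
  unfolding inc_def by (rule fp1D, rule fp1_transduce[of 5]) (auto simp: inc_step_def)

fun binc :: "bool list \<Rightarrow> bool list" where
  "binc [] = [True]"
| "binc (b # bs) = (if b then False # binc bs else True # bs)"

lemma length_binc: "length (binc bs) \<le> Suc (length bs)"
  by (induction bs) auto

lemma binc_bin: "binc (bin n) = bin (Suc n)"
proof (induction n rule: less_induct)
  case (less n)
  show ?case
  proof (cases "n = 0")
    case True
    then show ?thesis by (simp add: bin_pos)
  next
    case False
    then show ?thesis using less[of "n div 2"] by (auto simp: bin_pos[of n] bin_pos[of "Suc n"] elim!: oddE evenE)
  qed
qed

lemma transduce_inc_sink: "transduce inc_step inc_end 4 r = []"
  by (induction r) auto

lemma transduce_inc_copy: "transduce inc_step inc_end 2 (tok bs @ r) = tok bs"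
  by (induction bs) (auto simp: transduce_inc_sink)

text \<open>States 0 and 1 propagate the carry, 2 and 3 copy the digits above it, and 4 discards
  whatever follows the first token.\<close>

lemma inc_tok: "inc (tok bs @ r) = tok (binc bs)"
  unfolding inc_def by (induction bs) (auto simp: transduce_inc_sink transduce_inc_copy)

lemma inc_is_tok: "\<exists>bs. inc a = tok bs \<and> 2 * length bs \<le> length a + 2"
proof -
  let ?I = "transduce inc_step inc_end"
  have 2: "\<exists>bs. ?I 2 a = tok bs \<and> 2 * length bs \<le> length a + 1" for a
  proof (induction a rule: induct_list012)
    case 1
    show ?case by (intro exI[of _ "[]"]) simp
  next
    case (2 x)
    show ?case by (cases x) (auto simp: transduce_inc_sink intro: exI[of _ "[]"] exI[of _ "[False]"])
  next
    case (3 x y zs)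
    then obtain bs where "?I 2 zs = tok bs \<and> 2 * length bs \<le> length zs + 1" by blast
    then show ?case by (cases x) (auto simp: transduce_inc_sink intro: exI[of _ "[]"] exI[of _ "y # bs"])
  qed
  show ?thesis unfolding inc_def
  proof (induction a rule: induct_list012)
    case 1
    show ?case by (intro exI[of _ "[True]"]) simp
  next
    case (2 x)
    show ?case by (cases x) (auto simp: transduce_inc_sink intro: exI[of _ "[True]"])
  next
    case (3 x y zs)
    then obtain bs where "?I 0 zs = tok bs \<and> 2 * length bs \<le> length zs + 2" by blast
    moreover obtain bs' where "?I 2 zs = tok bs' \<and> 2 * length bs' \<le> length zs + 1" using 2 by blast
    ultimately show ?case
      by (cases x; cases y) (auto simp: transduce_inc_sink intro: exI[of _ "[True]"] exI[of _ "False # bs"] exI[of _ "True # bs'"])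
  qed
qed

definition count_up :: "bool list \<Rightarrow> bool list \<Rightarrow> bool list" where
  "count_up xs a = fold (\<lambda>_ a. inc a @ a) xs a"

text \<open>Each round increments the numeral in front and puts the result before it, hence the
  descending order, which \<open>guard\<close> and \<open>combine\<close> adopt by
  \<open>rev\<close>. The start value is part of the output, so there is one numeral more than there
  are list entries.\<close>

lemma count_up: "count_up xs (tok (bin m)) = concat (map enc_nat (rev [m..<Suc (m + length xs)]))"
proof -
  have "fold (\<lambda>_ a. inc a @ a) xs (tok (bin m) @ r) = concat (map enc_nat (rev [m..<Suc (m + length xs)])) @ r" for r
  proof (induction xs arbitrary: m r)
    case (Cons x xs)
    have "[m..<Suc (m + length (x # xs))] = m # [Suc m..<Suc (Suc m + length xs)]"
      by (subst upt_conv_Cons) (simp_all del: upt_Suc)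
    then show ?case using Cons[of "Suc m" "tok (bin m) @ r"]
      by (simp add: inc_tok binc_bin enc_nat_tok del: upt_Suc)
  qed (simp add: enc_nat_tok)
  from this[of "[]"] show ?thesis by (simp add: count_up_def)
qed

text \<open>The leading token grows by at most two bits per round, so the total length grows
  quadratically. The argument is arbitrary because \<open>fp3_fold\<close> requires its bound for
  all start values.\<close>

lemma length_count_up: "length (count_up xs a) \<le> length a + length a + 3 + length xs * (length a + 3 + 2 * length xs)"
proof -
  have *: "length (fold (\<lambda>_ a. inc a @ a) xs (tok bs @ r)) \<le>
     length r + length (tok bs) + length xs * (length (tok bs) + 2 * length xs)" for xs bs r
  proof (induction xs arbitrary: bs r)
    case (Cons x xs)
    have "length (tok (binc bs)) \<le> length (tok bs) + 2" using length_binc[of bs] by simp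
    moreover from this have "length xs * (length (tok (binc bs)) + 2 * length xs)
        \<le> length xs * (length (tok bs) + 2 + 2 * length xs)" by (intro mult_le_mono2) simp
    ultimately show ?case using Cons[of "binc bs" "tok bs @ r"] by (simp add: inc_tok algebra_simps)
  qed simp
  show ?thesis
  proof (cases xs)
    case (Cons x ys)
    \<comment> \<open>After the first round the accumulator begins with a token, whatever
      \<open>a\<close> is, and the bound for tokens applies with \<open>a\<close> as the
      remainder.\<close>
    obtain bs where bs: "inc a = tok bs" "2 * length bs \<le> length a + 2" using inc_is_tok by blast
    have "length ys * (length (tok bs) + 2 * length ys) \<le> length xs * (length a + 3 + 2 * length xs)"
      using bs Cons by (intro mult_mono) auto
    then show ?thesis using *[of ys bs a] bs Cons by (simp add: count_up_def)
  qed (simp add: count_up_def)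
qed

lemma expr_count_up: "expr m f \<Longrightarrow> expr m g \<Longrightarrow> expr m (\<lambda>\<rho>. count_up (f \<rho>) (g \<rho>))"
proof -
  have "fp3 (\<lambda>xs a y. fold (\<lambda>b a. (\<lambda>b a y. inc a @ a) b a y) xs a)"
  proof (rule fp3_fold)
    show "fp2 (\<lambda>a y. inc a @ a)" for b :: bool by (intro fp2_exprI expr_append expr_inc)
    show "ispoly (\<lambda>n. n + n + 3 + n * (n + 3 + 2 * n))" by (intro ispoly.intros)
    fix xs a y :: "bool list"
    let ?n = "length xs + length a + length y"
    have "length xs * (length a + 3 + 2 * length xs) \<le> ?n * (?n + 3 + 2 * ?n)" by (intro mult_mono) auto
    then show "length (fold (\<lambda>b a. inc a @ a) xs a) \<le> ?n + ?n + 3 + ?n * (?n + 3 + 2 * ?n)"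
      using length_count_up[of xs a] unfolding count_up_def by linarith
  qed
  from fp3D[OF this _ _ expr_const[of _ "[]"]] show "expr m f \<Longrightarrow> expr m g \<Longrightarrow> ?thesis"
    by (simp add: count_up_def)
qed

text \<open>A step of the Horner scheme on unary numbers, frozen as soon as the length of
  \<open>y\<close> is reached.\<close>

definition unary_step :: "bool \<Rightarrow> bool list \<Rightarrow> bool list \<Rightarrow> bool list" where
  "unary_step b u y = (if drop (length u) y = [] then u else if b then True # u @ u else u @ u)"

text \<open>The cap \<open>y\<close> is needed because the value is exponential in the number of bits.\<close>

definition unary :: "bool list \<Rightarrow> bool list \<Rightarrow> bool list" where
  "unary bs y = fold (\<lambda>b u. unary_step b u y) (rev bs) []"

lemma unary: "if val bs < length y then length (unary bs y) = val bs else length y \<le> length (unary bs y)"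
proof (induction bs)
  case (Cons b bs)
  have "unary (b # bs) y = unary_step b (unary bs y) y" by (simp add: unary_def)
  then show ?case using Cons by (auto simp: unary_step_def split: if_splits)
qed (auto simp: unary_def)

lemma expr_unary: "expr m f \<Longrightarrow> expr m g \<Longrightarrow> expr m (\<lambda>\<rho>. unary (f \<rho>) (g \<rho>))"
proof -
  have "fp3 (\<lambda>xs a y. fold (\<lambda>b a. unary_step b a y) xs a)"
  proof (rule fp3_fold)
    show "fp2 (unary_step b)" for b
    proof (rule fp2_exprI)
      fix m f g assume "expr m f" "expr m g"
      then show "expr m (\<lambda>\<rho>. unary_step b (f \<rho>) (g \<rho>))"
        unfolding unary_step_def
        by (cases b; simp only: if_True if_False; intro expr_if expr_drop expr_cons expr_append)
    qed
    show "ispoly (\<lambda>n. n + 2 * n)" by (intro ispoly.intros)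
    fix xs a y :: "bool list"
    have "length (fold (\<lambda>b a. unary_step b a y) xs a) \<le> max (length a) (2 * length y)"
    proof (induction xs arbitrary: a)
      case (Cons b xs)
      have "length (unary_step b a y) \<le> max (length a) (2 * length y)" by (auto simp: unary_step_def)
      then show ?case using Cons[of "unary_step b a y"] by simp
    qed simp
    then show "length (fold (\<lambda>b a. unary_step b a y) xs a) \<le>
       length xs + length a + length y + 2 * (length xs + length a + length y)" by simp
  qed
  from fp3D[OF this _ expr_const[of _ "[]"]] show "expr m f \<Longrightarrow> expr m g \<Longrightarrow> ?thesis"
    by (simp add: unary_def expr_rev)
qed

text \<open>Dropping \<open>m\<close> entries from \<open>xs\<close> both tests for
  \<open>m < X\<close>, where \<open>X\<close> is the length of \<open>xs\<close>, and leaves a list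
  of length \<open>X - m\<close>, exactly what \<open>count_up\<close> needs to get from
  \<open>m\<close> to \<open>X\<close>. The word \<open>w\<close> is a prefix for the formula code:
  empty, or the code of \<open>Neg\<close>.\<close>

definition guard_code :: "bool list \<Rightarrow> bool list \<Rightarrow> bool list \<Rightarrow> bool list \<Rightarrow> bool list" where
  "guard_code w xs d r = (if drop (length (unary (tok_bits d) xs)) xs = [] then enc_form contradiction
     else clauses True (count_up (drop (length (unary (tok_bits d) xs)) xs) d) @ w @ r)"

lemma guard_code:
  "guard_code w xs (tok (bin m)) r = (if m < length xs
     then clauses True (concat (map enc_nat (rev [m..<Suc (length xs)]))) @ w @ r else enc_form contradiction)"
  using unary[of "bin m" xs] by (auto simp: guard_code_def tok_bits count_up simp del: upt_Suc split: if_splits)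

fun repeat :: "nat \<Rightarrow> bool list \<Rightarrow> bool list" where
  "repeat 0 x = []"
| "repeat (Suc k) x = x @ repeat k x"

lemma expr_repeat: "expr m f \<Longrightarrow> expr m (\<lambda>\<rho>. repeat k (f \<rho>))"
  by (induction k) (auto intro: expr_const expr_append)

text \<open>Of the first three bits, one announces a dimension and two are a lowest digit 0, which
  doubles the numeral \<open>X + 1\<close> that follows; \<open>inc\<close> obtains this from the
  leading numeral \<open>X\<close> of \<open>count_up\<close>. The eight-bit constants are the codes
  of \<open>Or\<close>, \<open>And\<close>, \<open>Var 0 0\<close> and of \<open>And\<close>,
  \<open>Neg\<close>, \<open>Var 0 0\<close>.\<close>

definition combine_code :: "nat \<Rightarrow> bool list \<Rightarrow> bool list \<Rightarrow> bool list" where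
  "combine_code n s t =
     [True, True, False] @ inc (count_up (s @ t) [False]) @ repeat (n - 1) (True # ones (s @ t)) @ [False] @
     clauses False (count_up (tl (s @ t)) (tok [True])) @
     [True, True, True, False, False, False, False, False] @
     guard_code [] (s @ t) (first_dim s) (ren_code s) @
     [True, False, False, True, False, False, False, False] @
     guard_code [False, True] (s @ t) (first_dim t) (ren_code t)"

lemma expr_combine_code: "expr m f \<Longrightarrow> expr m g \<Longrightarrow> expr m (\<lambda>\<rho>. combine_code n (f \<rho>) (g \<rho>))"
  unfolding combine_code_def guard_code_def
  by (intro expr_append expr_const expr_inc expr_count_up expr_repeat expr_cons expr_ones expr_clauses expr_tl
      expr_if expr_drop expr_unary expr_tok_bits expr_first_dim expr_ren_code)

lemma enc_guard: "enc_form (guard (length xs) m p) = guard_code [] xs (tok (bin m)) (enc_form p)"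
  using clauses[of "rev [m..<Suc (length xs)]" True p]
  by (auto simp: guard_def guard_code simp del: upt_Suc)

lemma guard_code_prefix: "guard_code w xs d r = guard_code [] xs d (w @ r)"
  by (simp add: guard_code_def)

lemma combine_code:
  assumes "n \<ge> 1" and s: "s = enc_inst (ms, p)" and t: "t = enc_inst (ms', q)"
    and wf: "wf_inst n (ms, p)" "wf_inst n (ms', q)" and X: "X = length s + length t"
  shows "combine_code n s t = enc_inst (combine n X (2 ^ X - 1) (ms, p) (ms', q))"
proof -
  obtain m ls where ms: "ms = m # ls" using wf(1) \<open>n \<ge> 1\<close> by (cases ms) (auto simp: wf_inst_def)
  obtain m' ls' where ms': "ms' = m' # ls'" using wf(2) \<open>n \<ge> 1\<close> by (cases ms') (auto simp: wf_inst_def)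
  have X': "X = length (s @ t)" "1 \<le> X" by (auto simp: X s enc_inst_eq ms)
  have fd: "first_dim s = tok (bin m)" "first_dim t = tok (bin m')"
    by (simp_all only: s t enc_inst_eq ms ms' first_dim)
  have rc: "ren_code s = enc_form (ren p)" "ren_code t = enc_form (ren q)"
    by (simp_all only: s t enc_inst_eq ren_code)
  have b01: "tok (bin 0) = [False]" "tok (bin 1) = tok [True]" by (simp_all add: bin_pos)
  \<comment> \<open>Counting up to \<open>X\<close> takes one increment less from 1 than from 0;
    hence \<open>tl\<close>.\<close>
  have len: "0 + length (s @ t) = X" "1 + length (tl (s @ t)) = X" using X' by simp_all
  have c0: "count_up (s @ t) [False] = concat (map enc_nat (rev [0..<Suc X]))"
    and c1: "count_up (tl (s @ t)) (tok [True]) = concat (map enc_nat (rev [1..<Suc X]))"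
    using count_up[of "s @ t" 0] count_up[of "tl (s @ t)" 1] by (simp_all only: len b01)
  have E1: "inc (count_up (s @ t) [False]) = enc_nat (Suc X)"
    unfolding c0 by (simp add: enc_nat_tok inc_tok binc_bin)
  have E2: "True # False # enc_nat (Suc X) = enc_nat (2 * Suc X)"
    using bin_even[of "Suc X"] by (simp add: enc_nat_tok)
  have E3: "repeat k (True # ones (s @ t)) @ [False] = enc_dims (replicate k (2 ^ X - 1))" for k
    by (induction k) (simp_all add: ones X')
  have E4: "clauses False (count_up (tl (s @ t)) (tok [True])) @ enc_form r = enc_form (force 0 (rev [1..<Suc X]) r)" for r
    unfolding c1 using clauses[of "rev [1..<Suc X]" False r] by (auto simp del: upt_Suc)
  have E5: "guard_code [] (s @ t) (first_dim s) (ren_code s) = enc_form (guard X m (ren p))"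
    using enc_guard[of "s @ t" m "ren p"] unfolding fd(1) rc(1) X'(1) by simp
  have E6: "guard_code [False, True] (s @ t) (first_dim t) (ren_code t) = enc_form (guard X m' (Neg (ren q)))"
    using enc_guard[of "s @ t" m' "Neg (ren q)"] unfolding fd(2) rc(2) X'(1)
    by (simp add: guard_code_prefix[of "[False, True]"])
  define r where "r = Or (And (Var 0 0) (guard X m (ren p))) (And (Neg (Var 0 0)) (guard X m' (Neg (ren q))))"
  have "combine_code n s t = True # (True # False # inc (count_up (s @ t) [False])) @
      (repeat (n - 1) (True # ones (s @ t)) @ [False]) @
      (clauses False (count_up (tl (s @ t)) (tok [True])) @ enc_form r)"
    by (simp add: combine_code_def E5 E6 r_def enc_nat_tok)
  also have "\<dots> = enc_dims (2 * Suc X # replicate (n - 1) (2 ^ X - 1)) @ enc_form (force 0 (rev [1..<Suc X]) r)"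
    unfolding E1 E2 E3 E4 by (simp only: enc_dims_simps append_Cons append_assoc)
  finally show ?thesis by (simp only: combine_def prod.case r_def enc_inst_eq ms ms' list.sel)
qed

lemma val_less: "val bs < 2 ^ length bs"
  by (induction bs) (auto simp: of_bool_def)

lemma dims_less:
  assumes "m \<in> set ms" "length (enc_inst (ms, p)) \<le> X"
  shows "m \<le> 2 ^ X - 1"
proof -
  have "length (bin m) \<le> length (enc_dims ms)"
    using assms(1) by (induction ms) (auto simp: enc_nat_tok)
  then have "length (bin m) \<le> X" using assms(2) by (simp add: enc_inst_eq)
  then have "(2 :: nat) ^ length (bin m) \<le> 2 ^ X" by (rule power_increasing) simp
  then have "m < 2 ^ X" by (rule order.strict_trans2[rotated]) (use val_less[of "bin m"] in simp)
  then show ?thesis by linarith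
qed

text \<open>A nonempty proper subset of the two bits is a singleton. Both \<open>s\<close> and
  \<open>t\<close> must then code instances that keep their promise, as all other strings have value
  \<open>UNIV\<close>. So \<open>combine_code\<close> never has to recognize malformed codes or
  broken promises.\<close>

lemma UVAL_combine_code:
  assumes n: "n \<ge> 1" and x: "\<phi> \<noteq> {}" and st: "USAT n s \<subseteq> \<phi>" "coUSAT n t \<subseteq> \<phi>"
  shows "UVAL n (combine_code n s t) \<subseteq> \<phi>"
proof (cases "\<phi> = UNIV")
  case False
  then obtain c where c: "c \<notin> \<phi>" by auto
  define b where "b = (\<not> c)"
  have "y = b" if "y \<in> \<phi>" for y using c that unfolding b_def by (cases y; cases c) auto
  then have \<phi>: "\<phi> = {b}" using x by blast
  have "USAT n s \<noteq> UNIV" "coUSAT n t \<noteq> UNIV" using st False by auto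
  moreover have "USAT n s = UNIV" if "\<nexists>ms p. decode n s = Some (ms, p) \<and> card (wit_set ms (eval p)) \<le> 1"
    using that by (simp add: USAT_def split: option.split)
  moreover have "coUSAT n t = UNIV" if "\<nexists>ms p. decode n t = Some (ms, p) \<and> card (cowit_set ms (eval p)) \<le> 1"
    using that by (simp add: coUSAT_def split: option.split)
  ultimately obtain ms p ms' q where f: "decode n s = Some (ms, p)" "card (wit_set ms (eval p)) \<le> 1"
    and g: "decode n t = Some (ms', q)" "card (cowit_set ms' (eval q)) \<le> 1"
    by metis
  have b: "sat ms (eval p) = b" "nsat ms' (eval q) = b" using st f g by (simp_all add: \<phi> USAT_def coUSAT_def)
  note wf = decode_SomeD[OF f(1)] decode_SomeD[OF g(1)]
  let ?X = "length s + length t"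
  have len: "length (enc_inst (ms, p)) \<le> ?X" "length (enc_inst (ms', q)) \<le> ?X" using wf by auto
  \<comment> \<open>The bound is strict because the code of the dimensions contributes at least one
    bit.\<close>
  have small: "card (vset p) < ?X" "card (vset q) < ?X"
    using card_vset[of p] card_vset[of q] len wf(2,4) by (auto simp: enc_inst_eq enc_dims_def)
  have "1 \<le> ?X" using small by linarith
  then have "(2 :: nat) ^ 1 \<le> 2 ^ ?X" by (rule power_increasing) simp
  then have "1 \<le> (2 :: nat) ^ ?X - 1" by simp
  have "UVAL n (combine_code n s t) = {b}"
    unfolding combine_code[OF n wf(2,4) wf(1,3) refl]
    using dims_less[OF _ len(1)] dims_less[OF _ len(2)] small f(2) g(2) b
    by (intro UVAL_combine[OF n \<open>1 \<le> ?X\<close> \<open>1 \<le> 2 ^ ?X - 1\<close> wf(1,3)]) auto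
  then show ?thesis by (simp add: \<phi>)
qed simp

section \<open>Composing reductions, and the two inclusions\<close>

lemma preduces_trans_fp1:
  assumes "\<phi> \<propto> \<psi>" and F: "fp1 F" "\<And>x. x \<noteq> [] \<Longrightarrow> F x \<noteq> []"
    and sub: "\<And>x. \<psi>' (F x) \<subseteq> \<psi> x"
  shows "\<phi> \<propto> \<psi>'"
proof -
  obtain \<mu> where \<mu>: "poly_time_computable \<mu>" "\<And>x. x \<noteq> [] \<Longrightarrow> \<mu> x \<noteq> [] \<and> \<psi> (\<mu> x) \<subseteq> \<phi> x"
    using assms(1) unfolding preduces_def by blast
  let ?G = "\<lambda>x. F (if x = [] then [] else \<mu> x)"
  have "fp1 ?G" by (intro fp1_exprI fp1D[OF F(1)] fp1D[OF fp1_tm[OF \<mu>(1)]])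
  then have "poly_time_computable ?G" by (rule fp1_poly_time)
  then show ?thesis unfolding preduces_def using \<mu>(2) F(2) sub by (intro exI[of _ ?G]) fastforce
qed

text \<open>The inserted word is the code of \<open>And\<close> followed by that of
  \<open>Var 0 0\<close>. Codes are in prefix notation, so the old formula becomes the second
  operand without being parsed.\<close>

lemma UVAL_to_USAT:
  assumes "n \<ge> 1"
  shows "USAT n (insert_after_dims [True, False, False, False, False, False] s) \<subseteq> UVAL n s"
proof (cases "decode n s")
  case (Some I)
  obtain ms p where I: "I = (ms, p)" by fastforce
  note wf = decode_SomeD[OF Some[unfolded I]]
  have "insert_after_dims [True, False, False, False, False, False] s = enc_inst (ms, And (Var 0 0) p)"
    by (simp add: wf(2) enc_inst_eq insert_after_dims enc_nat_tok)
  then show ?thesis using USAT_And_first[OF wf(1) assms] wf(2) by simp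
qed (simp add: UVAL_def)

text \<open>The inserted word codes \<open>Neg\<close>, \<open>And\<close>, \<open>Neg\<close> and
  \<open>Var 0 0\<close> in prefix notation.\<close>

lemma UVAL_to_coUSAT:
  assumes "n \<ge> 1"
  shows "coUSAT n (insert_after_dims [False, True, True, False, False, True, False, False, False, False] s) \<subseteq> UVAL n s"
proof (cases "decode n s")
  case (Some I)
  obtain ms p where I: "I = (ms, p)" by fastforce
  note wf = decode_SomeD[OF Some[unfolded I]]
  have "insert_after_dims [False, True, True, False, False, True, False, False, False, False] s
      = enc_inst (ms, Neg (And (Neg (Var 0 0)) p))"
    by (simp add: wf(2) enc_inst_eq insert_after_dims enc_nat_tok)
  then show ?thesis using coUSAT_Neg_And_first[OF wf(1) assms] wf(2) by simp
qed (simp add: UVAL_def)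

theorem theorem10:
  fixes n :: nat
  assumes "n \<ge> 1"
  shows "pclass (UVAL n) = pclass (USAT n) \<inter> pclass (coUSAT n)"
proof (intro equalityI subsetI)
  fix \<phi> assume "\<phi> \<in> pclass (UVAL n)"
  then have \<phi>: "promise_problem \<phi>" "\<phi> \<propto> UVAL n" by (auto simp: pclass_def)
  have "\<phi> \<propto> USAT n" "\<phi> \<propto> coUSAT n"
    using preduces_trans_fp1[OF \<phi>(2) fp1_insert_after_dims insert_after_dims_nonempty]
      UVAL_to_USAT[OF assms] UVAL_to_coUSAT[OF assms] by blast+
  then show "\<phi> \<in> pclass (USAT n) \<inter> pclass (coUSAT n)" using \<phi> by (simp add: pclass_def)
next
  fix \<phi> assume "\<phi> \<in> pclass (USAT n) \<inter> pclass (coUSAT n)"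
  then have pp: "promise_problem \<phi>" and "\<phi> \<propto> USAT n" "\<phi> \<propto> coUSAT n" by (auto simp: pclass_def)
  then obtain \<mu> \<nu> where \<mu>: "poly_time_computable \<mu>" "\<And>x. x \<noteq> [] \<Longrightarrow> USAT n (\<mu> x) \<subseteq> \<phi> x"
    and \<nu>: "poly_time_computable \<nu>" "\<And>x. x \<noteq> [] \<Longrightarrow> coUSAT n (\<nu> x) \<subseteq> \<phi> x"
    unfolding preduces_def by metis
  let ?F = "\<lambda>x. combine_code n (if x = [] then [] else \<mu> x) (if x = [] then [] else \<nu> x)"
  have "fp1 ?F" by (intro fp1_exprI expr_combine_code fp1D[OF fp1_tm[OF \<mu>(1)]] fp1D[OF fp1_tm[OF \<nu>(1)]])
  then have "poly_time_computable ?F" by (rule fp1_poly_time)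
  moreover have "UVAL n (?F x) \<subseteq> \<phi> x" if "x \<noteq> []" for x
    using that pp \<mu>(2) \<nu>(2) UVAL_combine_code[OF assms] by (simp add: promise_problem_def)
  ultimately have "\<phi> \<propto> UVAL n" unfolding preduces_def
    by (intro exI[of _ ?F]) (simp add: combine_code_def)
  then show "\<phi> \<in> pclass (UVAL n)" using pp by (simp add: pclass_def)
qed

end
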